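(* Let $\alpha,\beta\in\mathbb{C}$. (i) Let $n\ge1$ and let $\mu$ be a partition with $l(\mu)\le 2n$, regarded as having $2n$ parts (zeros allowed). Then $$\frac{1}{\int_T\tilde\Delta_K^{(n)}(x;1,-1,\sqrt t,-\sqrt t;t)dT}\int_T P_\mu(x_1^{\pm1},\dots,x_n^{\pm1};t)\,\tilde\Delta_K^{(n)}(x;1,-1,\sqrt t,-\sqrt t;t)\prod_{i=1}^n(1-\alpha x_i^{\pm1})(1-\beta x_i^{\pm1})\,dT$$ $$+\frac{(1-\alpha^2)(1-\beta^2)}{\int_T\tilde\Delta_K^{(n-1)}(x;t,-t,\sqrt t,-\sqrt t;t)dT}\int_T P_\mu(x_1^{\pm1},\dots,x_{n-1}^{\pm1},1,-1;t)\,\tilde\Delta_K^{(n-1)}(x;t,-t,\sqrt t,-\sqrt t;t)\prod_{i=1}^{n-1}(1-\alpha x_i^{\pm1})(1-\beta x_i^{\pm1})\,dT$$ $$=\frac{2\phi_{2n}(t)}{v_\mu(t)(1-t)^{2n}}\Big(\prod_{i\ge0}H_{m_{2i}(\mu)}(\alpha\beta;t)\prod_{i\ge0}H_{m_{2i+1}(\mu)}(\beta/\alpha;t)\Big)(-\alpha)^{\#\text{ of odd parts of }\mu}.$$ (ii) Let $n\ge0$ and let $\mu$ be a partition with $l(\mu)\le 2n+1$, regarded as having $2n+1$ parts (zeros allowed). Then $$\frac{(1-\alpha)(1-\beta)}{\int_T\tilde\Delta_K^{(n)}(x;t,-1,\sqrt t,-\sqrt t;t)dT}\int_T P_\mu(x_1^{\pm1},\dots,x_n^{\pm1},1;t)\,\tilde\Delta_K^{(n)}(x;t,-1,\sqrt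 t,-\sqrt t;t)\prod_{i=1}^n(1-\alpha x_i^{\pm1})(1-\beta x_i^{\pm1})\,dT$$ $$+\frac{(1+\alpha)(1+\beta)}{\int_T\tilde\Delta_K^{(n)}(x;1,-t,\sqrt t,-\sqrt t;t)dT}\int_T P_\mu(x_1^{\pm1},\dots,x_n^{\pm1},-1;t)\,\tilde\Delta_K^{(n)}(x;1,-t,\sqrt t,-\sqrt t;t)\prod_{i=1}^n(1-\alpha x_i^{\pm1})(1-\beta x_i^{\pm1})\,dT$$ $$=\frac{2\phi_{2n+1}(t)}{v_\mu(t)(1-t)^{2n+1}}\Big(\prod_{i\ge0}H_{m_{2i}(\mu)}(\alpha\beta;t)\prod_{i\ge0}H_{m_{2i+1}(\mu)}(\beta/\alpha;t)\Big)(-\alpha)^{\#\text{ of odd parts of }\mu}.$$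
   Context: Let $t\in\mathbb{C}$ with $|t|<1$ and fix a square root $\sqrt t$. $T=\{(x_1,\dots,x_k):|x_1|=\dots=|x_k|=1\}$ is the torus in the variables of integration, $dT=\prod_j \frac{dx_j}{2\pi\sqrt{-1}\,x_j}$ (when there are no variables, the integral is evaluation). $[i]=(1-t^i)/(1-t)$, $[m]!=[m][m-1]\cdots[1]$, $[0]!=1$; $\phi_r(t)=(1-t)(1-t^2)\cdots(1-t^r)$. The Rogers--Szeg\H{o} polynomial is $H_m(z;t)=\sum_{i=0}^m z^i\frac{[m]!}{[m-i]!\,[i]!}$. For a partition $\lambda$ with $N$ parts (zeros included), $m_i(\lambda)$ is the number of $j\in\{1,\dots,N\}$ with $\lambda_j=i$ (so $m_0$ counts zero parts), and $v_\lambda(t)=\prod_{i\ge0}[m_i(\lambda)]!$. The Hall--Littlewood polynomial in $N$ variables is $P_\lambda(z_1,\dots,z_N;t)=\frac{1}{v_\lambda(t)}\sum_{w\in S_N}w\Big(z^\lambda\prod_{1\le i<j\le N}\frac{z_i-tz_j}{z_i-z_j}\Big)$, with $w$ permuting the subscripts of the variables. An argument list $x_1^{\pm1},\dots,x_k^{\pm1}$ means $x_1,x_1^{-1},\dots,x_k,x_k^{-1}$. The symmetric Koornwinder density is $$\tilde\Delta_K^{(k)}(x;a,b,c,d;t)=\frac{1}{2^kk!}\prod_{1\le i\le k}\frac{1-x_i^{\pm2}}{(1-ax_i^{\pm1})(1-bx_i^{\pm1})(1-cx_i^{\pm1})(1-dx_i^{\pm1})}\prod_{1\le i<j\le k}\frac{1-x_i^{\pm1}x_j^{\pm1}}{1-tx_i^{\pm1}x_j^{\pm1}},$$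 where an expression with $\pm$ signs denotes the product over all choices of signs, e.g. $1-x_i^{\pm2}$ means $(1-x_i^2)(1-x_i^{-2})$, $1-\alpha x_i^{\pm1}$ means $(1-\alpha x_i)(1-\alpha x_i^{-1})$, and $1-x_i^{\pm1}x_j^{\pm1}$ is a product of four factors. Common factors (when parameters equal $\pm1$) are cancelled. Since the number of odd parts of $\mu$ is $\sum_i m_{2i+1}(\mu)$ and $H_m$ has degree $m$, the right-hand sides are polynomials in $\alpha,\beta$; they are read as such when $\alpha=0$. *)

theory Defs
  imports "HOL-Probability.Probability" "HOL-Complex_Analysis.Contour_Integration"
begin

definition tint :: "complex \<Rightarrow> nat \<Rightarrow> complex" where
  "tint t i = (1 - t ^ i) / (1 - t)"

definition tfact :: "complex \<Rightarrow> nat \<Rightarrow> complex" where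
  "tfact t m = (\<Prod>i\<in>{1..m}. tint t i)"

definition phi :: "nat \<Rightarrow> complex \<Rightarrow> complex" where
  "phi r t = (\<Prod>i\<in>{1..r}. 1 - t ^ i)"

definition rogers_szego :: "nat \<Rightarrow> complex \<Rightarrow> complex \<Rightarrow> complex" where
  "rogers_szego m z t = (\<Sum>i\<le>m. z ^ i * (tfact t m / (tfact t (m - i) * tfact t i)))"

text \<open>
  A partition with \<open>N\<close> parts, zeros included, is a weakly decreasing list of length \<open>N\<close>.
  The multiplicity $m_i(\mu)$ is \<open>count_list \<mu> i\<close>.  In products over all $i \ge 0$ the factors with
  $m_i(\mu) = 0$ are 1, so the index ranges over \<open>set \<mu>\<close> only.
\<close>

definition is_partition :: "nat \<Rightarrow> nat list \<Rightarrow> bool" where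
  "is_partition N \<mu> \<longleftrightarrow> length \<mu> = N \<and> sorted_wrt (\<ge>) \<mu>"

definition vfun :: "nat list \<Rightarrow> complex \<Rightarrow> complex" where
  "vfun \<mu> t = (\<Prod>i\<in>set \<mu>. tfact t (count_list \<mu> i))"

text \<open>
  The value of the Hall--Littlewood polynomial at the point \<open>zs\<close>, where
  \<open>length zs = length \<mu>\<close>.  The symmetrization is evaluated termwise, so this is the value of the
  polynomial only if the entries of \<open>zs\<close> are distinct.  The arguments \<open>pm_args x k @ [1, -1]\<close>
  used below are distinct for almost all \<open>x\<close> in the torus (lemma \<open>AE_torus_distinct\<close>).
\<close>

definition hall_littlewood :: "nat list \<Rightarrow> complex list \<Rightarrow> complex \<Rightarrow> complex" where
  "hall_littlewood \<mu> zs t =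
     (let N = length \<mu> in
      1 / vfun \<mu> t *
      (\<Sum>w | w permutes {..<N}.
         (\<Prod>i<N. (zs ! w i) ^ (\<mu> ! i)) *
         (\<Prod>(i, j)\<in>{(i, j). i < j \<and> j < N}.
            (zs ! w i - t * zs ! w j) / (zs ! w i - zs ! w j))))"

definition pm_args :: "(nat \<Rightarrow> complex) \<Rightarrow> nat \<Rightarrow> complex list" where
  "pm_args x k = concat (map (\<lambda>i. [x i, inverse (x i)]) [0..<k])"

text \<open>$1 - c x^{\pm1}$ and $1 - c x^{\pm1} y^{\pm1}$.\<close>

definition pm1 :: "complex \<Rightarrow> complex \<Rightarrow> complex" where
  "pm1 c x = (1 - c * x) * (1 - c * inverse x)"

definition pm2 :: "complex \<Rightarrow> complex \<Rightarrow> complex \<Rightarrow> complex" where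
  "pm2 c x y = (1 - c * x * y) * (1 - c * x * inverse y) *
               (1 - c * inverse x * y) * (1 - c * inverse x * inverse y)"

text \<open>
  If a parameter is \<open>\<plusminus>1\<close>, a common factor of numerator and denominator vanishes where some
  \<open>x i = \<plusminus>1\<close>.  There the quotient below is 0 instead of the value after cancellation; this is a null
  set of the torus (again by \<open>AE_torus_distinct\<close>) and does not affect integrals.
\<close>

definition koornwinder_density ::
  "nat \<Rightarrow> complex \<Rightarrow> complex \<Rightarrow> complex \<Rightarrow> complex \<Rightarrow> complex \<Rightarrow> (nat \<Rightarrow> complex) \<Rightarrow> complex" where
  "koornwinder_density k a b c d t x =
     1 / (2 ^ k * fact k) *
     (\<Prod>i<k. pm1 1 ((x i)\<^sup>2) / (pm1 a (x i) * pm1 b (x i) * pm1 c (x i) * pm1 d (x i))) *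
     (\<Prod>(i, j)\<in>{(i, j). i < j \<and> j < k}. pm2 1 (x i) (x j) / pm2 t (x i) (x j))"

text \<open>
  The measure $dx / (2 \pi \sqrt{-1} x)$ on the unit circle (see \<open>integral_circle_measure\<close>) and its
  \<open>k\<close>-fold product.  For \<open>k = 0\<close> the latter is a unit point mass, so integration is evaluation.
\<close>

definition circle_measure :: "complex measure" where
  "circle_measure = distr (restrict_space lborel {0..1}) borel (\<lambda>\<theta>. cis (2 * pi * \<theta>))"

definition torus :: "nat \<Rightarrow> (nat \<Rightarrow> complex) measure" where
  "torus k = (\<Pi>\<^sub>M i\<in>{..<k}. circle_measure)"

text \<open>
  $\prod_{i\ge0} H_{m_{2i+1}(\mu)}(\beta/\alpha;t) \cdot (-\alpha)^{\#\text{odd parts of }\mu}$.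
  Each factor is a polynomial in \<open>\<alpha>\<close> and \<open>\<beta>\<close> (lemma \<open>odd_part_eq\<close>); at \<open>\<alpha> = 0\<close> only its
  leading term in \<open>\<beta>\<close> survives.
\<close>

definition odd_part :: "nat list \<Rightarrow> complex \<Rightarrow> complex \<Rightarrow> complex \<Rightarrow> complex" where
  "odd_part \<mu> \<alpha> \<beta> t =
     (if \<alpha> = 0 then (- \<beta>) ^ length (filter odd \<mu>)
      else (\<Prod>i | i \<in> set \<mu> \<and> odd i. rogers_szego (count_list \<mu> i) (\<beta> / \<alpha>) t) *
           (- \<alpha>) ^ length (filter odd \<mu>))"

definition even_part :: "nat list \<Rightarrow> complex \<Rightarrow> complex \<Rightarrow> complex \<Rightarrow> complex" where
  "even_part \<mu> \<alpha> \<beta> t = (\<Prod>i | i \<in> set \<mu> \<and> even i. rogers_szego (count_list \<mu> i) (\<alpha> * \<beta>) t)"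

lemma length_filter_odd:
  "length (filter odd \<mu>) = (\<Sum>i | i \<in> set \<mu> \<and> odd i. count_list \<mu> i)"
proof -
  have "length (filter odd \<mu>) = (\<Sum>i\<in>set (filter odd \<mu>). count_list (filter odd \<mu>) i)"
    by (rule sum_count_set[symmetric]) auto
  also have "\<dots> = (\<Sum>i | i \<in> set \<mu> \<and> odd i. count_list \<mu> i)"
  proof (rule sum.cong)
    fix i assume "i \<in> {i \<in> set \<mu>. odd i}"
    then have "odd i" by simp
    then show "count_list (filter odd \<mu>) i = count_list \<mu> i"
      by (induction \<mu>) auto
  qed auto
  finally show ?thesis .
qed

lemma tfact_nonzero:
  assumes "norm t < 1" shows "tfact t m \<noteq> 0"
proof -
  have "1 - t ^ i \<noteq> 0" if "i \<ge> 1" for i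
  proof
    assume "1 - t ^ i = 0"
    then have "norm t ^ i = 1" by (metis norm_one norm_power eq_iff_diff_eq_0)
    moreover have "norm t ^ i < 1" using assms that by (simp add: power_less_one_iff)
    ultimately show False by simp
  qed
  moreover have "1 - t \<noteq> 0" using assms by auto
  ultimately show ?thesis by (auto simp: tfact_def tint_def)
qed

lemma odd_part_eq:
  assumes "norm t < 1"
  shows "odd_part \<mu> \<alpha> \<beta> t =
    (\<Prod>i | i \<in> set \<mu> \<and> odd i. let m = count_list \<mu> i in
       (-1) ^ m * (\<Sum>j\<le>m. \<beta> ^ j * \<alpha> ^ (m - j) * (tfact t m / (tfact t (m - j) * tfact t j))))"
proof -
  let ?S = "{i. i \<in> set \<mu> \<and> odd i}"
  let ?b = "\<lambda>m j. tfact t m / (tfact t (m - j) * tfact t j)"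
  have pw: "c ^ length (filter odd \<mu>) = (\<Prod>i\<in>?S. c ^ count_list \<mu> i)" for c :: complex
    by (simp add: length_filter_odd power_sum)
  show ?thesis
  proof (cases "\<alpha> = 0")
    case True
    have "(\<Sum>j\<le>m. \<beta> ^ j * \<alpha> ^ (m - j) * ?b m j) = \<beta> ^ m" for m
    proof -
      have "(\<Sum>j\<le>m. \<beta> ^ j * \<alpha> ^ (m - j) * ?b m j) = (\<Sum>j\<in>{m}. \<beta> ^ j * \<alpha> ^ (m - j) * ?b m j)"
        by (rule sum.mono_neutral_right) (auto simp: True)
      also have "\<dots> = \<beta> ^ m"
        using tfact_nonzero[OF assms, of m] by (simp add: tfact_def[of t 0])
      finally show ?thesis .
    qed
    then show ?thesis
      by (simp add: odd_part_def True pw Let_def flip: power_mult_distrib)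
  next
    case False
    have "rogers_szego m (\<beta> / \<alpha>) t * (- \<alpha>) ^ m =
        (-1) ^ m * (\<Sum>j\<le>m. \<beta> ^ j * \<alpha> ^ (m - j) * ?b m j)" for m
    proof -
      have "rogers_szego m (\<beta> / \<alpha>) t * (- \<alpha>) ^ m =
          (\<Sum>j\<le>m. (-1) ^ m * (((\<beta> / \<alpha>) ^ j * \<alpha> ^ m) * ?b m j))"
        unfolding rogers_szego_def sum_distrib_right power_minus[of \<alpha>]
        by (intro sum.cong) (simp_all add: algebra_simps)
      also have "\<dots> = (\<Sum>j\<le>m. (-1) ^ m * ((\<beta> ^ j * \<alpha> ^ (m - j)) * ?b m j))"
        using False by (intro sum.cong refl) (simp add: power_divide power_diff)
      finally show ?thesis by (simp add: sum_distrib_left)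
    qed
    then show ?thesis
      using False by (simp add: odd_part_def pw Let_def flip: prod.distrib)
  qed
qed

lemma measurable_cis_param [measurable]:
  "(\<lambda>\<theta>. cis (2 * pi * \<theta>)) \<in> borel_measurable (restrict_space lborel {0..1})"
  by (intro measurable_restrict_space1)
     (auto intro!: borel_measurable_continuous_onI continuous_intros)

lemma sets_circle_measure [measurable_cong, simp]: "sets circle_measure = sets borel"
  by (simp add: circle_measure_def)

lemma space_circle_measure [simp]: "space circle_measure = UNIV"
  by (simp add: circle_measure_def)

lemma prob_space_circle_measure: "prob_space circle_measure"
  unfolding circle_measure_def
proof (rule prob_space.prob_space_distr)
  show "prob_space (restrict_space lborel {0..1::real})"
    by (rule prob_spaceI) (simp add: emeasure_restrict_space space_restrict_space)
qed measurable

lemma integral_circle_measure: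
  fixes f :: "complex \<Rightarrow> complex"
  assumes "integrable circle_measure f"
  shows "(\<integral>x. f x \<partial>circle_measure) =
    contour_integral (circlepath 0 1) (\<lambda>x. f x / (2 * pi * \<i> * x))"
proof -
  let ?c = "\<lambda>\<theta>. cis (2 * pi * \<theta>)"
  have [measurable]: "f \<in> borel_measurable borel"
    using borel_measurable_integrable[OF assms] by simp
  have "integrable (restrict_space lborel {0..1}) (\<lambda>\<theta>. f (?c \<theta>))"
    using assms by (simp add: circle_measure_def integrable_distr_eq)
  then have int: "set_integrable lborel {0..1} (\<lambda>\<theta>. f (?c \<theta>))"
    by (simp add: integrable_restrict_space set_integrable_def)
  have "(\<integral>x. f x \<partial>circle_measure) = (LINT \<theta>:{0..1}|lborel. f (?c \<theta>))"
    by (simp add: circle_measure_def integral_distr integral_restrict_space set_lebesgue_integral_def)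
  also have "\<dots> = integral {0..1} (\<lambda>\<theta>. f (?c \<theta>))"
    using set_borel_integral_eq_integral(2)[OF int] .
  also have "\<dots> = contour_integral (circlepath 0 1) (\<lambda>x. f x / (2 * pi * \<i> * x))"
    unfolding contour_integral_integral
    by (intro integral_cong)
       (simp add: vector_derivative_circlepath, simp add: circlepath cis_conv_exp mult_ac)
  finally show ?thesis .
qed

lemma AE_circle_measure_neq: "AE z in circle_measure. z \<noteq> c"
proof -
  let ?A = "{\<theta>. cis (2 * pi * \<theta>) = c}"
  have "countable ?A"
  proof (cases "?A = {}")
    case False
    then obtain \<theta>0 where 0: "cis (2 * pi * \<theta>0) = c" by auto
    have "?A \<subseteq> range (\<lambda>n::int. \<theta>0 + of_int n)"
    proof
      fix \<theta> assume "\<theta> \<in> ?A"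
      with 0 have "cis (2 * pi * \<theta>) = cis (2 * pi * \<theta>0)" by simp
      then obtain n :: int where "2 * pi * \<theta> = 2 * pi * \<theta>0 + 2 * pi * of_int n"
        using sin_cos_eq_iff[of "2 * pi * \<theta>" "2 * pi * \<theta>0"]
        by (auto simp: complex_eq_iff mult_ac)
      then have "\<theta> = \<theta>0 + of_int n"
        by (metis distrib_left mult_cancel_left pi_neq_zero zero_neq_numeral mult_eq_0_iff)
      then show "\<theta> \<in> range (\<lambda>n::int. \<theta>0 + of_int n)" by auto
    qed
    then show ?thesis by (rule countable_subset) simp
  qed auto
  then have "AE \<theta> in lborel. \<theta> \<notin> ?A"
    by (intro AE_not_in countable_imp_null_set_lborel)
  then have "AE \<theta> in restrict_space lborel {0..1}. cis (2 * pi * \<theta>) \<noteq> c"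
    by (auto simp: AE_restrict_space_iff elim!: eventually_mono)
  then show ?thesis
    unfolding circle_measure_def by (subst AE_distr_iff) auto
qed

lemma product_sigma_finite_circle_measure: "product_sigma_finite (\<lambda>_::nat. circle_measure)"
  by (simp add: product_sigma_finite_def prob_space_circle_measure prob_space_imp_sigma_finite)

lemma AE_torus_component:
  assumes "i < k" "AE z in circle_measure. P z"
  shows "AE x in torus k. P (x i)"
  unfolding torus_def using assms prob_space_circle_measure
  by (intro AE_PiM_component[where M = "\<lambda>_. circle_measure"]) auto

lemma AE_torus_neq:
  assumes "i < k" "j < k" "i \<noteq> j" and [measurable]: "g \<in> borel_measurable borel"
  shows "AE x in torus k. x i \<noteq> g (x j)"
proof -
  define J where "J = {..<k} - {i}"
  have k: "{..<k} = insert i J" and J: "finite J" "i \<notin> J" "j \<in> J" "j \<in> insert i J"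
    using assms by (auto simp: J_def)
  let ?M = "PiM (insert i J) (\<lambda>_. circle_measure)"
  let ?A = "{x \<in> space ?M. x i = g (x j)}"
  have [measurable]: "(\<lambda>x. x i) \<in> borel_measurable ?M" "(\<lambda>x. x j) \<in> borel_measurable ?M"
    using measurable_component_singleton[of i "insert i J" "\<lambda>_. circle_measure"]
      measurable_component_singleton[of j "insert i J" "\<lambda>_. circle_measure"] J
    by (simp_all cong: measurable_cong_sets)
  have A: "?A \<in> sets ?M" by measurable
  have "emeasure ?M ?A = (\<integral>\<^sup>+x. indicator ?A x \<partial>?M)" using A by simp
  also have "\<dots> = (\<integral>\<^sup>+y. (\<integral>\<^sup>+z. indicator ?A (y(i := z)) \<partial>circle_measure)
      \<partial>PiM J (\<lambda>_. circle_measure))"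
    using J A by (intro product_sigma_finite.product_nn_integral_insert product_sigma_finite_circle_measure) auto
  also have "\<dots> = (\<integral>\<^sup>+y. 0 \<partial>PiM J (\<lambda>_. circle_measure))"
  proof (rule nn_integral_cong)
    fix y :: "nat \<Rightarrow> complex"
    have "(\<integral>\<^sup>+z. indicator ?A (y(i := z)) \<partial>circle_measure) = (\<integral>\<^sup>+z. 0 \<partial>circle_measure)"
      using AE_circle_measure_neq[of "g (y j)"] \<open>i \<noteq> j\<close>
      by (intro nn_integral_cong_AE) (auto elim!: eventually_mono simp: indicator_def)
    then show "(\<integral>\<^sup>+z. indicator ?A (y(i := z)) \<partial>circle_measure) = 0" by simp
  qed
  finally have "emeasure ?M ?A = 0" by simp
  then show ?thesis
    unfolding torus_def k using A by (intro AE_I[of _ _ ?A]) auto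
qed

lemma distinct_pm_args:
  assumes "\<And>i. i < k \<Longrightarrow> x i \<noteq> 0 \<and> x i \<noteq> 1 \<and> x i \<noteq> -1"
    and "\<And>i j. i < k \<Longrightarrow> j < k \<Longrightarrow> i \<noteq> j \<Longrightarrow> x i \<noteq> x j \<and> x i \<noteq> inverse (x j)"
  shows "distinct (pm_args x k @ [1, -1])"
  using assms
proof (induction k)
  case 0
  then show ?case by (simp add: pm_args_def)
next
  case (Suc k)
  have IH: "distinct (pm_args x k @ [1, -1])"
    by (rule Suc.IH) (use Suc.prems less_SucI in blast)+
  have set: "set (pm_args x k) = (\<Union>j<k. {x j, inverse (x j)})"
    by (auto simp: pm_args_def)
  have k: "x k \<noteq> 0" "x k \<noteq> 1" "x k \<noteq> -1" using Suc.prems(1)[of k] by auto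
  have inv: "x k \<noteq> inverse (x k)"
  proof
    assume "x k = inverse (x k)"
    then have "(x k)\<^sup>2 = 1" using k by (simp add: power2_eq_square field_simps)
    then show False using k by (simp add: power2_eq_1_iff)
  qed
  have inv1: "inverse (x k) \<noteq> 1" "inverse (x k) \<noteq> -1"
    using k by (metis inverse_1 inverse_inverse_eq, metis inverse_minus_eq inverse_1 inverse_inverse_eq)
  have "x k \<noteq> x j \<and> x k \<noteq> inverse (x j) \<and> inverse (x k) \<noteq> x j \<and> inverse (x k) \<noteq> inverse (x j)"
    if "j < k" for j
    using Suc.prems(2)[of k j] that by (metis inverse_inverse_eq lessI less_SucI less_irrefl)
  then have "x k \<notin> set (pm_args x k)" "inverse (x k) \<notin> set (pm_args x k)"
    unfolding set by auto
  moreover have "pm_args x (Suc k) = pm_args x k @ [x k, inverse (x k)]"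
    by (simp add: pm_args_def)
  ultimately show ?case using IH k inv inv1 by auto
qed

lemma AE_torus_distinct: "AE x in torus k. distinct (pm_args x k @ [1, -1])"
proof -
  have 1: "AE x in torus k. \<forall>i\<in>{..<k}. x i \<noteq> 0 \<and> x i \<noteq> 1 \<and> x i \<noteq> -1"
    by (intro AE_finite_allI AE_torus_component AE_conjI AE_circle_measure_neq) auto
  have 2: "AE x in torus k. \<forall>p\<in>{(i, j). i < k \<and> j < k \<and> i \<noteq> j}.
      x (fst p) \<noteq> x (snd p) \<and> x (fst p) \<noteq> inverse (x (snd p))"
  proof (rule AE_finite_allI)
    show "finite {(i, j). i < k \<and> j < k \<and> i \<noteq> j}"
      by (rule finite_subset[of _ "{..<k} \<times> {..<k}"]) auto
  next
    fix p assume "p \<in> {(i, j). i < k \<and> j < k \<and> i \<noteq> j}"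
    then show "AE x in torus k. x (fst p) \<noteq> x (snd p) \<and> x (fst p) \<noteq> inverse (x (snd p))"
      using AE_torus_neq[of "fst p" k "snd p" "\<lambda>z. z"]
        AE_torus_neq[of "fst p" k "snd p" inverse]
      by (intro AE_conjI) auto
  qed
  show ?thesis
    using 1 2
  proof eventually_elim
    case (elim x)
    then show ?case by (intro distinct_pm_args) auto
  qed
qed

end

theory Submission
  imports Defs "HOL-Complex_Analysis.Conformal_Mappings"
begin

text \<open>
  Let $N$ be $2n$ or $2n+1$.  The left-hand side is $L(P_\mu \prod_i (1-\alpha z_i)(1-\beta z_i))$, where
  $L$ adds two normalised integrals over points $z = (z_1,\dots,z_N)$ that are closed under inversion:
  conjugate pairs $x_j^{\pm1}$ on the unit circle, together with a set $F$ of fixed eigenvalues chosen from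
  $1$ and $-1$.  For even $N$ the two choices are $F = \emptyset$ and $F = \{1,-1\}$, for odd $N$ they are
  $\{1\}$ and $\{-1\}$, as for the two components of the orthogonal group $O(N)$.  The factor in front of
  the second integral, and both factors for odd $N$, are the product $\prod (1-\alpha z)(1-\beta z)$
  over the fixed eigenvalues.

  \<^bold>\<open>Removing one slot.\<close>  Write $R(p_1,\dots,p_N)$ for the Hall--Littlewood symmetrisation of
  $p_1(z_1)\cdots p_N(z_N)$ (\<open>hl_sum\<close>, with the last slot first), and let the last polynomial be $1$.
  Sort the terms of $R$ by the point in the last slot.  If this point is fixed, its factors cancel against
  the density, and what remains is the integrand for $F$ without that point and $N-1$ slots.  If it is
  $1/x$ for a variable $x$, the density turns the dependence on $x$ into $x^2 K(x)/(x^2-1)$, with $K$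
  holomorphic in a disc of radius greater than $1$.  The poles on the circle cancel against the term in which $x$ and
  $1/x$ are interchanged, and the integral of the sum over $x$ is $(K(1)+K(-1))/2$
  (\<open>circle_integral_paired\<close>).  By antisymmetry $K$ vanishes at $\varepsilon = \pm1$ if $\varepsilon$ is
  already a fixed eigenvalue.  Otherwise $K(\varepsilon)$ times the remaining density is, up to a
  constant, the integrand for $F \cup \{\varepsilon\}$ and $N-1$ slots (\<open>residue_kernel_fixed\<close>).  In both cases
  one of $1$, $-1$ is toggled in $F$; this is the recursion \<open>hl_int_one_Cons\<close>.

  \<^bold>\<open>Evaluation.\<close>  A common factor $z^a$ of all slots contributes $(\prod F)^a$, so the recursion
  computes the integral of $R$ for every weakly ordered list of exponents.  In the suitably weighted sum of the two
  integrals each slot with exponent $a$ contributes a factor $1+(-1)^a$, up to constants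
  (\<open>totals_Cons\<close>).  Hence $L(P_\lambda) v_\lambda$ is $2[N]!$
  if all parts of $\lambda$ are even, and $0$ otherwise (\<open>even_size_evaluation\<close>,
  \<open>odd_size_evaluation\<close>).  The exponents $0,\dots,0$ give the normalising constants, since then $R=[N]!$.

  \<^bold>\<open>The factors in $\alpha$ and $\beta$.\<close>  Straightening, $R(\dots,p,xp,\dots) = t R(\dots,xp,p,\dots)$,
  gives a Pieri rule with Gaussian binomial coefficients (\<open>hl_functional_pieri\<close>).  Applied with
  $\alpha$ it leaves, for each odd part, the factor $-\alpha$.  Applied once more with $\beta$ it gives
  one Rogers--Szego polynomial for each block of equal parts.

  The analytic input is that $R$ is bounded at distinct points of a disc (\<open>hl_sum_bounded\<close>).  It makes
  each piece of the decomposition integrable, so that the variables can be integrated one at a time.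
\<close>

section \<open>Hall--Littlewood symmetrisation by the last slot\<close>

abbreviation last_factor :: "complex \<Rightarrow> ('a \<Rightarrow> complex) \<Rightarrow> 'a set \<Rightarrow> 'a \<Rightarrow> complex" where
  "last_factor t z I i \<equiv> (\<Prod>j\<in>I - {i}. (z j - t * z i) / (z j - z i))"

text \<open>
  The Hall--Littlewood symmetrisation of a product of polynomials, one for each slot, evaluated at the points
  \<open>z i\<close>.  The list starts with the polynomial of the last slot: the point \<open>z i\<close> that goes there meets every
  other point as the second argument of a factor $(z_j - t z_i)/(z_j - z_i)$.  Arbitrary polynomials make the
  sum multilinear in the slots, and an arbitrary index set makes it possible to drop points.
\<close>

fun hl_sum :: "complex \<Rightarrow> complex poly list \<Rightarrow> ('a \<Rightarrow> complex) \<Rightarrow> 'a set \<Rightarrow> complex" where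
  "hl_sum t [] z I = 1"
| "hl_sum t (p # ps) z I =
     (\<Sum>i\<in>I. poly p (z i) * last_factor t z I i * hl_sum t ps z (I - {i}))"

text \<open>
  The sum \<open>hl_sum\<close> over \<open>Y\<close> and one further point of value \<open>u\<close>, multiplied by
  $\prod_{j \in Y} (z_j - u)$.  The denominators that involve \<open>u\<close> have been cancelled term by term, so this is
  a polynomial in \<open>u\<close> that makes sense also where \<open>u\<close> meets a point of \<open>Y\<close>.
\<close>

fun cleared_sum :: "complex \<Rightarrow> complex poly list \<Rightarrow> complex \<Rightarrow> ('a \<Rightarrow> complex) \<Rightarrow> 'a set \<Rightarrow> complex" where
  "cleared_sum t [] u z Y = 0"
| "cleared_sum t (p # ps) u z Y =
     poly p u * (\<Prod>j\<in>Y. z j - t * u) * hl_sum t ps z Y +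
     (\<Sum>i\<in>Y. (t * z i - u) * poly p (z i) * last_factor t z Y i *
        cleared_sum t ps u z (Y - {i}))"

lemma hl_sum_cong:
  assumes "\<And>i. i \<in> I \<Longrightarrow> z i = z' i"
  shows "hl_sum t ps z I = hl_sum t ps z' I"
  using assms
proof (induction ps arbitrary: I)
  case (Cons p ps)
  show ?case unfolding hl_sum.simps
  proof (rule sum.cong[OF refl])
    fix i assume i: "i \<in> I"
    have "last_factor t z I i = last_factor t z' I i"
      using Cons.prems i by (intro prod.cong) auto
    moreover have "hl_sum t ps z (I - {i}) = hl_sum t ps z' (I - {i})"
      using Cons.prems by (intro Cons.IH) auto
    ultimately show "poly p (z i) * last_factor t z I i * hl_sum t ps z (I - {i}) =
      poly p (z' i) * last_factor t z' I i * hl_sum t ps z' (I - {i})"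
      using Cons.prems[OF i] by simp
  qed
qed simp

lemma hl_sum_reindex:
  assumes "inj_on f I"
  shows "hl_sum t ps (\<lambda>i. z (f i)) I = hl_sum t ps z (f ` I)"
  using assms
proof (induction ps arbitrary: I)
  case (Cons p ps)
  have "hl_sum t ps (\<lambda>i. z (f i)) (I - {i}) = hl_sum t ps z (f ` I - {f i})" if "i \<in> I" for i
    using Cons.IH[of "I - {i}"] Cons.prems that
    by (simp add: inj_on_diff inj_on_image_set_diff[where C = I])
  moreover have "(\<Prod>j\<in>f ` I - {f i}. (z j - t * z (f i)) / (z j - z (f i))) =
      (\<Prod>j\<in>I - {i}. (z (f j) - t * z (f i)) / (z (f j) - z (f i)))" if "i \<in> I" for i
  proof -
    have "f ` I - {f i} = f ` (I - {i})"
      using Cons.prems that by (simp add: inj_on_image_set_diff[where C = I])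
    then show ?thesis
      using Cons.prems by (simp add: prod.reindex inj_on_diff)
  qed
  ultimately show ?case
    using Cons.prems by (simp add: sum.reindex)
qed simp

lemma hl_sum_mult:
  assumes "finite I" "card I = length ps"
  shows "hl_sum t (map ((*) g) ps) z I = (\<Prod>i\<in>I. poly g (z i)) * hl_sum t ps z I"
  using assms
proof (induction ps arbitrary: I)
  case (Cons p ps)
  have "poly (g * p) (z i) * X * hl_sum t (map ((*) g) ps) z (I - {i}) =
      (\<Prod>i\<in>I. poly g (z i)) * (poly p (z i) * X * hl_sum t ps z (I - {i}))" if "i \<in> I" for i X
    using Cons.IH[of "I - {i}"] Cons.prems that by (simp add: prod.remove[of I i])
  then show ?case unfolding list.map hl_sum.simps sum_distrib_left by (intro sum.cong refl)
qed simp

lemma hl_sum_add: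
  "hl_sum t (pre @ (p + q) # post) z I = hl_sum t (pre @ p # post) z I + hl_sum t (pre @ q # post) z I"
proof (induction pre arbitrary: I)
  case (Cons r pre)
  show ?case by (simp add: Cons.IH algebra_simps sum.distrib)
qed (simp add: algebra_simps sum.distrib)

lemma hl_sum_smult:
  "hl_sum t (pre @ smult c p # post) z I = c * hl_sum t (pre @ p # post) z I"
proof (induction pre arbitrary: I)
  case (Cons r pre)
  show ?case by (simp add: Cons.IH algebra_simps sum_distrib_left)
qed (simp add: algebra_simps sum_distrib_left)

text \<open>
  Only the two factors for the two slots are not symmetric in the points $z_i$, $z_j$ that fill them.
  Symmetrising replaces $z_i(z_j-tz_i)/(z_j-z_i)$ by $t(z_i+z_j)$ and $z_j(z_j-tz_i)/(z_j-z_i)$ by $z_i+z_j$.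
\<close>

lemma hl_sum_swap:
  assumes "finite I" "inj_on z I"
  shows "hl_sum t (pre @ pCons 0 p # p # post) z I = t * hl_sum t (pre @ p # pCons 0 p # post) z I"
  using assms
proof (induction pre arbitrary: I)
  case (Cons r pre)
  have "hl_sum t (pre @ pCons 0 p # p # post) z (I - {i}) =
      t * hl_sum t (pre @ p # pCons 0 p # post) z (I - {i})" for i
    using Cons.prems by (intro Cons.IH) (auto simp: inj_on_diff)
  then show ?case by (simp add: sum_distrib_left algebra_simps)
next
  case Nil
  define W where "W i j = poly p (z i) * poly p (z j) *
      (\<Prod>k\<in>I - {i, j}. (z k - t * z i) / (z k - z i)) *
      (\<Prod>k\<in>I - {i, j}. (z k - t * z j) / (z k - z j)) * hl_sum t post z (I - {i, j})" for i j
  have W_sym: "W i j = W j i" for i j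
    by (simp add: W_def insert_commute mult_ac)
  define P where "P = (SIGMA i:I. I - {i})"
  have expand: "hl_sum t (q # r # post) z I =
      (\<Sum>(i, j)\<in>P. poly q (z i) * poly r (z j) * ((z j - t * z i) / (z j - z i)) *
        ((\<Prod>k\<in>I - {i, j}. (z k - t * z i) / (z k - z i)) *
         (\<Prod>k\<in>I - {i, j}. (z k - t * z j) / (z k - z j)) * hl_sum t post z (I - {i, j})))" for q r
  proof -
    have "poly q (z i) * (\<Prod>k\<in>I - {i}. (z k - t * z i) / (z k - z i)) *
        (poly r (z j) * (\<Prod>k\<in>I - {i} - {j}. (z k - t * z j) / (z k - z j)) * hl_sum t post z (I - {i} - {j}))
      = poly q (z i) * poly r (z j) * ((z j - t * z i) / (z j - z i)) *
        ((\<Prod>k\<in>I - {i, j}. (z k - t * z i) / (z k - z i)) *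
         (\<Prod>k\<in>I - {i, j}. (z k - t * z j) / (z k - z j)) * hl_sum t post z (I - {i, j}))"
      if "i \<in> I" "j \<in> I - {i}" for i j
      using that Nil.prems by (simp add: prod.remove[of "I - {i}" j] Diff_insert2[symmetric] mult_ac)
    then show ?thesis
      unfolding P_def by (simp add: sum.Sigma[symmetric] Nil.prems sum_distrib_left)
  qed
  have flip: "(\<Sum>(i, j)\<in>P. g i j) = (\<Sum>(i, j)\<in>P. g j i)" for g :: "'a \<Rightarrow> 'a \<Rightarrow> complex"
    by (rule sum.reindex_bij_witness[where i = prod.swap and j = prod.swap]) (auto simp: P_def)
  \<comment> \<open>\<open>W\<close> is the part of a term that is symmetric in the two points.\<close>
  have two: "2 * (\<Sum>(i, j)\<in>P. g i j * W i j) = (\<Sum>(i, j)\<in>P. (g i j + g j i) * W i j)" for g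
  proof -
    have "2 * (\<Sum>(i, j)\<in>P. g i j * W i j) = (\<Sum>(i, j)\<in>P. g i j * W i j) + (\<Sum>(i, j)\<in>P. g j i * W j i)"
      using flip[of "\<lambda>i j. g i j * W i j"] by simp
    also have "\<dots> = (\<Sum>(i, j)\<in>P. (g i j + g j i) * W i j)"
      by (simp add: sum.distrib[symmetric] W_sym algebra_simps split_def)
    finally show ?thesis .
  qed
  have L: "hl_sum t (pCons 0 p # p # post) z I = (\<Sum>(i, j)\<in>P. z i * ((z j - t * z i) / (z j - z i)) * W i j)"
    unfolding expand by (intro sum.cong) (auto simp: W_def mult_ac)
  have R: "hl_sum t (p # pCons 0 p # post) z I = (\<Sum>(i, j)\<in>P. z j * ((z j - t * z i) / (z j - z i)) * W i j)"
    unfolding expand by (intro sum.cong) (auto simp: W_def mult_ac)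
  have "2 * hl_sum t (pCons 0 p # p # post) z I = (\<Sum>(i, j)\<in>P. t * (z i + z j) * W i j)"
    unfolding L two
  proof (intro sum.cong refl, clarify)
    fix i j assume "(i, j) \<in> P"
    then have "z i - z j \<noteq> 0" "z j - z i \<noteq> 0"
      using Nil.prems by (auto simp: P_def inj_on_def)
    then have "z i * ((z j - t * z i) / (z j - z i)) + z j * ((z i - t * z j) / (z i - z j)) = t * (z i + z j)"
      by (simp add: divide_simps) (simp add: algebra_simps)
    then show "(z i * ((z j - t * z i) / (z j - z i)) + z j * ((z i - t * z j) / (z i - z j))) * W i j =
        t * (z i + z j) * W i j" by simp
  qed
  moreover have "2 * hl_sum t (p # pCons 0 p # post) z I = (\<Sum>(i, j)\<in>P. (z i + z j) * W i j)"
    unfolding R two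
  proof (intro sum.cong refl, clarify)
    fix i j assume "(i, j) \<in> P"
    then have "z i - z j \<noteq> 0" "z j - z i \<noteq> 0"
      using Nil.prems by (auto simp: P_def inj_on_def)
    then have "z j * ((z j - t * z i) / (z j - z i)) + z i * ((z i - t * z j) / (z i - z j)) = z i + z j"
      by (simp add: divide_simps) (simp add: algebra_simps)
    then show "(z j * ((z j - t * z i) / (z j - z i)) + z i * ((z i - t * z j) / (z i - z j))) * W i j =
        (z i + z j) * W i j" by simp
  qed
  ultimately have "2 * hl_sum t (pCons 0 p # p # post) z I = 2 * (t * hl_sum t (p # pCons 0 p # post) z I)"
    by (simp only: sum_distrib_left split_def mult.assoc mult.left_commute[of 2 t])
  then show ?case by simp
qed

lemma cleared_sum_cong:
  assumes "\<And>i. i \<in> I \<Longrightarrow> z i = z' i"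
  shows "cleared_sum t ps u z I = cleared_sum t ps u z' I"
  using assms
proof (induction ps arbitrary: I)
  case (Cons p ps)
  have "last_factor t z I i = last_factor t z' I i"
    if "i \<in> I" for i
    using Cons.prems that by (intro prod.cong) auto
  moreover have "cleared_sum t ps u z (I - {i}) = cleared_sum t ps u z' (I - {i})" for i
    using Cons.prems by (intro Cons.IH) auto
  moreover have "hl_sum t ps z I = hl_sum t ps z' I" using Cons.prems by (rule hl_sum_cong)
  moreover have "(\<Prod>j\<in>I. z j - t * u) = (\<Prod>j\<in>I. z' j - t * u)"
    using Cons.prems by (intro prod.cong) auto
  ultimately show ?case
    using Cons.prems by (simp cong: sum.cong)
qed simp

lemma cleared_sum_eq:
  assumes "finite Y" "i0 \<notin> Y" "Suc (card Y) = length ps" "z i0 \<notin> z ` Y"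
  shows "cleared_sum t ps (z i0) z Y = (\<Prod>j\<in>Y. z j - z i0) * hl_sum t ps z (insert i0 Y)"
  using assms
proof (induction ps arbitrary: Y)
  case (Cons p ps)
  have nz: "z j - z i0 \<noteq> 0" "z i0 - z j \<noteq> 0" if "j \<in> Y" for j
    using Cons.prems that by (metis eq_iff_diff_eq_0 image_eqI)+
  have first: "(\<Prod>j\<in>Y. z j - t * z i0) =
      (\<Prod>j\<in>Y. z j - z i0) * (\<Prod>j\<in>Y. (z j - t * z i0) / (z j - z i0))"
    unfolding prod.distrib[symmetric] using nz by (intro prod.cong) auto
  have rest: "(t * z i - z i0) * poly p (z i) * last_factor t z Y i *
        cleared_sum t ps (z i0) z (Y - {i}) =
      (\<Prod>j\<in>Y. z j - z i0) * (poly p (z i) *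
        last_factor t z (insert i0 Y) i *
        hl_sum t ps z (insert i0 Y - {i}))" if i: "i \<in> Y" for i
  proof -
    have IH: "cleared_sum t ps (z i0) z (Y - {i}) =
        (\<Prod>j\<in>Y - {i}. z j - z i0) * hl_sum t ps z (insert i0 (Y - {i}))"
      using Cons.prems i card_Suc_Diff1[of Y i] by (intro Cons.IH) (simp_all, blast)
    have ins: "insert i0 Y - {i} = insert i0 (Y - {i})" using i Cons.prems by auto
    have 1: "(\<Prod>j\<in>Y. z j - z i0) = (z i - z i0) * (\<Prod>j\<in>Y - {i}. z j - z i0)"
      using Cons.prems i by (simp add: prod.remove)
    have 2: "(\<Prod>j\<in>insert i0 (Y - {i}). (z j - t * z i) / (z j - z i)) =
        (z i0 - t * z i) / (z i0 - z i) * last_factor t z Y i"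
      using Cons.prems by simp
    have 3: "(z i - z i0) * ((z i0 - t * z i) / (z i0 - z i)) = t * z i - z i0"
      using nz[OF i] by (simp add: field_simps)
    show ?thesis unfolding IH ins 1 2 3[symmetric] by (simp add: mult_ac)
  qed
  have ins: "insert i0 Y - {i0} = Y" using Cons.prems by auto
  have "hl_sum t (p # ps) z (insert i0 Y) =
      poly p (z i0) * (\<Prod>j\<in>Y. (z j - t * z i0) / (z j - z i0)) * hl_sum t ps z Y +
      (\<Sum>i\<in>Y. poly p (z i) * last_factor t z (insert i0 Y) i *
        hl_sum t ps z (insert i0 Y - {i}))"
    using Cons.prems by (simp add: ins)
  moreover have "(\<Sum>i\<in>Y. (t * z i - z i0) * poly p (z i) *
        last_factor t z Y i * cleared_sum t ps (z i0) z (Y - {i})) =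
      (\<Prod>j\<in>Y. z j - z i0) * (\<Sum>i\<in>Y. poly p (z i) *
        last_factor t z (insert i0 Y) i *
        hl_sum t ps z (insert i0 Y - {i}))"
    unfolding sum_distrib_left by (rule sum.cong[OF refl rest])
  ultimately show ?case
    unfolding cleared_sum.simps first by (simp only: distrib_left mult_ac)
qed simp

text \<open>
  Multiplication by $\prod (z_j - u)$ removes the poles of a symmetric expression, which has none, and so leaves
  a zero at each $z_j$.  In the recursion the zero comes from two terms that cancel: the one with \<open>u\<close> in the last slot
  and the one with the coinciding point there.
\<close>

lemma cleared_sum_vanishes:
  assumes "finite Y" "inj_on z Y" "i0 \<in> Y" "Suc (card Y) = length ps"
  shows "cleared_sum t ps (z i0) z Y = 0"
  using assms
proof (induction ps arbitrary: Y)
  case (Cons p ps)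
  let ?c = "\<lambda>i. (t * z i - z i0) * poly p (z i) * last_factor t z Y i *
        cleared_sum t ps (z i0) z (Y - {i})"
  have "?c i = 0" if "i \<in> Y - {i0}" for i
  proof -
    have "cleared_sum t ps (z i0) z (Y - {i}) = 0"
      using Cons.prems that card_Suc_Diff1[of Y i] by (intro Cons.IH) (auto simp: inj_on_diff)
    then show ?thesis by simp
  qed
  then have s1: "sum ?c Y = ?c i0"
    using Cons.prems by (simp add: sum.remove[of Y i0] sum.neutral)
  have s2: "cleared_sum t ps (z i0) z (Y - {i0}) =
      (\<Prod>j\<in>Y - {i0}. z j - z i0) * hl_sum t ps z Y"
  proof -
    have "z i0 \<notin> z ` (Y - {i0})" using Cons.prems by (auto simp: inj_on_def)
    then have "cleared_sum t ps (z i0) z (Y - {i0}) =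
        (\<Prod>j\<in>Y - {i0}. z j - z i0) * hl_sum t ps z (insert i0 (Y - {i0}))"
      using Cons.prems card_Suc_Diff1[of Y i0] by (intro cleared_sum_eq) auto
    then show ?thesis using Cons.prems by (simp add: insert_absorb)
  qed
  have s3: "last_factor t z Y i0 * (\<Prod>j\<in>Y - {i0}. z j - z i0) =
      (\<Prod>j\<in>Y - {i0}. z j - t * z i0)"
    unfolding prod.distrib[symmetric]
    using Cons.prems by (intro prod.cong) (auto simp: inj_on_def)
  have s4: "(\<Prod>j\<in>Y. z j - t * z i0) = (z i0 - t * z i0) * (\<Prod>j\<in>Y - {i0}. z j - t * z i0)"
    using Cons.prems by (simp add: prod.remove[of Y i0])
  show ?case
    unfolding cleared_sum.simps s1 s2 s4 s3[symmetric] by (simp add: algebra_simps)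
qed simp

lemma holomorphic_cleared_sum [holomorphic_intros]:
  "(\<lambda>u. cleared_sum t ps u z Y) holomorphic_on S"
proof (induction ps arbitrary: Y)
  case (Cons p ps)
  have "(\<lambda>u. poly p u) holomorphic_on S"
    by (induction p) (auto intro!: holomorphic_intros)
  with Cons.IH show ?case by (auto intro!: holomorphic_intros)
qed simp

section \<open>Boundedness of the symmetrisation\<close>

lemma factor_at_zeros:
  fixes f :: "complex \<Rightarrow> complex"
  assumes "finite Y" "inj_on z Y" "f holomorphic_on UNIV" "\<And>j. j \<in> Y \<Longrightarrow> f (z j) = 0"
  shows "\<exists>g. g holomorphic_on UNIV \<and> (\<forall>u. f u = (\<Prod>j\<in>Y. z j - u) * g u)"
  using assms
proof (induction Y arbitrary: f rule: finite_induct)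
  case (insert j Y)
  define g where "g = (\<lambda>u. - (if u = z j then deriv f (z j) else (f u - f (z j)) / (u - z j)))"
  have hol: "g holomorphic_on UNIV"
    unfolding g_def using insert.prems by (intro holomorphic_on_minus pole_lemma) auto
  have f: "f u = (z j - u) * g u" for u
    using insert.prems(3)[of j] by (auto simp: g_def field_simps)
  have "g (z k) = 0" if "k \<in> Y" for k
  proof -
    have "z j - z k \<noteq> 0" using that insert by (auto simp: inj_on_def)
    then show ?thesis using insert.prems(3)[of k] f[of "z k"] that by auto
  qed
  then obtain h where "h holomorphic_on UNIV" "\<And>u. g u = (\<Prod>j\<in>Y. z j - u) * h u"
    using insert.IH[OF _ hol] insert.prems by (auto simp: inj_on_insert)
  then show ?case
    using insert.hyps f by (auto intro!: exI[of _ h])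
qed auto

lemma cleared_sum_eq_upd:
  assumes "finite Y" "i0 \<notin> Y" "Suc (card Y) = length ps" "u \<notin> z ` Y"
  shows "cleared_sum t ps u z Y = (\<Prod>j\<in>Y. z j - u) * hl_sum t ps (z(i0 := u)) (insert i0 Y)"
proof -
  have eq: "(z(i0 := u)) j = z j" if "j \<in> Y" for j using assms that by auto
  have "cleared_sum t ps u (z(i0 := u)) Y =
      (\<Prod>j\<in>Y. (z(i0 := u)) j - u) * hl_sum t ps (z(i0 := u)) (insert i0 Y)"
    using assms cleared_sum_eq[of Y i0 ps "z(i0 := u)" t] by (auto simp: image_iff)
  moreover have "cleared_sum t ps u (z(i0 := u)) Y = cleared_sum t ps u z Y"
    using eq by (rule cleared_sum_cong)
  moreover have "(\<Prod>j\<in>Y. (z(i0 := u)) j - u) = (\<Prod>j\<in>Y. z j - u)"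
    using eq by (intro prod.cong) auto
  ultimately show ?thesis by simp
qed

text \<open>
  The polynomial \<open>cleared_sum\<close> vanishes where two points meet, so the poles of the symmetrisation are
  removable in each point separately.  This is what the maximum principle needs.
\<close>

lemma hl_sum_entire_extension:
  assumes "finite Y" "inj_on z Y" "i0 \<notin> Y" "Suc (card Y) = length ps"
  shows "\<exists>g. g holomorphic_on UNIV \<and>
    (\<forall>u. u \<notin> z ` Y \<longrightarrow> g u = hl_sum t ps (z(i0 := u)) (insert i0 Y))"
proof -
  have "cleared_sum t ps (z j) z Y = 0" if "j \<in> Y" for j
    using assms that by (intro cleared_sum_vanishes) auto
  then obtain g where g: "g holomorphic_on UNIV"
      "\<And>u. cleared_sum t ps u z Y = (\<Prod>j\<in>Y. z j - u) * g u"
    using factor_at_zeros[OF assms(1,2) holomorphic_cleared_sum] by metis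
  have "g u = hl_sum t ps (z(i0 := u)) (insert i0 Y)" if u: "u \<notin> z ` Y" for u
  proof -
    have "(\<Prod>j\<in>Y. z j - u) \<noteq> 0" using u assms(1) by auto
    then show ?thesis using g(2)[of u] cleared_sum_eq_upd[OF assms(1,3,4) u] by simp
  qed
  with g(1) show ?thesis by blast
qed

lemma poly_bounded_on_cball:
  fixes p :: "complex poly"
  shows "\<exists>B. \<forall>u. norm u \<le> r \<longrightarrow> norm (poly p u) \<le> B"
proof -
  have "compact (poly p ` cball 0 r)"
    by (intro compact_continuous_image continuous_intros) auto
  then obtain B where "\<forall>v\<in>poly p ` cball 0 r. norm v \<le> B"
    using compact_imp_bounded bounded_iff by blast
  then show ?thesis by (intro exI[of _ B]) auto
qed

text \<open>
  Points at mutual distance at least 1 allow a direct estimate of every factor of the recursion.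
\<close>

lemma hl_sum_bounded_separated:
  assumes "norm t \<le> 1"
  shows "\<exists>B. \<forall>(z :: 'a \<Rightarrow> complex) I. finite I \<and> card I = length ps \<and> (\<forall>i\<in>I. norm (z i) \<le> r) \<and>
    (\<forall>i\<in>I. \<forall>j\<in>I. i \<noteq> j \<longrightarrow> 1 \<le> norm (z i - z j)) \<longrightarrow> norm (hl_sum t ps z I) \<le> B"
proof (induction ps)
  case Nil
  then show ?case by (intro exI[of _ 1]) auto
next
  case (Cons p ps)
  then obtain B where B: "\<And>(z :: 'a \<Rightarrow> complex) I. finite I \<Longrightarrow> card I = length ps \<Longrightarrow>
      (\<And>i. i \<in> I \<Longrightarrow> norm (z i) \<le> r) \<Longrightarrow>
      (\<And>i j. i \<in> I \<Longrightarrow> j \<in> I \<Longrightarrow> i \<noteq> j \<Longrightarrow> 1 \<le> norm (z i - z j)) \<Longrightarrow> norm (hl_sum t ps z I) \<le> B"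
    by metis
  obtain M where M: "\<And>u. norm u \<le> r \<Longrightarrow> norm (poly p u) \<le> M"
    using poly_bounded_on_cball by metis
  show ?case
  proof (intro exI[of _ "of_nat (Suc (length ps)) * (M * (2 * r) ^ length ps * B)"] allI impI, elim conjE)
    fix z :: "'a \<Rightarrow> complex" and I :: "'a set"
    assume I: "finite I" "card I = length (p # ps)" and r: "\<forall>i\<in>I. norm (z i) \<le> r"
      and sep: "\<forall>i\<in>I. \<forall>j\<in>I. i \<noteq> j \<longrightarrow> 1 \<le> norm (z i - z j)"
    have "norm (poly p (z i) * last_factor t z I i * hl_sum t ps z (I - {i}))
        \<le> M * (2 * r) ^ length ps * B" if i: "i \<in> I" for i
    proof -
      have ri: "norm (z i) \<le> r" "0 \<le> r" using r i norm_ge_zero order_trans by blast+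
      have c: "card (I - {i}) = length ps" using I i by simp
      have "norm (last_factor t z I i) \<le> (\<Prod>j\<in>I - {i}. 2 * r)"
        unfolding prod_norm[symmetric]
      proof (intro prod_mono conjI norm_ge_zero)
        fix j assume j: "j \<in> I - {i}"
        have "norm (z j - t * z i) \<le> norm (z j) + norm t * norm (z i)"
          using norm_triangle_ineq4[of "z j" "t * z i"] by (simp add: norm_mult)
        also have "\<dots> \<le> r + 1 * r"
          using r j i assms ri by (intro add_mono mult_mono) auto
        finally have "norm (z j - t * z i) \<le> 2 * r" by simp
        moreover have "1 \<le> norm (z j - z i)" using sep i j by auto
        ultimately have "norm (z j - t * z i) / norm (z j - z i) \<le> 2 * r / 1"
          using ri by (intro frac_le) auto
        then show "norm ((z j - t * z i) / (z j - z i)) \<le> 2 * r" by (simp add: norm_divide)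
      qed
      then have 1: "norm (last_factor t z I i) \<le> (2 * r) ^ length ps"
        by (simp add: c)
      have 2: "norm (hl_sum t ps z (I - {i})) \<le> B"
        using I r sep c by (intro B) auto
      have 3: "norm (poly p (z i)) \<le> M" using M ri by auto
      have "0 \<le> M" "0 \<le> B" using 2 3 norm_ge_zero order_trans by blast+
      then show ?thesis
        unfolding norm_mult using 1 2 3 ri by (intro mult_mono) auto
    qed
    from sum_norm_le[of I _ "\<lambda>_. M * (2 * r) ^ length ps * B", OF this]
    show "norm (hl_sum t (p # ps) z I) \<le> of_nat (Suc (length ps)) * (M * (2 * r) ^ length ps * B)"
      using I by simp
  qed
qed

text \<open>
  The points may be arbitrarily close to each other, where the single terms are unbounded.  By the maximum
  principle each point in turn can be moved, without decreasing the absolute value, to some place on the next of the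
  circles of radius $|r|+1, |r|+2, \dots$; at the end all points are at mutual distance at least 1.
\<close>

lemma hl_sum_bounded:
  assumes "norm t \<le> 1"
  shows "\<exists>B. \<forall>(z :: 'a \<Rightarrow> complex) I. finite I \<and> card I = length ps \<and> inj_on z I \<and>
    (\<forall>i\<in>I. norm (z i) \<le> r) \<longrightarrow> norm (hl_sum t ps z I) \<le> B"
proof -
  obtain B where B: "\<And>(z :: 'a \<Rightarrow> complex) I. finite I \<Longrightarrow> card I = length ps \<Longrightarrow>
      (\<And>i. i \<in> I \<Longrightarrow> norm (z i) \<le> \<bar>r\<bar> + length ps) \<Longrightarrow>
      (\<And>i j. i \<in> I \<Longrightarrow> j \<in> I \<Longrightarrow> i \<noteq> j \<Longrightarrow> 1 \<le> norm (z i - z j)) \<Longrightarrow> norm (hl_sum t ps z I) \<le> B"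
    using hl_sum_bounded_separated[OF assms, of ps "\<bar>r\<bar> + length ps", where 'a = 'a] by metis
  have bnd: "norm (hl_sum t ps z (W \<union> V)) \<le> B"
    if "finite W" "finite V" "W \<inter> V = {}" "card W + card V = length ps" "inj_on z (W \<union> V)"
      "\<And>i. i \<in> W \<Longrightarrow> norm (z i) \<le> \<bar>r\<bar>"
      "\<And>j. j \<in> V \<Longrightarrow> \<bar>r\<bar> + 1 \<le> norm (z j) \<and> norm (z j) \<le> \<bar>r\<bar> + card V"
      "\<And>i j. i \<in> V \<Longrightarrow> j \<in> V \<Longrightarrow> i \<noteq> j \<Longrightarrow> 1 \<le> norm (z i - z j)"
    for z :: "'a \<Rightarrow> complex" and W V
    using that
  proof (induction W arbitrary: V z rule: finite_induct)
    case empty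
    then show ?case using B[of V z] by simp
  next
    case (insert i W)
    define Y where "Y = W \<union> V"
    define \<rho> where "\<rho> = \<bar>r\<bar> + card V + 1"
    have Y: "finite Y" "i \<notin> Y" "inj_on z Y" "insert i W \<union> V = insert i Y"
      using insert by (auto simp: Y_def inj_on_insert)
    have cY: "Suc (card Y) = length ps"
      using insert by (simp add: Y_def card_Un_disjoint)
    obtain g where hol: "g holomorphic_on UNIV"
      and g: "\<And>u. u \<notin> z ` Y \<Longrightarrow> g u = hl_sum t ps (z(i := u)) (insert i Y)"
      using hl_sum_entire_extension[OF Y(1,3,2) cY] by metis
    have "norm (g (z i)) \<le> B"
    proof (rule maximum_modulus_frontier[where S = "ball 0 \<rho>" and f = g and \<xi> = "z i"])
      fix u assume "u \<in> frontier (ball (0::complex) \<rho>)"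
      then have u: "norm u = \<rho>" by (simp add: frontier_ball \<rho>_def)
      have less: "norm (z j) + 1 \<le> \<rho>" if "j \<in> Y" for j
        using that insert.prems by (fastforce simp: Y_def \<rho>_def)
      have ne: "u \<notin> z ` Y" using less u by fastforce
      have "norm (hl_sum t ps (z(i := u)) (W \<union> insert i V)) \<le> B"
      proof (rule insert.IH)
        show "inj_on (z(i := u)) (W \<union> insert i V)"
          using Y ne by (auto simp: inj_on_def Y_def)
        have iV: "i \<notin> V" "card (insert i V) = Suc (card V)" using insert by auto
        show "W \<inter> insert i V = {}" "card W + card (insert i V) = length ps"
          using insert iV by auto
        show "norm ((z(i := u)) j) \<le> \<bar>r\<bar>" if "j \<in> W" for j
          using insert that by auto
        show "\<bar>r\<bar> + 1 \<le> norm ((z(i := u)) j) \<and> norm ((z(i := u)) j) \<le> \<bar>r\<bar> + card (insert i V)"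
          if "j \<in> insert i V" for j
          using insert.prems(6)[of j] that u iV by (auto simp: \<rho>_def)
        have far: "1 \<le> norm (u - z j)" "1 \<le> norm (z j - u)" if "j \<in> V" for j
          using less[of j] that u norm_triangle_ineq2[of u "z j"] by (auto simp: Y_def norm_minus_commute)
        show "1 \<le> norm ((z(i := u)) j - (z(i := u)) k)"
          if "j \<in> insert i V" "k \<in> insert i V" "j \<noteq> k" for j k
          using insert.prems(7)[of j k] that far by auto
      qed (use insert in auto)
      then show "norm (g u) \<le> B" using g[OF ne] by (simp add: Y_def)
    next
      show "z i \<in> ball 0 \<rho>" using insert.prems(5)[of i] by (simp add: \<rho>_def)
      show "g holomorphic_on interior (ball 0 \<rho>)"
        using hol by (rule holomorphic_on_subset) auto
      show "continuous_on (closure (ball 0 \<rho>)) g"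
        using holomorphic_on_imp_continuous_on[OF hol] by (rule continuous_on_subset) auto
    qed simp
    moreover have "z i \<notin> z ` Y" using insert.prems(4) Y by (auto simp: inj_on_def)
    ultimately show ?case using g[of "z i"] Y(4) by simp
  qed
  have "norm (hl_sum t ps z W) \<le> B"
    if "finite W" "card W = length ps" "inj_on z W" "\<And>i. i \<in> W \<Longrightarrow> norm (z i) \<le> r"
    for z :: "'a \<Rightarrow> complex" and W
  proof -
    have "norm (z i) \<le> \<bar>r\<bar>" if "i \<in> W" for i
      using \<open>\<And>i. i \<in> W \<Longrightarrow> norm (z i) \<le> r\<close>[OF that] by linarith
    then show ?thesis using bnd[of W "{}" z] that(1-3) by simp
  qed
  then show ?thesis by (intro exI[of _ B]) auto
qed

section \<open>The constant symmetrisation and the permutation sum\<close>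

lemma coeff_prod_linear:
  fixes a :: "'a \<Rightarrow> complex"
  assumes "finite I"
  shows "degree (\<Prod>i\<in>I. [:a i, c:]) \<le> card I" "coeff (\<Prod>i\<in>I. [:a i, c:]) (card I) = c ^ card I"
proof -
  have "degree (\<Prod>i\<in>I. [:a i, c:]) \<le> card I \<and> coeff (\<Prod>i\<in>I. [:a i, c:]) (card I) = c ^ card I"
    using assms
  proof (induction I rule: finite_induct)
    case (insert i I)
    have "degree ([:a i, c:] * (\<Prod>i\<in>I. [:a i, c:])) \<le> 1 + card I"
      using insert by (intro order_trans[OF degree_mult_le] add_mono) auto
    moreover have "coeff ([:a i, c:] * (\<Prod>i\<in>I. [:a i, c:])) (Suc (card I)) = c ^ Suc (card I)"
      using insert by (simp add: coeff_eq_0)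
    ultimately show ?case using insert by simp
  qed simp
  then show "degree (\<Prod>i\<in>I. [:a i, c:]) \<le> card I" "coeff (\<Prod>i\<in>I. [:a i, c:]) (card I) = c ^ card I"
    by auto
qed

text \<open>
  The partial fraction expansion of $\prod_i (z_i - tu)/(z_i - u)$ in \<open>u\<close>, with value $t^N$ at infinity,
  evaluated at $u = 0$.
\<close>

lemma sum_prod_quotients:
  fixes z :: "'a \<Rightarrow> complex"
  assumes "finite I" "inj_on z I" "0 \<notin> z ` I"
  shows "(1 - t) * (\<Sum>i\<in>I. \<Prod>j\<in>I - {i}. (z j - t * z i) / (z j - z i)) = 1 - t ^ card I"
proof -
  define F where "F i = last_factor t z I i" for i
  define P where "P = (\<Prod>i\<in>I. [:z i, -t:])"
  define Q where "Q = smult (t ^ card I) (\<Prod>i\<in>I. [:z i, -1:]) +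
    (\<Sum>i\<in>I. smult ((1 - t) * z i * F i) (\<Prod>j\<in>I - {i}. [:z j, -1:]))"
  have small: "degree (\<Prod>j\<in>I - {i}. [:z j, -1:]) < card I" if "i \<in> I" for i
    using coeff_prod_linear(1)[of "I - {i}" z "-1"] assms(1) that card_Diff1_less[of I i] by simp
  have "P = Q"
  proof (rule poly_eqI_degree_lead_coeff)
    show "coeff P (card I) = coeff Q (card I)"
      using assms(1) small by (simp add: P_def Q_def coeff_prod_linear coeff_sum coeff_eq_0 power_mult_distrib[symmetric])
    show "card I \<le> card (z ` I)" using assms by (simp add: card_image)
    show "degree P \<le> card I" using assms by (simp add: P_def coeff_prod_linear)
    show "degree Q \<le> card I" unfolding Q_def
      using assms small
      by (intro degree_add_le degree_sum_le order_trans[OF degree_smult_le])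
         (auto simp: coeff_prod_linear intro: less_imp_le)
    fix u assume "u \<in> z ` I"
    then obtain k where k: "k \<in> I" "u = z k" by auto
    have "(1 - t) * z i * F i * (\<Prod>j\<in>I - {i}. z j - z k) = 0" if "i \<in> I - {k}" for i
    proof -
      have "(\<Prod>j\<in>I - {i}. z j - z k) = 0" using that k assms by (intro prod_zero) auto
      then show ?thesis by simp
    qed
    then have "(\<Sum>i\<in>I - {k}. (1 - t) * z i * F i * (\<Prod>j\<in>I - {i}. z j - z k)) = 0"
      by (rule sum.neutral[OF ballI])
    then have "poly Q u = (1 - t) * z k * F k * (\<Prod>j\<in>I - {k}. z j - z k)"
      using assms k by (simp add: Q_def poly_sum poly_prod sum.remove[of I k] prod.remove[of I k])
    also have "\<dots> = (z k - t * z k) * (F k * (\<Prod>j\<in>I - {k}. z j - z k))"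
      by (simp add: algebra_simps)
    also have "F k * (\<Prod>j\<in>I - {k}. z j - z k) = (\<Prod>j\<in>I - {k}. z j - t * z k)"
      unfolding F_def prod.distrib[symmetric] using assms k
      by (intro prod.cong) (auto simp: inj_on_def)
    also have "(z k - t * z k) * (\<Prod>j\<in>I - {k}. z j - t * z k) = poly P u"
    proof -
      have "poly P u = (\<Prod>j\<in>I. z j - t * z k)"
        unfolding P_def poly_prod k(2) by (intro prod.cong) auto
      then show ?thesis using prod.remove[OF assms(1) k(1), of "\<lambda>j. z j - t * z k"] by (simp only:)
    qed
    finally show "poly P u = poly Q u" by simp
  qed
  then have "poly P 0 = poly Q 0" by simp
  moreover have "poly P 0 = (\<Prod>i\<in>I. z i)" by (simp add: P_def poly_prod)
  moreover have "poly Q 0 = t ^ card I * (\<Prod>i\<in>I. z i) +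
      (\<Sum>i\<in>I. (1 - t) * z i * F i * (\<Prod>j\<in>I - {i}. z j))"
    by (simp add: Q_def poly_sum poly_prod)
  moreover have "(\<Sum>i\<in>I. (1 - t) * z i * F i * (\<Prod>j\<in>I - {i}. z j)) =
      (\<Sum>i\<in>I. (1 - t) * F i * (\<Prod>j\<in>I. z j))"
    using assms by (intro sum.cong refl) (simp add: prod.remove)
  ultimately have "(\<Prod>i\<in>I. z i) * 1 = (\<Prod>i\<in>I. z i) * (t ^ card I + (1 - t) * (\<Sum>i\<in>I. F i))"
    by (simp only: sum_distrib_left[symmetric] sum_distrib_right[symmetric])
       (simp add: algebra_simps)
  moreover have "(\<Prod>i\<in>I. z i) \<noteq> 0" using assms by auto
  ultimately have "1 = t ^ card I + (1 - t) * (\<Sum>i\<in>I. F i)"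
    by (simp only: mult_cancel_left) simp
  then show ?thesis unfolding F_def by (simp add: algebra_simps)
qed

text \<open>
  The symmetrisation for the empty partition; it identifies the normalising integrals as special
  cases of the integrals to be evaluated.
\<close>

lemma hl_sum_ones:
  assumes "t \<noteq> 1" "finite I" "inj_on z I" "0 \<notin> z ` I"
  shows "hl_sum t (replicate (card I) 1) z I = tfact t (card I)"
proof -
  have "hl_sum t (replicate n 1) z I = tfact t n"
    if "finite I" "inj_on z I" "0 \<notin> z ` I" "card I = n" for n I
    using that
  proof (induction n arbitrary: I)
    case (Suc n)
    have "hl_sum t (replicate n 1) z (I - {i}) = tfact t n" if "i \<in> I" for i
      using Suc.prems that by (intro Suc.IH) (auto simp: inj_on_diff)
    then have "hl_sum t (replicate (Suc n) 1) z I =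
        (\<Sum>i\<in>I. \<Prod>j\<in>I - {i}. (z j - t * z i) / (z j - z i)) * tfact t n"
      by (simp add: sum_distrib_right)
    also have "(\<Sum>i\<in>I. \<Prod>j\<in>I - {i}. (z j - t * z i) / (z j - z i)) = tint t (Suc n)"
      using sum_prod_quotients[OF Suc.prems(1-3), of t] Suc.prems(4) assms(1)
      by (simp add: tint_def field_simps)
    finally show ?case by (simp add: tfact_def)
  qed (simp add: tfact_def)
  then show ?thesis using assms by blast
qed

text \<open>
  A permutation of $N+1$ letters is a choice of the value at the last letter and a permutation of the first $N$,
  composed with the transposition that moves that value to the end.
\<close>

lemma sum_permutes_eq_hl_sum:
  "(\<Sum>w | w permutes {..<length ps}. (\<Prod>i<length ps. poly (ps ! i) (z (w i))) *
      (\<Prod>(i, j)\<in>{(i, j). i < j \<and> j < length ps}. (z (w i) - t * z (w j)) / (z (w i) - z (w j)))) =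
    hl_sum t (rev ps) z {..<length ps}"
proof (induction ps arbitrary: z rule: rev_induct)
  case Nil
  show ?case by simp
next
  case (snoc p ps)
  let ?N = "length ps"
  let ?\<tau> = "Transposition.transpose ?N"
  define G where "G z w = (\<Prod>i<?N. poly (ps ! i) (z (w i))) *
      (\<Prod>(i, j)\<in>{(i, j). i < j \<and> j < ?N}. (z (w i) - t * z (w j)) / (z (w i) - z (w j)))"
    for z :: "nat \<Rightarrow> complex" and w
  define H where "H w = (\<Prod>i<Suc ?N. poly ((ps @ [p]) ! i) (z (w i))) *
      (\<Prod>(i, j)\<in>{(i, j). i < j \<and> j < Suc ?N}. (z (w i) - t * z (w j)) / (z (w i) - z (w j)))" for w
  have pairs: "{(i, j). i < j \<and> j < Suc ?N} = {(i, j). i < j \<and> j < ?N} \<union> (\<lambda>i. (i, ?N)) ` {..<?N}"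
    by (auto simp: less_Suc_eq)
  have fin: "finite {(i, j). i < j \<and> j < ?N}"
    by (rule finite_subset[of _ "{..<?N} \<times> {..<?N}"]) auto
  have step: "H (?\<tau> b \<circ> q) =
      poly p (z b) * (\<Prod>j\<in>{..<Suc ?N} - {b}. (z j - t * z b) / (z j - z b)) *
        G (\<lambda>i. z (?\<tau> b i)) q"
    if b: "b \<in> {..<Suc ?N}" and q: "q permutes {..<?N}" for b q
  proof -
    have qN: "q ?N = ?N" using q by (simp add: permutes_def)
    have im: "?\<tau> b ` {..<?N} = {..<Suc ?N} - {b}"
      using b by (auto simp: Transposition.transpose_def image_iff)
    have "(\<Prod>i<?N. (z (?\<tau> b (q i)) - t * z b) / (z (?\<tau> b (q i)) - z b)) =
        (\<Prod>i<?N. (z (?\<tau> b i) - t * z b) / (z (?\<tau> b i) - z b))"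
      using q by (rule prod.permute[symmetric, unfolded o_def])
    also have "\<dots> = (\<Prod>j\<in>{..<Suc ?N} - {b}. (z j - t * z b) / (z j - z b))"
      unfolding im[symmetric] by (subst prod.reindex) (auto simp: inj_on_def transpose_eq_iff)
    finally have last: "(\<Prod>i<?N. (z (?\<tau> b (q i)) - t * z b) / (z (?\<tau> b (q i)) - z b)) =
      (\<Prod>j\<in>{..<Suc ?N} - {b}. (z j - t * z b) / (z j - z b))" .
    have "(\<Prod>(i, j)\<in>{(i, j). i < j \<and> j < Suc ?N}.
        (z ((?\<tau> b \<circ> q) i) - t * z ((?\<tau> b \<circ> q) j)) /
        (z ((?\<tau> b \<circ> q) i) - z ((?\<tau> b \<circ> q) j))) =
      (\<Prod>(i, j)\<in>{(i, j). i < j \<and> j < ?N}.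
        (z ((?\<tau> b \<circ> q) i) - t * z ((?\<tau> b \<circ> q) j)) /
        (z ((?\<tau> b \<circ> q) i) - z ((?\<tau> b \<circ> q) j))) *
      (\<Prod>j\<in>{..<Suc ?N} - {b}. (z j - t * z b) / (z j - z b))"
      unfolding pairs last[symmetric]
      by (subst prod.union_disjoint) (auto simp: fin prod.reindex inj_on_def qN)
    then show ?thesis
      by (simp add: H_def G_def qN nth_append mult_ac)
  qed
  have "(\<Sum>w | w permutes {..<Suc ?N}. H w) =
      (\<Sum>b\<in>{..<Suc ?N}. \<Sum>q | q permutes {..<?N}. H (?\<tau> b \<circ> q))"
    unfolding lessThan_Suc by (rule sum_over_permutations_insert) auto
  also have "\<dots> = (\<Sum>b\<in>{..<Suc ?N}. poly p (z b) * (\<Prod>j\<in>{..<Suc ?N} - {b}. (z j - t * z b) / (z j - z b)) *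
        hl_sum t (rev ps) z ({..<Suc ?N} - {b}))"
  proof (rule sum.cong[OF refl])
    fix b assume b: "b \<in> {..<Suc ?N}"
    have im: "?\<tau> b ` {..<?N} = {..<Suc ?N} - {b}"
      using b by (auto simp: Transposition.transpose_def image_iff)
    have "(\<Sum>q | q permutes {..<?N}. H (?\<tau> b \<circ> q)) =
        poly p (z b) * (\<Prod>j\<in>{..<Suc ?N} - {b}. (z j - t * z b) / (z j - z b)) *
        (\<Sum>q | q permutes {..<?N}. G (\<lambda>i. z (?\<tau> b i)) q)"
      using step[OF b] by (simp add: sum_distrib_left)
    also have "(\<Sum>q | q permutes {..<?N}. G (\<lambda>i. z (?\<tau> b i)) q) =
        hl_sum t (rev ps) (\<lambda>i. z (?\<tau> b i)) {..<?N}"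
      unfolding G_def by (rule snoc.IH)
    also have "\<dots> = hl_sum t (rev ps) z ({..<Suc ?N} - {b})"
      unfolding im[symmetric] by (rule hl_sum_reindex) (auto simp: inj_on_def transpose_eq_iff)
    finally show "(\<Sum>q | q permutes {..<?N}. H (?\<tau> b \<circ> q)) =
      poly p (z b) * (\<Prod>j\<in>{..<Suc ?N} - {b}. (z j - t * z b) / (z j - z b)) *
        hl_sum t (rev ps) z ({..<Suc ?N} - {b})" .
  qed
  finally show ?case unfolding H_def by simp
qed

lemma hall_littlewood_eq_hl_sum:
  "hall_littlewood \<mu> zs t = hl_sum t (map (monom 1) (rev \<mu>)) ((!) zs) {..<length \<mu>} / vfun \<mu> t"
  using sum_permutes_eq_hl_sum[of "map (monom 1) \<mu>" "(!) zs" t]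
  by (simp add: hall_littlewood_def Let_def poly_monom rev_map)

section \<open>Integrals over the circle with cancelling poles\<close>

lemma AE_circle_measure_norm: "AE z in circle_measure. norm z = 1"
  unfolding circle_measure_def by (subst AE_distr_iff) auto

lemma circle_integral_holomorphic:
  assumes hol: "f holomorphic_on ball 0 r" and r: "1 < r" and meas: "f \<in> borel_measurable borel"
  shows "integrable circle_measure f" "(\<integral>z. f z \<partial>circle_measure) = f 0"
proof -
  interpret prob_space circle_measure by (rule prob_space_circle_measure)
  have hol': "f holomorphic_on cball 0 1"
    using hol by (rule holomorphic_on_subset) (use r in auto)
  have "compact (f ` cball 0 1)"
    using hol' by (intro compact_continuous_image holomorphic_on_imp_continuous_on) auto
  then obtain B where B: "\<forall>w\<in>f ` cball 0 1. norm w \<le> B"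
    using compact_imp_bounded bounded_iff by blast
  show int: "integrable circle_measure f"
    using AE_circle_measure_norm meas B
    by (intro integrable_const_bound[where B = B]) (auto elim!: eventually_mono)
  have "((\<lambda>u. f u / (u - 0)) has_contour_integral (2 * of_real pi * \<i> * f 0)) (circlepath 0 1)"
    using hol' by (rule Cauchy_integral_circlepath_simple) auto
  then have "((\<lambda>u. f u / (u - 0) / (2 * pi * \<i>)) has_contour_integral
      ((2 * of_real pi * \<i> * f 0) / (2 * pi * \<i>))) (circlepath 0 1)"
    by (rule has_contour_integral_div)
  then have "contour_integral (circlepath 0 1) (\<lambda>u. f u / (2 * pi * \<i> * u)) = f 0"
    by (intro contour_integral_unique) (simp add: mult_ac)
  then show "(\<integral>z. f z \<partial>circle_measure) = f 0"
    using integral_circle_measure[OF int] by simp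
qed

text \<open>
  On the unit circle $1/z$ is the conjugate of $z$, so this is the mean value property of the
  reflected function.
\<close>

lemma circle_integral_holomorphic_inverse:
  assumes hol: "f holomorphic_on ball 0 r" and r: "1 < r" and meas: "f \<in> borel_measurable borel"
  shows "integrable circle_measure (\<lambda>z. f (inverse z))"
    and "(\<integral>z. f (inverse z) \<partial>circle_measure) = f 0"
proof -
  define g where "g = cnj \<circ> f \<circ> cnj"
  have hol_g: "g holomorphic_on ball 0 r"
  proof -
    have "cnj ` ball 0 r \<subseteq> ball 0 r" by auto
    then have "f holomorphic_on (cnj ` ball 0 r)" by (rule holomorphic_on_subset[OF hol])
    then show ?thesis unfolding g_def by (rule holomorphic_on_compose_cnj_cnj) simp
  qed
  have c: "cnj \<in> borel_measurable borel"
    by (intro borel_measurable_continuous_onI continuous_intros)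
  have meas_g: "g \<in> borel_measurable borel"
    using measurable_compose[OF measurable_compose[OF c meas] c] by (simp add: g_def o_def)
  have ae: "AE z in circle_measure. f (inverse z) = cnj (g z)"
    using AE_circle_measure_norm
  proof eventually_elim
    case (elim z)
    then have "inverse z = cnj z"
      using divide_conv_cnj[of z 1] by (simp add: inverse_eq_divide)
    then show ?case by (simp add: g_def)
  qed
  have m: "(\<lambda>z. f (inverse z)) \<in> borel_measurable circle_measure"
    using meas by simp
  have m': "(\<lambda>z. cnj (g z)) \<in> borel_measurable circle_measure"
    using measurable_compose[OF meas_g c] by simp
  note g = circle_integral_holomorphic[OF hol_g r meas_g]
  show "integrable circle_measure (\<lambda>z. f (inverse z))"
    using integrable_cong_AE[OF m m' ae] g(1) by simp
  have "(\<integral>z. f (inverse z) \<partial>circle_measure) = (\<integral>z. cnj (g z) \<partial>circle_measure)"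
    by (rule integral_cong_AE[OF m m' ae])
  also have "\<dots> = f 0" using g(2) by (simp add: g_def)
  finally show "(\<integral>z. f (inverse z) \<partial>circle_measure) = f 0" .
qed

text \<open>
  The kernel that carries the simple poles at $1$ and $-1$ on the circle of integration.
\<close>

definition paired :: "(complex \<Rightarrow> complex) \<Rightarrow> complex \<Rightarrow> complex" where
  "paired K x = x\<^sup>2 / (x\<^sup>2 - 1) * K x"

text \<open>
  Subtracting the two polar parts leaves difference quotients of $x K(x)$, which are holomorphic.
\<close>

lemma paired_decomposition:
  assumes hol: "K holomorphic_on ball 0 r" and r: "1 < r"
  obtains G where "G holomorphic_on ball 0 r" "G 0 = 0"
    "\<And>x. x \<in> ball 0 r \<Longrightarrow> x \<noteq> 1 \<Longrightarrow> x \<noteq> -1 \<Longrightarrow>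
       paired K x = G x + x / 2 * (K 1 / (x - 1) + K (-1) / (x + 1))"
proof -
  define k where "k x = x * K x" for x
  define d where "d a x = (if x = a then deriv k a else (k x - k a) / (x - a))" for a x
  define G where "G x = x / 2 * (d 1 x - d (-1) x)" for x
  have k: "k holomorphic_on ball 0 r"
    unfolding k_def using hol by (intro holomorphic_intros)
  have "d a holomorphic_on ball 0 r" for a
    unfolding d_def using k by (intro pole_lemma_open) auto
  then have "G holomorphic_on ball 0 r"
    unfolding G_def by (intro holomorphic_intros) auto
  moreover have "paired K x = G x + x / 2 * (K 1 / (x - 1) + K (-1) / (x + 1))"
    if "x \<noteq> 1" "x \<noteq> -1" for x
  proof -
    have nz: "x - 1 \<noteq> 0" "x + 1 \<noteq> 0" using that by (auto simp: add_eq_0_iff2)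
    have sq: "x\<^sup>2 - 1 = (x - 1) * (x + 1)" by (simp add: power2_eq_square algebra_simps)
    have "G x = x / 2 * ((x * K x - K 1) / (x - 1) - (x * K x + K (-1)) / (x + 1))"
      using that by (simp add: G_def d_def k_def)
    moreover have "x\<^sup>2 / ((x - 1) * (x + 1)) * K x =
        x / 2 * ((x * K x - K 1) / (x - 1) - (x * K x + K (-1)) / (x + 1)) +
        x / 2 * (K 1 / (x - 1) + K (-1) / (x + 1))"
    proof -
      define A B where "A = inverse (x - 1)" and "B = inverse (x + 1)"
      have "(x - 1) * A = 1" "(x + 1) * B = 1" using nz by (simp_all add: A_def B_def)
      then have "A - B = 2 * (A * B)" by algebra
      then have "x\<^sup>2 * (A * B) * K x =
          x / 2 * ((x * K x - K 1) * A - (x * K x + K (-1)) * B) + x / 2 * (K 1 * A + K (-1) * B)"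
        by algebra
      then show ?thesis
        unfolding A_def B_def by (simp only: divide_inverse inverse_mult_distrib)
    qed
    ultimately show ?thesis by (simp add: paired_def sq)
  qed
  ultimately show ?thesis using that[of G] by (auto simp: G_def)
qed

text \<open>
  This is why no principal value is needed: $x/(x-1)$ and $x/(x+1)$ become constant after
  adding their values at $1/x$.
\<close>

lemma pole_pair_inverse:
  fixes x :: complex
  assumes "norm x = 1" "x \<noteq> 1" "x \<noteq> -1"
  shows "x / 2 * (a / (x - 1) + b / (x + 1)) +
    inverse x / 2 * (a / (inverse x - 1) + b / (inverse x + 1)) = (a + b) / 2"
proof -
  have x0: "x \<noteq> 0" using assms by auto
  have nz: "x - 1 \<noteq> 0" "x + 1 \<noteq> 0"
    using assms by (auto simp: add_eq_0_iff2)
  have "inverse x - 1 = - ((x - 1) / x)" "inverse x + 1 = (x + 1) / x"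
    using x0 by (simp_all add: field_simps)
  then have "a / (inverse x - 1) + b / (inverse x + 1) = x * (b / (x + 1) - a / (x - 1))"
    by (simp only:) (simp add: right_diff_distrib mult.commute)
  then have 1: "inverse x / 2 * (a / (inverse x - 1) + b / (inverse x + 1)) =
      (b / (x + 1) - a / (x - 1)) / 2"
    using x0 by (simp only:) simp
  have 2: "x * (a / (x - 1)) - a / (x - 1) = a"
    using nz(1) by (simp add: diff_divide_distrib[symmetric] divide_eq_eq) (simp add: algebra_simps)
  have 3: "x * (b / (x + 1)) + b / (x + 1) = b"
    using nz(2) by (simp add: add_divide_distrib[symmetric] divide_eq_eq) (simp add: algebra_simps)
  have "x / 2 * (a / (x - 1) + b / (x + 1)) + (b / (x + 1) - a / (x - 1)) / 2 =
      ((x * (a / (x - 1)) - a / (x - 1)) + (x * (b / (x + 1)) + b / (x + 1))) / 2"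
  proof -
    have "x / 2 * (A + B) + (B - A) / 2 = ((x * A - A) + (x * B + B)) / 2" for A B
      by (simp add: field_simps)
    then show ?thesis .
  qed
  then show ?thesis unfolding 1 2 3 .
qed

lemma inverse_unit:
  fixes x :: complex
  assumes "norm x = 1" "x \<noteq> 1" "x \<noteq> -1"
  shows "norm (inverse x) = 1" "inverse x \<noteq> 1" "inverse x \<noteq> -1"
proof -
  have "inverse x = -1 \<longleftrightarrow> x = -1"
    using inverse_eq_iff_eq[of x "-1"] by simp
  then show "inverse x \<noteq> -1" using assms by simp
qed (use assms in \<open>auto simp: norm_inverse\<close>)

text \<open>
  The holomorphic part of \<open>paired_decomposition\<close> vanishes at $0$ and so integrates to $0$; the polar parts
  contribute the constant from \<open>pole_pair_inverse\<close>.
\<close>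

lemma circle_integral_paired:
  assumes hol: "K holomorphic_on ball 0 r" and r: "1 < r" and meas: "f \<in> borel_measurable borel"
    and f: "AE x in circle_measure. f x = paired K x + paired K (inverse x)"
  shows "(\<integral>x. f x \<partial>circle_measure) = (K 1 + K (-1)) / 2"
proof -
  interpret prob_space circle_measure by (rule prob_space_circle_measure)
  obtain G where G: "G holomorphic_on ball 0 r" "G 0 = 0"
    "\<And>x. x \<in> ball 0 r \<Longrightarrow> x \<noteq> 1 \<Longrightarrow> x \<noteq> -1 \<Longrightarrow>
       paired K x = G x + x / 2 * (K 1 / (x - 1) + K (-1) / (x + 1))"
    by (rule paired_decomposition[OF hol r]) blast
  \<comment> \<open>$G$ is controlled only on the disc; cutting it off makes it measurable on the whole plane.\<close>
  define H where "H x = (if x \<in> ball 0 r then G x else 0)" for x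
  have H: "H holomorphic_on ball 0 r"
    using G(1) by (rule holomorphic_transform) (simp add: H_def)
  have mH: "H \<in> borel_measurable borel"
    unfolding H_def using G(1)
    by (intro borel_measurable_continuous_on_if holomorphic_on_imp_continuous_on) auto
  note int = circle_integral_holomorphic[OF H r mH] circle_integral_holomorphic_inverse[OF H r mH]
  have "AE x in circle_measure. f x = H x + H (inverse x) + (K 1 + K (-1)) / 2"
    using f AE_circle_measure_norm AE_circle_measure_neq[of 1] AE_circle_measure_neq[of "-1"]
  proof eventually_elim
    case (elim x)
    note f = elim(1) and elim = elim(2-)
    note i = inverse_unit[OF elim]
    have "f x = G x + x / 2 * (K 1 / (x - 1) + K (-1) / (x + 1)) +
        (G (inverse x) + inverse x / 2 * (K 1 / (inverse x - 1) + K (-1) / (inverse x + 1)))"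
      using f G(3)[of x] G(3)[of "inverse x"] elim i r by simp
    then show ?case
      unfolding pole_pair_inverse[OF elim, of "K 1" "K (-1)", symmetric]
      using elim i r by (simp add: H_def)
  qed
  moreover have "(\<lambda>x. H x + H (inverse x) + (K 1 + K (-1)) / 2) \<in> borel_measurable circle_measure"
    using mH by simp
  ultimately have "(\<integral>x. f x \<partial>circle_measure) =
      (\<integral>x. H x + H (inverse x) + (K 1 + K (-1)) / 2 \<partial>circle_measure)"
    using meas by (intro integral_cong_AE) auto
  also have "\<dots> = (K 1 + K (-1)) / 2"
    using int G(2) r by (simp add: prob_space[simplified]) (simp add: H_def)
  finally show ?thesis .
qed

text \<open>
  The bound depends on $K$ only through its size on a larger circle.  It is therefore uniform in
  all parameters of $K$, which is what integrability in several variables requires.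
\<close>

lemma paired_bound:
  assumes hol: "K holomorphic_on ball 0 r" and rho: "1 < \<rho>" "\<rho> < r"
    and M: "\<And>x. norm x = \<rho> \<Longrightarrow> norm (K x) \<le> M"
    and x: "norm x = 1" "x \<noteq> 1" "x \<noteq> -1"
  shows "norm (paired K x + paired K (inverse x)) \<le> (2 * (\<rho>\<^sup>2 / (\<rho>\<^sup>2 - 1) + \<rho> / (\<rho> - 1)) + 1) * M"
proof -
  have r: "1 < r" using rho by simp
  have maxmod: "norm (g y) \<le> B"
    if "g holomorphic_on ball 0 r" "\<And>y. norm y = \<rho> \<Longrightarrow> norm (g y) \<le> B" "norm y \<le> 1" for g y B
  proof (rule maximum_modulus_frontier[where S = "ball 0 \<rho>" and f = g and \<xi> = y])
    show "g holomorphic_on interior (ball 0 \<rho>)"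
      using that(1) by (rule holomorphic_on_subset) (use rho in auto)
    show "continuous_on (closure (ball 0 \<rho>)) g"
      using holomorphic_on_imp_continuous_on[OF that(1)]
      by (rule continuous_on_subset) (use rho in auto)
  qed (use that rho in \<open>auto simp: frontier_ball\<close>)
  obtain G where G: "G holomorphic_on ball 0 r" "G 0 = 0"
    "\<And>x. x \<in> ball 0 r \<Longrightarrow> x \<noteq> 1 \<Longrightarrow> x \<noteq> -1 \<Longrightarrow>
       paired K x = G x + x / 2 * (K 1 / (x - 1) + K (-1) / (x + 1))"
    by (rule paired_decomposition[OF hol r]) blast
  have K1: "norm (K 1) \<le> M" "norm (K (-1)) \<le> M"
    using maxmod[OF hol M] by auto
  then have M0: "0 \<le> M" using norm_ge_zero order_trans by blast
  have "norm (G y) \<le> (\<rho>\<^sup>2 / (\<rho>\<^sup>2 - 1) + \<rho> / (\<rho> - 1)) * M" if y: "norm y = \<rho>" for y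
  proof -
    have "y \<noteq> 1" "y \<noteq> -1" using y rho by auto
    then have "G y = paired K y - y / 2 * (K 1 / (y - 1) + K (-1) / (y + 1))"
      using G(3)[of y] y rho by simp
    also have "norm \<dots> \<le> norm (paired K y) + norm (y / 2 * (K 1 / (y - 1) + K (-1) / (y + 1)))"
      by (rule norm_triangle_ineq4)
    also have "norm (paired K y) \<le> \<rho>\<^sup>2 / (\<rho>\<^sup>2 - 1) * M"
    proof -
      have "\<rho>\<^sup>2 - 1 \<le> norm (y\<^sup>2 - 1)"
        using norm_triangle_ineq2[of "y\<^sup>2" 1] y by (simp add: norm_power)
      moreover have "0 < \<rho>\<^sup>2 - 1" using rho by (simp add: power2_eq_square less_1_mult)
      ultimately have "\<rho>\<^sup>2 / norm (y\<^sup>2 - 1) \<le> \<rho>\<^sup>2 / (\<rho>\<^sup>2 - 1)"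
        by (intro divide_left_mono mult_pos_pos) auto
      then show ?thesis
        unfolding paired_def norm_mult norm_divide using y M[OF y] M0 rho
        by (intro mult_mono) (auto simp: norm_power)
    qed
    also have "norm (y / 2 * (K 1 / (y - 1) + K (-1) / (y + 1))) \<le> \<rho> / 2 * (M / (\<rho> - 1) + M / (\<rho> - 1))"
    proof -
      have "\<rho> - 1 \<le> norm (y - 1)" "\<rho> - 1 \<le> norm (y + 1)"
        using norm_triangle_ineq2[of y 1] norm_triangle_ineq2[of y "-1"] y by auto
      then have "norm (K 1) / norm (y - 1) \<le> M / (\<rho> - 1)" "norm (K (-1)) / norm (y + 1) \<le> M / (\<rho> - 1)"
        using K1 rho M0 by (intro frac_le; simp)+
      then have "norm (K 1 / (y - 1) + K (-1) / (y + 1)) \<le> M / (\<rho> - 1) + M / (\<rho> - 1)"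
        by (intro order_trans[OF norm_triangle_ineq] add_mono) (simp_all add: norm_divide)
      then show ?thesis unfolding norm_mult norm_divide using y rho
        by (intro mult_mono) auto
    qed
    also have "\<rho> / 2 * (M / (\<rho> - 1) + M / (\<rho> - 1)) = \<rho> / (\<rho> - 1) * M"
      by simp
    finally show ?thesis by (simp add: distrib_right)
  qed
  then have Gb: "norm (G y) \<le> (\<rho>\<^sup>2 / (\<rho>\<^sup>2 - 1) + \<rho> / (\<rho> - 1)) * M" if "norm y = 1" for y
    using maxmod[OF G(1)] that by auto
  note i = inverse_unit[OF x]
  have "paired K x + paired K (inverse x) = G x + x / 2 * (K 1 / (x - 1) + K (-1) / (x + 1)) +
      (G (inverse x) + inverse x / 2 * (K 1 / (inverse x - 1) + K (-1) / (inverse x + 1)))"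
    using G(3)[of x] G(3)[of "inverse x"] x i r by simp
  also have "\<dots> = G x + G (inverse x) + (K 1 + K (-1)) / 2"
    unfolding pole_pair_inverse[OF x, of "K 1" "K (-1)", symmetric] by (simp only: add.assoc add.left_commute)
  also have "norm \<dots> \<le> norm (G x) + norm (G (inverse x)) + norm ((K 1 + K (-1)) / 2)"
    by (intro order_trans[OF norm_triangle_ineq] add_mono norm_triangle_ineq) auto
  also have "\<dots> \<le> (\<rho>\<^sup>2 / (\<rho>\<^sup>2 - 1) + \<rho> / (\<rho> - 1)) * M + (\<rho>\<^sup>2 / (\<rho>\<^sup>2 - 1) + \<rho> / (\<rho> - 1)) * M + M"
  proof (intro add_mono Gb x i)
    have "norm (K 1 + K (-1)) \<le> M + M"
      using K1 by (intro order_trans[OF norm_triangle_ineq] add_mono)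
    then show "norm ((K 1 + K (-1)) / 2) \<le> M" by (simp add: norm_divide)
  qed
  finally show ?thesis by (simp add: algebra_simps)
qed

section \<open>Spectra closed under inversion and their density\<close>

text \<open>
  Names for the arguments of the Hall--Littlewood polynomial: the variables, their inverses, and the fixed
  eigenvalues.  Working with names instead of values keeps index sets disjoint where values may
  coincide.
\<close>

datatype eigen = Var nat | Inv nat | Plus | Minus

fun eig :: "(nat \<Rightarrow> complex) \<Rightarrow> eigen \<Rightarrow> complex" where
  "eig x (Var i) = x i"
| "eig x (Inv i) = inverse (x i)"
| "eig x Plus = 1"
| "eig x Minus = -1"

abbreviation fixed :: "eigen \<Rightarrow> complex" where
  "fixed q \<equiv> eig (\<lambda>_. 1) q"

abbreviation signs :: "eigen set" where
  "signs \<equiv> {Plus, Minus}"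

definition spectrum :: "eigen set \<Rightarrow> nat set \<Rightarrow> eigen set" where
  "spectrum F J = Var ` J \<union> Inv ` J \<union> F"

text \<open>
  The Koornwinder factor of one variable after cancellation: the parameters $\pm\sqrt t$ give the denominator
  $1 - t x^{\pm2}$, and the parameters $\pm1$ cancel the numerator.  Replacing the parameter $\varepsilon = \pm1$ by
  $t\varepsilon$ has the effect of an interaction with the fixed point $\varepsilon$.
\<close>

definition weight :: "complex \<Rightarrow> eigen set \<Rightarrow> complex \<Rightarrow> complex" where
  "weight t F u = (\<Prod>q\<in>F. pm1 (fixed q) u / pm1 (t * fixed q) u) / pm1 t (u\<^sup>2)"

text \<open>
  The symmetric Koornwinder density, over any finite set of variables so that variables can be integrated out in any
  order without renaming.
\<close>

definition eig_density :: "complex \<Rightarrow> eigen set \<Rightarrow> nat set \<Rightarrow> (nat \<Rightarrow> complex) \<Rightarrow> complex" where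
  "eig_density t F J x = 1 / (2 ^ card J * fact (card J)) * (\<Prod>i\<in>J. weight t F (x i)) *
     (\<Prod>(i, j)\<in>{(i, j). i \<in> J \<and> j \<in> J \<and> i < j}. pm2 1 (x i) (x j) / pm2 t (x i) (x j))"

text \<open>
  Almost every point of the torus is generic, and at generic points no denominator in the argument vanishes.
\<close>

definition generic :: "nat set \<Rightarrow> (nat \<Rightarrow> complex) \<Rightarrow> bool" where
  "generic J x \<longleftrightarrow> (\<forall>j\<in>J. norm (x j) = 1) \<and> inj_on (eig x) (spectrum signs J)"

lemma finite_fixed: "F \<subseteq> signs \<Longrightarrow> finite F"
  by (rule finite_subset) auto

lemma finite_spectrum [simp]: "finite J \<Longrightarrow> F \<subseteq> signs \<Longrightarrow> finite (spectrum F J)"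
  by (auto simp: spectrum_def finite_fixed)

lemma eig_fixed: "q \<in> signs \<Longrightarrow> eig x q = fixed q" "q \<in> signs \<Longrightarrow> fixed q * fixed q = 1"
  by auto

lemma prod_spectrum:
  assumes "finite J" "F \<subseteq> signs"
  shows "(\<Prod>b\<in>spectrum F J. g b) = (\<Prod>j\<in>J. g (Var j) * g (Inv j)) * (\<Prod>q\<in>F. g q)"
proof -
  have "(\<Prod>b\<in>spectrum F J. g b) = (\<Prod>b\<in>Var ` J. g b) * (\<Prod>b\<in>Inv ` J. g b) * (\<Prod>q\<in>F. g q)"
    unfolding spectrum_def using assms finite_fixed[of F]
    by (subst prod.union_disjoint, auto)+
  also have "(\<Prod>b\<in>Var ` J. g b) = (\<Prod>j\<in>J. g (Var j))" by (subst prod.reindex) (auto simp: inj_on_def)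
  also have "(\<Prod>b\<in>Inv ` J. g b) = (\<Prod>j\<in>J. g (Inv j))" by (subst prod.reindex) (auto simp: inj_on_def)
  finally show ?thesis by (simp add: prod.distrib)
qed

lemma card_spectrum:
  assumes "finite J" "F \<subseteq> signs"
  shows "card (spectrum F J) = 2 * card J + card F"
proof -
  have "card (Var ` J \<union> Inv ` J \<union> F) = card (Var ` J) + card (Inv ` J) + card F"
    using assms finite_fixed[of F] by (subst card_Un_disjoint, auto)+
  then show ?thesis by (simp add: spectrum_def card_image inj_on_def)
qed

lemma card_spectrum_remove:
  assumes "finite J" "F \<subseteq> signs" "q \<in> F"
  shows "Suc (card (spectrum (F - {q}) J)) = card (spectrum F J)"
proof -
  have "F - {q} \<subseteq> signs" using assms(2) by blast
  moreover have "card F = Suc (card (F - {q}))"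
    using assms(3) finite_fixed[OF assms(2)] by (intro card.remove)
  ultimately show ?thesis using assms by (simp only: card_spectrum)
qed

lemma card_spectrum_exchange:
  assumes "finite J" "F \<subseteq> signs" "q \<in> signs - F" "i \<in> J"
  shows "Suc (card (spectrum (insert q F) (J - {i}))) = card (spectrum F J)"
proof -
  define a where "a = card (J - {i})"
  have sub: "insert q F \<subseteq> signs" using assms(2,3) by blast
  have "card J = Suc a" unfolding a_def using assms(1,4) by (intro card.remove)
  then have 1: "card (spectrum F J) = 2 * Suc a + card F"
    unfolding card_spectrum[OF assms(1,2)] by simp
  have "card (insert q F) = Suc (card F)" using assms(3) finite_fixed[OF assms(2)] by simp
  then have 2: "card (spectrum (insert q F) (J - {i})) = 2 * a + Suc (card F)"
    using card_spectrum[OF _ sub, of "J - {i}"] assms(1) unfolding a_def by simp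
  show ?thesis unfolding 1 2 by simp
qed

text \<open>
  The spectrum is closed under inversion.  All cancellations between the density and the
  Hall--Littlewood factors rest on this symmetry.
\<close>

lemma prod_spectrum_inverse:
  assumes "finite J" "F \<subseteq> signs"
  shows "(\<Prod>b\<in>spectrum F J. g (eig x b)) = (\<Prod>b\<in>spectrum F J. g (inverse (eig x b)))"
proof -
  have "(\<Prod>q\<in>F. g (eig x q)) = (\<Prod>q\<in>F. g (inverse (eig x q)))"
    using assms by (intro prod.cong) auto
  then show ?thesis using assms by (simp add: prod_spectrum mult.commute)
qed

lemma spectrum_insert:
  "spectrum F (insert i J) = insert (Var i) (insert (Inv i) (spectrum F J))"
  "spectrum (insert q F) J = insert q (spectrum F J)"
  by (auto simp: spectrum_def)

lemma spectrum_mono: "F \<subseteq> F' \<Longrightarrow> J \<subseteq> J' \<Longrightarrow> spectrum F J \<subseteq> spectrum F' J'"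
  by (auto simp: spectrum_def)

lemma generic_subset: "generic J x \<Longrightarrow> J' \<subseteq> J \<Longrightarrow> generic J' x"
  unfolding generic_def
  using inj_on_subset[OF _ spectrum_mono[OF order.refl, of J' J "{Plus, Minus}"], of "eig x"] by auto

lemma generic_inj: "generic J x \<Longrightarrow> F \<subseteq> signs \<Longrightarrow> inj_on (eig x) (spectrum F J)"
  unfolding generic_def
  using inj_on_subset[OF _ spectrum_mono[OF _ order.refl, of F "{Plus, Minus}" J], of "eig x"] by auto

lemma generic_norm:
  assumes "generic J x" "F \<subseteq> signs" "b \<in> spectrum F J"
  shows "norm (eig x b) = 1" "eig x b \<noteq> 0"
proof -
  show "norm (eig x b) = 1"
    using assms by (cases b) (auto simp: spectrum_def generic_def norm_inverse)
  then show "eig x b \<noteq> 0" by auto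
qed

lemma generic_neq:
  assumes "generic J x" "i \<in> J"
  shows "x i \<noteq> 0" "x i \<noteq> 1" "x i \<noteq> -1" "inverse (x i) \<noteq> 1" "inverse (x i) \<noteq> -1" "x i \<noteq> inverse (x i)"
proof -
  have inj: "inj_on (eig x) (spectrum signs J)" using assms by (simp add: generic_def)
  have m: "Var i \<in> spectrum {Plus, Minus} J" "Inv i \<in> spectrum {Plus, Minus} J"
     "Plus \<in> spectrum {Plus, Minus} J" "Minus \<in> spectrum {Plus, Minus} J"
    using assms by (auto simp: spectrum_def)
  show "x i \<noteq> 1" "x i \<noteq> -1" "inverse (x i) \<noteq> 1" "inverse (x i) \<noteq> -1" "x i \<noteq> inverse (x i)"
    using inj_onD[OF inj, of "Var i" Plus] inj_onD[OF inj, of "Var i" Minus]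
      inj_onD[OF inj, of "Inv i" Plus] inj_onD[OF inj, of "Inv i" Minus]
      inj_onD[OF inj, of "Var i" "Inv i"] m by auto
  show "x i \<noteq> 0" using assms by (auto simp: generic_def)
qed

lemma pm1_inverse: "pm1 c (inverse u) = pm1 c u"
  by (simp add: pm1_def mult.commute)

lemma pm2_eq_pm1: "pm2 c u v = pm1 (c * v) u * pm1 (c * inverse v) u"
  by (simp add: pm1_def pm2_def mult_ac)

lemma pm2_commute: "pm2 c u v = pm2 c v u"
  by (simp add: pm2_def mult_ac)

lemma pm1_nonzero:
  assumes "norm u = 1" "norm c < 1"
  shows "pm1 c u \<noteq> 0"
proof -
  have "norm (c * u) \<noteq> 1" "norm (c * inverse u) \<noteq> 1"
    using assms by (simp_all add: norm_mult norm_inverse)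
  then show ?thesis unfolding pm1_def by (metis eq_iff_diff_eq_0 mult_eq_0_iff norm_one)
qed

text \<open>
  All factors of the density that involve a variable with value \<open>u\<close>, when \<open>Y\<close> is the rest of the spectrum.
\<close>

definition interaction :: "complex \<Rightarrow> (nat \<Rightarrow> complex) \<Rightarrow> eigen set \<Rightarrow> complex \<Rightarrow> complex" where
  "interaction t x Y u = (\<Prod>b\<in>Y. pm1 (eig x b) u / pm1 (t * eig x b) u) / pm1 t (u\<^sup>2)"

lemma density_insert:
  assumes "finite J" "i \<notin> J" "F \<subseteq> signs"
  shows "eig_density t F (insert i J) x =
    eig_density t F J x * interaction t x (spectrum F J) (x i) / (2 * of_nat (Suc (card J)))"
proof -
  let ?r = "\<lambda>i j. pm2 1 (x i) (x j) / pm2 t (x i) (x j)"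
  let ?P = "{(a, b). a \<in> J \<and> b \<in> J \<and> a < b}"
  have fin: "finite ?P" by (rule finite_subset[of _ "J \<times> J"]) (use assms in auto)
  have pairs: "{(a, b). a \<in> insert i J \<and> b \<in> insert i J \<and> a < b} =
      ?P \<union> (Pair i ` {j \<in> J. i < j} \<union> (\<lambda>j. (j, i)) ` {j \<in> J. j < i})"
    by auto
  have split: "J = {j \<in> J. i < j} \<union> {j \<in> J. j < i}"
    using assms(2) by (auto simp: not_less le_less)
  have "(\<Prod>(a, b)\<in>{(a, b). a \<in> insert i J \<and> b \<in> insert i J \<and> a < b}. ?r a b) =
      (\<Prod>(a, b)\<in>?P. ?r a b) * (\<Prod>(a, b)\<in>Pair i ` {j \<in> J. i < j} \<union> (\<lambda>j. (j, i)) ` {j \<in> J. j < i}. ?r a b)"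
    unfolding pairs using assms fin by (intro prod.union_disjoint) auto
  also have "(\<Prod>(a, b)\<in>Pair i ` {j \<in> J. i < j} \<union> (\<lambda>j. (j, i)) ` {j \<in> J. j < i}. ?r a b) =
      (\<Prod>j\<in>{j \<in> J. i < j}. ?r i j) * (\<Prod>j\<in>{j \<in> J. j < i}. ?r i j)"
    using assms by (subst prod.union_disjoint)
      (auto simp: prod.reindex inj_on_def pm2_commute[of _ "x i"])
  also have "\<dots> = (\<Prod>j\<in>J. ?r i j)"
    by (subst (3) split, subst prod.union_disjoint) (use assms in auto)
  also have "\<dots> = (\<Prod>j\<in>J. (pm1 (eig x (Var j)) (x i) / pm1 (t * eig x (Var j)) (x i)) *
        (pm1 (eig x (Inv j)) (x i) / pm1 (t * eig x (Inv j)) (x i)))"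
    by (simp add: pm2_eq_pm1)
  finally have 1: "(\<Prod>(a, b)\<in>{(a, b). a \<in> insert i J \<and> b \<in> insert i J \<and> a < b}. ?r a b) =
    (\<Prod>(a, b)\<in>?P. ?r a b) * (\<Prod>j\<in>J. (pm1 (eig x (Var j)) (x i) / pm1 (t * eig x (Var j)) (x i)) *
        (pm1 (eig x (Inv j)) (x i) / pm1 (t * eig x (Inv j)) (x i)))" .
  have 2: "weight t F (x i) = (\<Prod>q\<in>F. pm1 (eig x q) (x i) / pm1 (t * eig x q) (x i)) / pm1 t ((x i)\<^sup>2)"
    unfolding weight_def using assms by (intro arg_cong2[where f = "(/)"] prod.cong) auto
  have 3: "(2::complex) ^ card (insert i J) * fact (card (insert i J)) =
      (2 ^ card J * fact (card J)) * (2 * of_nat (Suc (card J)))"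
    using assms by (simp add: mult_ac)
  have "eig_density t F (insert i J) x = 1 / (2 ^ card (insert i J) * fact (card (insert i J))) *
      (weight t F (x i) * (\<Prod>j\<in>J. weight t F (x j))) *
      (\<Prod>(a, b)\<in>{(a, b). a \<in> insert i J \<and> b \<in> insert i J \<and> a < b}. ?r a b)"
    unfolding eig_density_def using assms by simp
  also have "\<dots> = eig_density t F J x * interaction t x (spectrum F J) (x i) / (2 * of_nat (Suc (card J)))"
    unfolding 1 2 3 eig_density_def interaction_def prod_spectrum[OF assms(1,3)]
    by (simp only: divide_inverse inverse_mult_distrib mult_1_left mult_1_right mult_ac)
  finally show ?thesis .
qed

text \<open>
  The function $K$ of the overview.  Its denominators vanish only for $|u| \geq |t|^{-1/2}$ if the spectrum lies on the
  unit circle.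
\<close>

definition residue_kernel :: "complex \<Rightarrow> complex poly list \<Rightarrow> (nat \<Rightarrow> complex) \<Rightarrow> eigen set \<Rightarrow> complex \<Rightarrow> complex" where
  "residue_kernel t ps x Y u = cleared_sum t ps u (eig x) Y / (\<Prod>b\<in>Y. eig x b - t * u) / (1 - t * u\<^sup>2)"

lemma nonzero_linear:
  assumes "norm (t::complex) < 1" "norm u = 1" "norm b = 1"
  shows "b - t * u \<noteq> 0" "1 - t * b * u \<noteq> 0" "1 - t * u\<^sup>2 \<noteq> 0" "1 - t * inverse (u\<^sup>2) \<noteq> 0"
    "1 - t * b * inverse u \<noteq> 0"
proof -
  have *: "a \<noteq> c" if "norm a \<noteq> norm c" for a c :: complex using that by auto
  show "b - t * u \<noteq> 0" "1 - t * b * u \<noteq> 0" "1 - t * u\<^sup>2 \<noteq> 0" "1 - t * inverse (u\<^sup>2) \<noteq> 0"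
    "1 - t * b * inverse u \<noteq> 0"
    unfolding right_minus_eq using assms
    by (intro *; simp add: norm_mult norm_power norm_inverse)+
qed

text \<open>
  Inverting the points of \<open>Y\<close> in some of the products shows that the factors for
  $1/u$ in the last slot cancel half of the interaction.  The surviving factors from \<open>Y\<close> have zeros at the
  points of \<open>Y\<close> and poles only outside the closed unit disc.
\<close>

lemma interaction_times_last:
  assumes "norm t < 1" "generic J x" "finite J" "F \<subseteq> signs"
    and u: "norm u = 1" "u \<noteq> 1" "u \<noteq> -1" "u \<notin> eig x ` spectrum F J" "inverse u \<notin> eig x ` spectrum F J"
  shows "interaction t x (spectrum F J) u * ((u - t * inverse u) / (u - inverse u)) *
      (\<Prod>b\<in>spectrum F J. (eig x b - t * inverse u) / (eig x b - inverse u)) =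
    u\<^sup>2 / (u\<^sup>2 - 1) * (\<Prod>b\<in>spectrum F J. eig x b - u) / (\<Prod>b\<in>spectrum F J. eig x b - t * u) / (1 - t * u\<^sup>2)"
proof -
  let ?Y = "spectrum F J"
  have u0: "u \<noteq> 0" using u by auto
  have b: "norm (eig x b) = 1" "eig x b \<noteq> 0" if "b \<in> ?Y" for b
    using generic_norm[OF assms(2,4) that] .
  have inv_mem: "inverse (eig x b) \<in> eig x ` ?Y" if "b \<in> ?Y" for b
  proof (cases b)
    case (Var j)
    then have "Inv j \<in> ?Y" "eig x (Inv j) = inverse (eig x b)"
      using that assms(4) by (auto simp: spectrum_def)
    then show ?thesis by (metis image_eqI)
  next
    case (Inv j)
    then have "Var j \<in> ?Y" "eig x (Var j) = inverse (eig x b)"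
      using that assms(4) by (auto simp: spectrum_def)
    then show ?thesis by (metis image_eqI)
  qed (use that in \<open>auto simp: image_iff intro!: bexI[of _ b]\<close>)
  have "(\<Prod>b\<in>?Y. (eig x b - t * inverse u) / (eig x b - inverse u)) =
      (\<Prod>b\<in>?Y. (inverse (eig x b) - t * inverse u) / (inverse (eig x b) - inverse u))"
    using assms by (intro prod_spectrum_inverse)
  also have "\<dots> = (\<Prod>b\<in>?Y. (1 - t * eig x b * inverse u) / (1 - eig x b * inverse u))"
  proof (rule prod.cong[OF refl])
    fix c assume "c \<in> ?Y"
    then have "eig x c \<noteq> 0" using b by auto
    then have "inverse (eig x c) - t * inverse u = inverse (eig x c) * (1 - t * eig x c * inverse u)"
      "inverse (eig x c) - inverse u = inverse (eig x c) * (1 - eig x c * inverse u)"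
      by (simp_all add: right_diff_distrib)
    then show "(inverse (eig x c) - t * inverse u) / (inverse (eig x c) - inverse u) =
        (1 - t * eig x c * inverse u) / (1 - eig x c * inverse u)"
      using \<open>eig x c \<noteq> 0\<close> by simp
  qed
  finally have 1: "(\<Prod>b\<in>?Y. (eig x b - t * inverse u) / (eig x b - inverse u)) =
    (\<Prod>b\<in>?Y. (1 - t * eig x b * inverse u) / (1 - eig x b * inverse u))" .
  have "(\<Prod>b\<in>?Y. pm1 (eig x b) u / pm1 (t * eig x b) u) *
      (\<Prod>b\<in>?Y. (1 - t * eig x b * inverse u) / (1 - eig x b * inverse u)) =
      (\<Prod>b\<in>?Y. (1 - eig x b * u) / (1 - t * eig x b * u))"
    unfolding prod.distrib[symmetric]
  proof (rule prod.cong[OF refl])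
    fix c assume c: "c \<in> ?Y"
    have "eig x c \<noteq> u" using u(4) c by auto
    then have "1 - eig x c * inverse u \<noteq> 0" using u0 by (simp add: field_simps)
    moreover have "1 - t * eig x c * inverse u \<noteq> 0"
      using nonzero_linear(5)[OF assms(1) u(1) b(1)[OF c]] by simp
    ultimately show "pm1 (eig x c) u / pm1 (t * eig x c) u * ((1 - t * eig x c * inverse u) / (1 - eig x c * inverse u)) =
        (1 - eig x c * u) / (1 - t * eig x c * u)"
      unfolding pm1_def by (simp only: times_divide_times_eq) (simp add: mult_ac)
  qed
  also have "\<dots> = (\<Prod>b\<in>?Y. (1 - inverse (eig x b) * u) / (1 - t * inverse (eig x b) * u))"
    using assms by (intro prod_spectrum_inverse[where g = "\<lambda>b. (1 - b * u) / (1 - t * b * u)"])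
  also have "\<dots> = (\<Prod>b\<in>?Y. (eig x b - u) / (eig x b - t * u))"
  proof (rule prod.cong[OF refl])
    fix c assume "c \<in> ?Y"
    then have "eig x c \<noteq> 0" using b by auto
    then have "eig x c - u = eig x c * (1 - inverse (eig x c) * u)"
      "eig x c - t * u = eig x c * (1 - t * inverse (eig x c) * u)"
      by (simp_all add: right_diff_distrib)
    then show "(1 - inverse (eig x c) * u) / (1 - t * inverse (eig x c) * u) = (eig x c - u) / (eig x c - t * u)"
      using \<open>eig x c \<noteq> 0\<close> by simp
  qed
  finally have 2: "(\<Prod>b\<in>?Y. pm1 (eig x b) u / pm1 (t * eig x b) u) *
      (\<Prod>b\<in>?Y. (1 - t * eig x b * inverse u) / (1 - eig x b * inverse u)) =
      (\<Prod>b\<in>?Y. eig x b - u) / (\<Prod>b\<in>?Y. eig x b - t * u)"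
    by (simp add: prod_dividef)
  have "u\<^sup>2 \<noteq> 1" using u by (simp add: power2_eq_1_iff)
  have n: "1 - t * u\<^sup>2 \<noteq> 0" "1 - t * inverse (u\<^sup>2) \<noteq> 0"
    using nonzero_linear(3,4)[OF assms(1) u(1) norm_one] .
  have "(u - t * inverse u) = u * (1 - t * inverse (u\<^sup>2))" "u - inverse u = (u\<^sup>2 - 1) * inverse u"
    using u0 by (simp_all add: field_simps power2_eq_square)
  then have "(u - t * inverse u) / (u - inverse u) / pm1 t (u\<^sup>2) =
      u * (1 - t * inverse (u\<^sup>2)) / ((u\<^sup>2 - 1) * inverse u) / ((1 - t * u\<^sup>2) * (1 - t * inverse (u\<^sup>2)))"
    by (simp only: pm1_def)
  moreover have "u * P / (Q * inverse u) / (R * P) = u\<^sup>2 / Q / R" if "P \<noteq> 0" for P Q R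
    using u0 that by (simp add: divide_inverse power2_eq_square)
  ultimately have 3: "(u - t * inverse u) / (u - inverse u) / pm1 t (u\<^sup>2) = u\<^sup>2 / (u\<^sup>2 - 1) / (1 - t * u\<^sup>2)"
    using n by metis
  have "interaction t x ?Y u * ((u - t * inverse u) / (u - inverse u)) *
      (\<Prod>b\<in>?Y. (eig x b - t * inverse u) / (eig x b - inverse u)) =
      ((\<Prod>b\<in>?Y. pm1 (eig x b) u / pm1 (t * eig x b) u) *
      (\<Prod>b\<in>?Y. (1 - t * eig x b * inverse u) / (1 - eig x b * inverse u))) *
      ((u - t * inverse u) / (u - inverse u) / pm1 t (u\<^sup>2))"
    unfolding 1 interaction_def by (simp only: times_divide_eq_left times_divide_eq_right mult_ac)
  also have "\<dots> = u\<^sup>2 / (u\<^sup>2 - 1) * (\<Prod>b\<in>?Y. eig x b - u) / (\<Prod>b\<in>?Y. eig x b - t * u) / (1 - t * u\<^sup>2)"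
    unfolding 2 3 by (simp add: mult_ac)
  finally show ?thesis .
qed

text \<open>
  The terms of \<open>hl_sum\<close> that have the point \<open>q\<close> in the last slot, when the polynomial of that slot is 1.
\<close>

definition last_slot :: "complex \<Rightarrow> complex poly list \<Rightarrow> (nat \<Rightarrow> complex) \<Rightarrow> eigen set \<Rightarrow> eigen \<Rightarrow> complex" where
  "last_slot t ps x Z q =
     (\<Prod>b\<in>Z - {q}. (eig x b - t * eig x q) / (eig x b - eig x q)) * hl_sum t ps (eig x) (Z - {q})"

lemma hl_sum_one_Cons: "hl_sum t (1 # ps) (eig x) Z = (\<Sum>q\<in>Z. last_slot t ps x Z q)"
  by (simp add: last_slot_def)

text \<open>
  Both signs are covered: the last slot holds the inverse of \<open>eig x q'\<close>.
\<close>

lemma last_slot_variable: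
  assumes "norm t < 1" "finite J" "i \<notin> J" "F \<subseteq> signs" "generic (insert i J) x"
    and len: "Suc (card (spectrum F J)) = length ps"
    and q: "(q, q') = (Inv i, Var i) \<or> (q, q') = (Var i, Inv i)"
  shows "eig_density t F (insert i J) x * last_slot t ps x (spectrum F (insert i J)) q =
    eig_density t F J x / (2 * of_nat (Suc (card J))) * paired (residue_kernel t ps x (spectrum F J)) (eig x q')"
proof -
  let ?Y = "spectrum F J" let ?u = "eig x q'"
  have inj: "inj_on (eig x) (spectrum F (insert i J))" using generic_inj assms by blast
  have gen: "generic J x" using assms(5) by (rule generic_subset) auto
  note neq = generic_neq[OF assms(5), of i, simplified]
  have qs: "q \<notin> ?Y" "q' \<notin> ?Y" "q \<noteq> q'" "spectrum F (insert i J) = insert q (insert q' ?Y)"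
    "eig x q = inverse ?u"
    using q assms(3,4) by (auto simp: spectrum_def)
  have fin: "finite ?Y" using assms by simp
  have u: "norm ?u = 1" "?u \<noteq> 1" "?u \<noteq> -1"
    using q neq generic_norm(1)[OF assms(5,4), of q'] qs(4) by auto
  have notin: "?u \<notin> eig x ` ?Y" "inverse ?u \<notin> eig x ` ?Y"
    using inj qs by (auto simp: inj_on_insert)
  have cl: "cleared_sum t ps ?u (eig x) ?Y = (\<Prod>b\<in>?Y. eig x b - ?u) * hl_sum t ps (eig x) (insert q' ?Y)"
    using fin qs len notin by (intro cleared_sum_eq) auto
  have ia: "interaction t x ?Y (x i) = interaction t x ?Y ?u"
    using q by (auto simp: interaction_def pm1_inverse power_inverse)
  have "insert q (insert q' ?Y) - {q} = insert q' ?Y" using qs by auto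
  then have last: "last_slot t ps x (spectrum F (insert i J)) q =
      (?u - t * inverse ?u) / (?u - inverse ?u) *
      (\<Prod>b\<in>?Y. (eig x b - t * inverse ?u) / (eig x b - inverse ?u)) * hl_sum t ps (eig x) (insert q' ?Y)"
    using fin qs(2) by (simp only: last_slot_def qs(4,5)) simp
  have "eig_density t F (insert i J) x * last_slot t ps x (spectrum F (insert i J)) q =
      eig_density t F J x / (2 * of_nat (Suc (card J))) * hl_sum t ps (eig x) (insert q' ?Y) *
      (interaction t x ?Y ?u * ((?u - t * inverse ?u) / (?u - inverse ?u)) *
      (\<Prod>b\<in>?Y. (eig x b - t * inverse ?u) / (eig x b - inverse ?u)))"
    unfolding density_insert[OF assms(2-4)] last ia by (simp only: divide_inverse mult_ac)
  also have "\<dots> = eig_density t F J x / (2 * of_nat (Suc (card J))) * paired (residue_kernel t ps x ?Y) ?u"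
    unfolding interaction_times_last[OF assms(1) gen assms(2,4) u notin] paired_def residue_kernel_def cl
    by (simp only: divide_inverse mult_ac)
  finally show ?thesis .
qed

text \<open>
  The factor $(z-t\varepsilon)/(z-\varepsilon)$ at $z = -\varepsilon$, if both fixed eigenvalues are present.
\<close>

definition kappa :: "complex \<Rightarrow> eigen set \<Rightarrow> complex" where
  "kappa t F = (if F = {} then 1 else (1 + t) / 2)"

lemma kappa_nonzero: "norm t < 1 \<Longrightarrow> kappa t F \<noteq> 0"
proof -
  assume "norm t < 1"
  then have "t \<noteq> -1" by auto
  then have "t + 1 \<noteq> 0" by (simp add: add_eq_0_iff2)
  then have "1 + t \<noteq> 0" by (metis add.commute)
  then show ?thesis by (simp add: kappa_def)
qed

lemma prod_pm1_over_fixed: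
  assumes "generic J x" "j \<in> J" "e = 1 \<or> e = -1" "norm t < 1"
  shows "(x j - t * e) / (x j - e) * ((inverse (x j) - t * e) / (inverse (x j) - e)) =
    pm1 (t * e) (x j) / pm1 e (x j)"
proof -
  have x0: "x j \<noteq> 0" using generic_neq[OF assms(1,2)] by auto
  then have "x j * inverse (x j) = 1" by simp
  then have "(x j - c) * (inverse (x j) - c) = pm1 c (x j)" for c
    by (simp add: pm1_def algebra_simps)
  then show ?thesis by (simp only: times_divide_times_eq)
qed

text \<open>
  A fixed eigenvalue in the last slot changes the density back to the one without this eigenvalue.
\<close>

lemma density_insert_fixed:
  assumes "norm t < 1" "finite J" "insert q F \<subseteq> signs" "q \<notin> F" "generic J x"
  shows "eig_density t (insert q F) J x *
      (\<Prod>b\<in>spectrum F J. (eig x b - t * fixed q) / (eig x b - fixed q)) = kappa t F * eig_density t F J x"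
proof -
  have e: "fixed q = 1 \<or> fixed q = -1" "q \<in> signs" using assms by auto
  have F: "F = {} \<or> (\<exists>q'. F = {q'} \<and> q' \<in> signs \<and> fixed q' = - fixed q)"
    using assms(3,4) by auto
  have k: "(\<Prod>b\<in>F. (eig x b - t * fixed q) / (eig x b - fixed q)) = kappa t F"
    using F
  proof
    assume "\<exists>q'. F = {q'} \<and> q' \<in> signs \<and> fixed q' = - fixed q"
    then obtain q' where q': "F = {q'}" "q' \<in> signs" "fixed q' = - fixed q" by blast
    then have "eig x q' = - fixed q" using eig_fixed(1)[OF q'(2), of x] by (simp only:)
    then have "(\<Prod>b\<in>F. (eig x b - t * fixed q) / (eig x b - fixed q)) =
        (- fixed q - t * fixed q) / (- fixed q - fixed q)"
      by (simp add: q'(1))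
    also have "\<dots> = (1 + t) / 2" using e(1) by (auto simp: field_simps)
    finally show ?thesis using q' by (simp add: kappa_def)
  qed (simp add: kappa_def)
  have w: "weight t (insert q F) (x j) * (pm1 (t * fixed q) (x j) / pm1 (fixed q) (x j)) = weight t F (x j)"
    if j: "j \<in> J" for j
  proof -
    have n: "norm (x j) = 1" using assms(5) j by (auto simp: generic_def)
    have "norm (t * fixed q) < 1" using e assms(1) by (auto simp: norm_mult)
    then have "pm1 (t * fixed q) (x j) \<noteq> 0" using n by (intro pm1_nonzero)
    moreover have "1 - fixed q * u \<noteq> 0" if "u \<noteq> 1" "u \<noteq> -1" for u
    proof
      assume "1 - fixed q * u = 0"
      then have "fixed q * (fixed q * u) = fixed q" by simp
      then have "u = fixed q"
        using eig_fixed(2)[OF e(2)] by (simp only: mult.assoc[symmetric] mult_1_left)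
      then show False using e(1) that by simp
    qed
    then have "pm1 (fixed q) (x j) \<noteq> 0"
      using generic_neq[OF assms(5) j] by (simp only: pm1_def mult_eq_0_iff) blast
    ultimately show ?thesis
      using assms(3,4) finite_fixed[of F] by (simp add: weight_def)
  qed
  have W: "(\<Prod>j\<in>J. weight t (insert q F) (x j)) * (\<Prod>j\<in>J. pm1 (t * fixed q) (x j) / pm1 (fixed q) (x j)) =
      (\<Prod>j\<in>J. weight t F (x j))"
    unfolding prod.distrib[symmetric] by (intro prod.cong refl w)
  have P: "(\<Prod>j\<in>J. (eig x (Var j) - t * fixed q) / (eig x (Var j) - fixed q) *
      ((eig x (Inv j) - t * fixed q) / (eig x (Inv j) - fixed q))) =
      (\<Prod>j\<in>J. pm1 (t * fixed q) (x j) / pm1 (fixed q) (x j))"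
    unfolding eig.simps by (intro prod.cong refl prod_pm1_over_fixed[OF assms(5) _ e(1) assms(1)])
  have F2: "F \<subseteq> signs" using assms by auto
  have "eig_density t (insert q F) J x *
      (\<Prod>b\<in>spectrum F J. (eig x b - t * fixed q) / (eig x b - fixed q)) =
      eig_density t (insert q F) J x * (\<Prod>j\<in>J. pm1 (t * fixed q) (x j) / pm1 (fixed q) (x j)) * kappa t F"
    unfolding prod_spectrum[OF assms(2) F2] P k by (simp only: mult.assoc)
  also have "\<dots> = kappa t F * eig_density t F J x"
    unfolding eig_density_def W[symmetric] by (simp only: mult_ac)
  finally show ?thesis .
qed

lemma last_slot_fixed:
  assumes "norm t < 1" "finite J" "F \<subseteq> signs" "q \<in> F" "generic J x"
  shows "eig_density t F J x * last_slot t ps x (spectrum F J) q =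
    kappa t (F - {q}) * (eig_density t (F - {q}) J x * hl_sum t ps (eig x) (spectrum (F - {q}) J))"
proof -
  have *: "spectrum F J - {q} = spectrum (F - {q}) J" using assms by (auto simp: spectrum_def)
  have F: "insert q (F - {q}) = F" using assms by auto
  have "eig x q = fixed q" using assms(3,4) by auto
  then show ?thesis
    using density_insert_fixed[OF assms(1,2), of q "F - {q}" x] assms
    unfolding last_slot_def * F by (simp add: mult.assoc[symmetric])
qed

text \<open>
  The residues of the kernel at $\pm1$.  If the fixed eigenvalue is already present, the kernel vanishes by antisymmetry;
  otherwise the limit of a conjugate pair at this value creates a single new fixed eigenvalue.
\<close>

lemma residue_kernel_fixed:
  assumes "norm t < 1" "finite J" "F \<subseteq> signs" "q \<in> signs" "generic J x"
    and len: "Suc (card (spectrum F J)) = length ps"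
  shows "eig_density t F J x * residue_kernel t ps x (spectrum F J) (fixed q) =
    (if q \<in> F then 0 else
      eig_density t (insert q F) J x * hl_sum t ps (eig x) (spectrum (insert q F) J) / (kappa t F * (1 - t)))"
proof (cases "q \<in> F")
  case True
  have "cleared_sum t ps (eig x q) (eig x) (spectrum F J) = 0"
    using True assms generic_inj[OF assms(5,3)] finite_fixed[OF assms(3)]
    by (intro cleared_sum_vanishes) (auto simp: spectrum_def)
  moreover have "eig x q = fixed q" using assms(3,4) by auto
  ultimately show ?thesis using True by (simp add: residue_kernel_def)
next
  case False
  let ?Y = "spectrum F J"
  have eq: "eig x q = fixed q" using assms(3,4) by auto
  have inj: "inj_on (eig x) (spectrum (insert q F) J)"
    using assms by (intro generic_inj) auto
  have qY: "q \<notin> ?Y" using False assms by (auto simp: spectrum_def)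
  have notin: "fixed q \<notin> eig x ` ?Y"
    using inj qY eq by (auto simp: spectrum_insert inj_on_insert)
  have cl: "cleared_sum t ps (fixed q) (eig x) ?Y = (\<Prod>b\<in>?Y. eig x b - fixed q) * hl_sum t ps (eig x) (spectrum (insert q F) J)"
    using cleared_sum_eq[of ?Y q ps "eig x" t] assms qY notin len by (simp add: eq spectrum_insert)
  define A where "A = (\<Prod>b\<in>?Y. (eig x b - fixed q) / (eig x b - t * fixed q))"
  define B where "B = (\<Prod>b\<in>?Y. eig x b - t * fixed q)"
  define C where "C = (\<Prod>b\<in>?Y. (eig x b - t * fixed q) / (eig x b - fixed q))"
  have nz: "eig x b - t * fixed q \<noteq> 0" if "b \<in> ?Y" for b
    using generic_norm(1)[OF assms(5,3) that] nonzero_linear(1)[OF assms(1), of "fixed q" "eig x b"] assms(4) by auto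
  have nz': "eig x b - fixed q \<noteq> 0" if "b \<in> ?Y" for b
    using notin that by (metis eq_iff_diff_eq_0 image_eqI)
  have B: "B \<noteq> 0" unfolding B_def using nz assms by simp
  have AB: "(\<Prod>b\<in>?Y. eig x b - fixed q) = A * B"
    unfolding A_def B_def prod.distrib[symmetric] using nz by (intro prod.cong) auto
  have AC: "A * C = 1"
    unfolding A_def C_def prod.distrib[symmetric] using nz nz' by (intro prod.neutral) auto
  have sq: "(fixed q)\<^sup>2 = 1" using assms(4) by auto
  have kern: "residue_kernel t ps x ?Y (fixed q) = A * hl_sum t ps (eig x) (spectrum (insert q F) J) / (1 - t)"
    unfolding residue_kernel_def cl AB B_def[symmetric] sq using B by simp
  have "eig_density t (insert q F) J x * C = kappa t F * eig_density t F J x"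
    unfolding C_def using assms False by (intro density_insert_fixed) auto
  then have dens: "eig_density t F J x = eig_density t (insert q F) J x * C / kappa t F"
    using kappa_nonzero[OF assms(1), of F] by (simp add: field_simps)
  have "eig_density t F J x * residue_kernel t ps x ?Y (fixed q) =
      eig_density t (insert q F) J x * (A * C) * hl_sum t ps (eig x) (spectrum (insert q F) J) / (kappa t F * (1 - t))"
    unfolding kern dens by (simp add: mult_ac)
  then show ?thesis using False AC by simp
qed

section \<open>Measurability, generic points and bounds\<close>

abbreviation circles :: "nat set \<Rightarrow> (nat \<Rightarrow> complex) measure" where
  "circles J \<equiv> \<Pi>\<^sub>M i\<in>J. circle_measure"

lemma product_prob_space_circle_measure: "product_prob_space (\<lambda>_::nat. circle_measure)"
  by (simp add: product_prob_space_def product_prob_space_axioms_def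
      product_sigma_finite_circle_measure prob_space_circle_measure)

lemma prob_space_circles: "prob_space (circles J)"
  by (intro prob_space_PiM prob_space_circle_measure)

lemma measurable_component:
  "i \<in> J \<Longrightarrow> (\<lambda>x. x i) \<in> borel_measurable (circles J)"
  using measurable_component_singleton[of i J "\<lambda>_. circle_measure"]
  by (simp cong: measurable_cong_sets)

lemma measurable_eig:
  assumes "F \<subseteq> signs" "b \<in> spectrum F J"
  shows "(\<lambda>x. eig x b) \<in> borel_measurable (circles J)"
proof (cases b)
  case (Var i)
  then have "i \<in> J" using assms by (auto simp: spectrum_def)
  then show ?thesis using measurable_component Var by simp
next
  case (Inv i)
  then have "i \<in> J" using assms by (auto simp: spectrum_def)
  then show ?thesis using measurable_component Inv by simp
qed simp_all

lemma measurable_hl_sum: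
  assumes "\<And>i. i \<in> I \<Longrightarrow> (\<lambda>x. z x i) \<in> borel_measurable M"
  shows "(\<lambda>x. hl_sum t ps (z x) I) \<in> borel_measurable M"
  using assms
proof (induction ps arbitrary: I)
  case (Cons p ps)
  have p: "(\<lambda>x. poly p (z x i)) \<in> borel_measurable M" if "i \<in> I" for i
    using Cons.prems[OF that]
    by (rule measurable_compose) (intro borel_measurable_continuous_onI continuous_intros)
  show ?case
    unfolding hl_sum.simps
  proof (intro borel_measurable_sum borel_measurable_times borel_measurable_prod)
    fix i assume "i \<in> I"
    then show "(\<lambda>x. poly p (z x i)) \<in> borel_measurable M" by (rule p)
    show "(\<lambda>x. hl_sum t ps (z x) (I - {i})) \<in> borel_measurable M"
      using Cons.prems by (intro Cons.IH) auto
    fix j assume "j \<in> I - {i}"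
    then have [measurable]: "(\<lambda>x. z x i) \<in> borel_measurable M" "(\<lambda>x. z x j) \<in> borel_measurable M"
      using Cons.prems \<open>i \<in> I\<close> by auto
    show "(\<lambda>x. (z x j - t * z x i) / (z x j - z x i)) \<in> borel_measurable M" by measurable
  qed
qed simp

lemma measurable_eig_density:
  assumes "F \<subseteq> signs"
  shows "eig_density t F J \<in> borel_measurable (circles J)"
  unfolding eig_density_def[abs_def]
proof (intro borel_measurable_times borel_measurable_prod borel_measurable_const)
  fix i assume "i \<in> J"
  note [measurable] = measurable_component[OF this]
  show "(\<lambda>x. weight t F (x i)) \<in> borel_measurable (circles J)"
    unfolding weight_def pm1_def by measurable
next
  fix ij assume "ij \<in> {(i, j). i \<in> J \<and> j \<in> J \<and> i < j}"
  then obtain i j where [simp]: "ij = (i, j)" and ij: "i \<in> J" "j \<in> J" by auto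
  note [measurable] = ij[THEN measurable_component]
  show "(\<lambda>x. case ij of (i, j) \<Rightarrow> pm2 1 (x i) (x j) / pm2 t (x i) (x j)) \<in> borel_measurable (circles J)"
    unfolding pm2_def by simp measurable
qed

lemma measurable_hl_sum_eig:
  assumes "F \<subseteq> signs" "Z \<subseteq> spectrum F J"
  shows "(\<lambda>x. hl_sum t ps (eig x) Z) \<in> borel_measurable (circles J)"
  using assms measurable_eig by (intro measurable_hl_sum) auto

lemma measurable_last_slot:
  assumes "F \<subseteq> signs" "q \<in> spectrum F J"
  shows "(\<lambda>x. last_slot t ps x (spectrum F J) q) \<in> borel_measurable (circles J)"
  unfolding last_slot_def
proof (intro borel_measurable_times borel_measurable_prod)
  show "(\<lambda>x. hl_sum t ps (eig x) (spectrum F J - {q})) \<in> borel_measurable (circles J)"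
    using assms by (intro measurable_hl_sum_eig[of F]) auto
  fix b assume "b \<in> spectrum F J - {q}"
  then have [measurable]: "(\<lambda>x. eig x b) \<in> borel_measurable (circles J)"
      "(\<lambda>x. eig x q) \<in> borel_measurable (circles J)"
    using assms measurable_eig by auto
  show "(\<lambda>x. (eig x b - t * eig x q) / (eig x b - eig x q)) \<in> borel_measurable (circles J)"
    by measurable
qed

lemma eig_cong:
  assumes "\<And>j. j \<in> J \<Longrightarrow> x j = y j" "F \<subseteq> signs" "b \<in> spectrum F J"
  shows "eig x b = eig y b"
  using assms by (auto simp: spectrum_def)

lemma generic_cong:
  assumes "\<And>j. j \<in> J \<Longrightarrow> x j = y j"
  shows "generic J x \<longleftrightarrow> generic J y"
proof -
  have "inj_on (eig x) (spectrum signs J) \<longleftrightarrow> inj_on (eig y) (spectrum {Plus, Minus} J)"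
    using eig_cong[where J = J and x = x and y = y and F = "{Plus, Minus}"] assms
    by (intro inj_on_cong) auto
  then show ?thesis using assms by (simp add: generic_def)
qed

definition eigen_list :: "nat \<Rightarrow> eigen list" where
  "eigen_list k = concat (map (\<lambda>i. [Var i, Inv i]) [0..<k])"

lemma set_eigen_list: "set (eigen_list k) = spectrum {} {..<k}"
  by (auto simp: eigen_list_def spectrum_def)

lemma map_eig_eigen_list: "map (eig x) (eigen_list k) = pm_args x k"
  by (simp add: eigen_list_def pm_args_def map_concat o_def)

lemma AE_generic_torus: "AE x in torus k. generic {..<k} x"
proof -
  have "AE x in torus k. \<forall>j\<in>{..<k}. norm (x j) = 1"
    using AE_circle_measure_norm by (intro AE_finite_allI AE_torus_component) auto
  then show ?thesis
    using AE_torus_distinct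
  proof eventually_elim
    case (elim x)
    have "pm_args x k @ [1, -1] = map (eig x) (eigen_list k @ [Plus, Minus])"
      by (simp add: map_eig_eigen_list)
    then have "inj_on (eig x) (set (eigen_list k @ [Plus, Minus]))"
      using elim(2) by (metis distinct_map)
    moreover have eq: "set (eigen_list k @ [Plus, Minus]) = spectrum {Plus, Minus} {..<k}"
      by (auto simp: set_eigen_list) (auto simp: spectrum_def)
    ultimately show ?case using elim(1) unfolding generic_def eq by simp
  qed
qed

text \<open>
  Needed for the passage from the full torus to subsets of its coordinates.
\<close>

lemma measurable_generic:
  assumes "finite J"
  shows "{x \<in> space (circles J). generic J x} \<in> sets (circles J)"
proof -
  let ?S = "spectrum {Plus, Minus} J"
  have fin: "finite ?S" using assms by simp
  have "Measurable.pred (circles J) (\<lambda>x. \<forall>j\<in>J. norm (x j) = 1)"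
  proof (rule pred_intros_finite(3)[OF assms])
    fix j assume "j \<in> J"
    note [measurable] = measurable_component[OF this]
    show "Measurable.pred (circles J) (\<lambda>x. norm (x j) = 1)" by measurable
  qed
  moreover have "Measurable.pred (circles J) (\<lambda>x. \<forall>a\<in>?S. \<forall>b\<in>?S. eig x a = eig x b \<longrightarrow> a = b)"
  proof (intro pred_intros_finite(3)[OF fin])
    fix a b assume "a \<in> ?S" "b \<in> ?S"
    then have "{x \<in> space (circles J). eig x a = eig x b} \<in> sets (circles J)"
      by (intro measurable_equality_set measurable_eig[OF order.refl])
    then have "Measurable.pred (circles J) (\<lambda>x. eig x a = eig x b)" by (simp only: pred_def)
    then show "Measurable.pred (circles J) (\<lambda>x. eig x a = eig x b \<longrightarrow> a = b)"
      by (intro pred_intros_logic) simp_all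
  qed
  ultimately have "Measurable.pred (circles J) (generic J)"
    unfolding generic_def[abs_def] inj_on_def by (rule pred_intros_logic)
  then show ?thesis by (simp add: pred_def)
qed

text \<open>
  Reduction to the torus: the product over \<open>J\<close> is the image of a larger torus under restriction.
\<close>

lemma AE_generic:
  assumes "finite J"
  shows "AE x in circles J. generic J x"
proof -
  interpret product_prob_space "\<lambda>_::nat. circle_measure" by (rule product_prob_space_circle_measure)
  obtain k where k: "J \<subseteq> {..<k}" using finite_nat_iff_bounded assms by blast
  have eq: "circles J = distr (torus k) (circles J) (\<lambda>x. restrict x J)"
    unfolding torus_def using k by (intro distr_restrict) auto
  have m: "(\<lambda>x. restrict x J) \<in> measurable (torus k) (circles J)"
    unfolding torus_def using k by (rule measurable_restrict_subset)
  have "AE x in torus k. generic J (restrict x J)"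
    using AE_generic_torus
  proof eventually_elim
    case (elim x)
    then have "generic J x" using k by (rule generic_subset)
    then show ?case using generic_cong[of J x "restrict x J"] by simp
  qed
  then show ?thesis
    by (subst eq) (simp add: AE_distr_iff[OF m measurable_generic[OF assms]])
qed

lemma pm1_bounds:
  assumes "norm u = 1"
  shows "norm (pm1 c u) \<le> (1 + norm c)\<^sup>2" "norm c \<le> 1 \<Longrightarrow> (1 - norm c)\<^sup>2 \<le> norm (pm1 c u)"
proof -
  have up: "norm (1 - c * u) \<le> 1 + norm c" "norm (1 - c * inverse u) \<le> 1 + norm c"
    using norm_triangle_ineq4[of 1 "c * u"] norm_triangle_ineq4[of 1 "c * inverse u"] assms
    by (simp_all add: norm_mult norm_inverse)
  have lo: "1 - norm c \<le> norm (1 - c * u)" "1 - norm c \<le> norm (1 - c * inverse u)"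
    using norm_triangle_ineq2[of 1 "c * u"] norm_triangle_ineq2[of 1 "c * inverse u"] assms
    by (simp_all add: norm_mult norm_inverse)
  show "norm (pm1 c u) \<le> (1 + norm c)\<^sup>2"
    unfolding pm1_def norm_mult power2_eq_square using up by (intro mult_mono) auto
  show "(1 - norm c)\<^sup>2 \<le> norm (pm1 c u)" if "norm c \<le> 1"
    unfolding pm1_def norm_mult power2_eq_square using lo that by (intro mult_mono) auto
qed

lemma pm1_quotient_bound:
  assumes "norm u = 1" "norm c = 1" "norm t < 1"
  shows "norm (pm1 c u / pm1 (t * c) u) \<le> 4 / (1 - norm t)\<^sup>2"
proof -
  have "norm (pm1 c u) \<le> 4" using pm1_bounds(1)[OF assms(1), of c] assms(2) by simp
  moreover have "(1 - norm t)\<^sup>2 \<le> norm (pm1 (t * c) u)"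
    using pm1_bounds(2)[OF assms(1), of "t * c"] assms by (simp add: norm_mult)
  moreover have "0 < (1 - norm t)\<^sup>2" using assms by simp
  ultimately show ?thesis unfolding norm_divide by (intro frac_le) auto
qed

lemma weight_bound:
  assumes "norm u = 1" "F \<subseteq> signs" "norm t < 1"
  shows "norm (weight t F u) \<le> (4 / (1 - norm t)\<^sup>2) ^ card F / (1 - norm t)\<^sup>2"
proof -
  have "norm (\<Prod>q\<in>F. pm1 (fixed q) u / pm1 (t * fixed q) u) \<le> (\<Prod>q\<in>F. 4 / (1 - norm t)\<^sup>2)"
    unfolding prod_norm[symmetric]
  proof (intro prod_mono conjI norm_ge_zero)
    fix q assume "q \<in> F"
    then have "norm (fixed q) = 1" using assms(2) by auto
    then show "norm (pm1 (fixed q) u / pm1 (t * fixed q) u) \<le> 4 / (1 - norm t)\<^sup>2"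
      using assms by (intro pm1_quotient_bound) auto
  qed
  moreover have "(1 - norm t)\<^sup>2 \<le> norm (pm1 t (u\<^sup>2))"
    using assms by (intro pm1_bounds(2)) (auto simp: norm_power)
  moreover have "0 < (1 - norm t)\<^sup>2" using assms by simp
  ultimately show ?thesis unfolding weight_def norm_divide by (intro frac_le) (auto simp: prod_nonneg)
qed

lemma eig_density_bounded:
  assumes "finite J" "F \<subseteq> signs" "norm t < 1"
  shows "\<exists>C. \<forall>x. generic J x \<longrightarrow> norm (eig_density t F J x) \<le> C"
proof (intro exI allI impI)
  fix x assume gen: "generic J x"
  let ?P = "{(i, j). i \<in> J \<and> j \<in> J \<and> i < j}"
  let ?w = "(4 / (1 - norm t)\<^sup>2) ^ card F / (1 - norm t)\<^sup>2" and ?m = "4 / (1 - norm t)\<^sup>2"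
  have n: "norm (x j) = 1" if "j \<in> J" for j using gen that by (simp add: generic_def)
  have 1: "norm (\<Prod>i\<in>J. weight t F (x i)) \<le> (\<Prod>i\<in>J. ?w)"
    unfolding prod_norm[symmetric] using assms n by (intro prod_mono conjI norm_ge_zero weight_bound) auto
  have 2: "norm (\<Prod>(i, j)\<in>?P. pm2 1 (x i) (x j) / pm2 t (x i) (x j)) \<le> (\<Prod>(i, j)\<in>?P. ?m * ?m)"
    unfolding prod_norm[symmetric]
  proof (intro prod_mono conjI norm_ge_zero)
    fix p assume "p \<in> ?P"
    then obtain i j where p: "p = (i, j)" "i \<in> J" "j \<in> J" by auto
    have "pm2 1 (x i) (x j) / pm2 t (x i) (x j) =
        (pm1 (x j) (x i) / pm1 (t * x j) (x i)) *
        (pm1 (inverse (x j)) (x i) / pm1 (t * inverse (x j)) (x i))"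
      by (simp add: pm2_eq_pm1)
    also have "norm \<dots> \<le> ?m * ?m"
      unfolding norm_mult using n p assms
      by (intro mult_mono pm1_quotient_bound) (auto simp: norm_inverse)
    finally show "norm (case p of (i, j) \<Rightarrow> pm2 1 (x i) (x j) / pm2 t (x i) (x j)) \<le>
        (case p of (i, j) \<Rightarrow> ?m * ?m)" using p by simp
  qed
  show "norm (eig_density t F J x) \<le>
      norm (1 / (2 ^ card J * fact (card J)) :: complex) * (\<Prod>i\<in>J. ?w) * (\<Prod>(i, j)\<in>?P. ?m * ?m)"
    unfolding eig_density_def norm_mult using 1 2 assms by (intro mult_mono) (auto simp: prod_nonneg)
qed

lemma hl_sum_eig_bounded:
  assumes "finite J" "F \<subseteq> signs" "norm t < 1" "length ps = card (spectrum F J)"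
  shows "\<exists>C. \<forall>x. generic J x \<longrightarrow> norm (hl_sum t ps (eig x) (spectrum F J)) \<le> C"
proof -
  obtain B where B: "\<And>(z :: eigen \<Rightarrow> complex) I. finite I \<Longrightarrow> card I = length ps \<Longrightarrow> inj_on z I \<Longrightarrow>
      (\<And>i. i \<in> I \<Longrightarrow> norm (z i) \<le> 1) \<Longrightarrow> norm (hl_sum t ps z I) \<le> B"
    using hl_sum_bounded[of t ps 1, where 'a = eigen] assms(3) by (metis less_imp_le)
  have "norm (hl_sum t ps (eig x) (spectrum F J)) \<le> B" if "generic J x" for x
    using assms generic_inj[OF that] generic_norm[OF that] by (intro B) auto
  then show ?thesis by blast
qed

lemma integrable_circles_bounded:
  fixes f :: "(nat \<Rightarrow> complex) \<Rightarrow> complex"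
  assumes "finite J" "f \<in> borel_measurable (circles J)" "\<And>x. generic J x \<Longrightarrow> norm (f x) \<le> C"
  shows "integrable (circles J) f"
proof -
  interpret prob_space "circles J" by (rule prob_space_circles)
  have "AE x in circles J. norm (f x) \<le> C"
    using AE_generic[OF assms(1)] by eventually_elim (rule assms(3))
  then show ?thesis using assms(2) by (rule integrable_const_bound)
qed

definition hl_int :: "complex \<Rightarrow> eigen set \<Rightarrow> nat set \<Rightarrow> complex poly list \<Rightarrow> complex" where
  "hl_int t F J ps = (\<integral>x. eig_density t F J x * hl_sum t ps (eig x) (spectrum F J) \<partial>circles J)"

lemma integrable_density_hl_sum:
  assumes "finite J" "F \<subseteq> signs" "norm t < 1" "length ps = card (spectrum F J)"
  shows "integrable (circles J) (\<lambda>x. eig_density t F J x * hl_sum t ps (eig x) (spectrum F J))"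
proof -
  obtain C D where C: "\<And>x. generic J x \<Longrightarrow> norm (eig_density t F J x) \<le> C"
    and D: "\<And>x. generic J x \<Longrightarrow> norm (hl_sum t ps (eig x) (spectrum F J)) \<le> D"
    using eig_density_bounded[OF assms(1-3)] hl_sum_eig_bounded[OF assms] by metis
  show ?thesis
  proof (rule integrable_circles_bounded)
    show "norm (eig_density t F J x * hl_sum t ps (eig x) (spectrum F J)) \<le> C * D" if "generic J x" for x
    proof -
      have "0 \<le> C" using C[OF that] norm_ge_zero order_trans by blast
      then show ?thesis unfolding norm_mult using C[OF that] D[OF that] by (intro mult_mono) auto
    qed
  qed (use assms measurable_eig_density measurable_hl_sum_eig in \<open>auto intro!: borel_measurable_times\<close>)
qed

section \<open>Integrating out one conjugate pair\<close>

text \<open>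
  Within radius \<open>r\<close> the kernel is holomorphic; the circle of radius \<open>\<rho>\<close> lies
  inside this disc and outside the circle of integration.
\<close>

lemma annulus_radii:
  assumes "norm (t::complex) < 1"
  obtains \<rho> r :: real where "1 < \<rho>" "\<rho> < r" "norm t * r\<^sup>2 < 1"
proof -
  \<comment> \<open>chosen so that $|t| r^2 = 2|t|/(1+|t|) < 1 < r$\<close>
  define r where "r = sqrt (2 / (1 + norm t))"
  have pos: "0 < 1 + norm t" by (simp add: add_pos_nonneg)
  have r2: "r\<^sup>2 = 2 / (1 + norm t)" using pos by (simp add: r_def)
  have "1 < 2 / (1 + norm t)" using assms pos by (simp add: less_divide_eq)
  then have "1 < r" by (simp add: r_def)
  moreover have "norm t * r\<^sup>2 < 1" unfolding r2 using assms pos by (simp add: divide_less_eq)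
  ultimately show ?thesis using that[of "(1 + r) / 2" r] by simp
qed

lemma kernel_denominators:
  assumes "norm (t::complex) * r\<^sup>2 < 1" "1 < r" "norm u \<le> r" "norm b = 1"
  shows "1 - norm t * r \<le> norm (b - t * u)" "1 - norm t * r\<^sup>2 \<le> norm (1 - t * u\<^sup>2)"
    "0 < 1 - norm t * r" "0 < 1 - norm t * r\<^sup>2"
proof -
  have "norm t * r \<le> norm t * r\<^sup>2"
    using assms(2) by (intro mult_left_mono self_le_power) auto
  then show "0 < 1 - norm t * r" "0 < 1 - norm t * r\<^sup>2" using assms(1) by simp_all
  have "norm t * norm u \<le> norm t * r" using assms(3) by (intro mult_left_mono) auto
  then show "1 - norm t * r \<le> norm (b - t * u)"
    using norm_triangle_ineq2[of b "t * u"] assms(4) by (simp add: norm_mult)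
  have "norm t * (norm u)\<^sup>2 \<le> norm t * r\<^sup>2" using assms(3) by (intro mult_left_mono power_mono) auto
  then show "1 - norm t * r\<^sup>2 \<le> norm (1 - t * u\<^sup>2)"
    using norm_triangle_ineq2[of 1 "t * u\<^sup>2"] by (simp add: norm_mult norm_power)
qed

lemma holomorphic_residue_kernel:
  assumes "generic J x" "finite J" "F \<subseteq> signs" "norm t * r\<^sup>2 < 1" "1 < r"
  shows "residue_kernel t ps x (spectrum F J) holomorphic_on ball 0 r"
proof -
  have nz: "eig x b - t * u \<noteq> 0" "1 - t * u\<^sup>2 \<noteq> 0" if "b \<in> spectrum F J" "u \<in> ball 0 r" for b u
    using kernel_denominators[OF assms(4,5), of u "eig x b"] generic_norm(1)[OF assms(1,3) that(1)] that by auto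
  have nz': "1 - t * u\<^sup>2 \<noteq> 0" if "u \<in> ball 0 r" for u
    using kernel_denominators(2,4)[OF assms(4,5), of u 1] that by auto
  have "(\<Prod>b\<in>spectrum F J. eig x b - t * u) \<noteq> 0" if "u \<in> ball 0 r" for u
    using nz(1) that assms by simp
  then show ?thesis
    unfolding residue_kernel_def[abs_def] using nz'
    by (intro holomorphic_intros) auto
qed

text \<open>
  For $|u| > 1$ the value \<open>u\<close> does not meet the spectrum, so the kernel is a quotient of a
  bounded symmetrisation and factors bounded away from zero.
\<close>

lemma residue_kernel_bounded:
  assumes "finite J" "i \<notin> J" "F \<subseteq> signs" "norm t < 1" "norm t * \<rho>\<^sup>2 < 1" "1 < \<rho>"
    and len: "Suc (card (spectrum F J)) = length ps"
  shows "\<exists>M. \<forall>x u. generic J x \<and> norm u = \<rho> \<longrightarrow> norm (residue_kernel t ps x (spectrum F J) u) \<le> M"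
proof -
  let ?Y = "spectrum F J" let ?N = "card ?Y"
  obtain B where B: "\<And>(z :: eigen \<Rightarrow> complex) I. finite I \<Longrightarrow> card I = length ps \<Longrightarrow> inj_on z I \<Longrightarrow>
      (\<And>i. i \<in> I \<Longrightarrow> norm (z i) \<le> \<rho>) \<Longrightarrow> norm (hl_sum t ps z I) \<le> B"
    using hl_sum_bounded[of t ps \<rho>, where 'a = eigen] assms(4) by (metis less_imp_le)
  have iY: "Var i \<notin> ?Y" using assms by (auto simp: spectrum_def)
  have fin: "finite ?Y" using assms by simp
  have "norm (residue_kernel t ps x ?Y u) \<le>
      (1 + \<rho>) ^ ?N * B / (1 - norm t * \<rho>) ^ ?N / (1 - norm t * \<rho>\<^sup>2)"
    if gen: "generic J x" and u: "norm u = \<rho>" for x u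
  proof -
    have n: "norm (eig x b) = 1" if "b \<in> ?Y" for b using generic_norm(1)[OF gen assms(3) that] .
    have notin: "u \<notin> eig x ` ?Y" using n u assms(6) by fastforce
    have "norm (hl_sum t ps ((eig x)(Var i := u)) (insert (Var i) ?Y)) \<le> B"
    proof (rule B)
      show "inj_on ((eig x)(Var i := u)) (insert (Var i) ?Y)"
        using generic_inj[OF gen assms(3)] notin iY by (auto simp: inj_on_def)
      show "norm (((eig x)(Var i := u)) b) \<le> \<rho>" if "b \<in> insert (Var i) ?Y" for b
        using that n u assms(6) by auto
    qed (use fin iY len in auto)
    moreover have "norm (\<Prod>b\<in>?Y. eig x b - u) \<le> (\<Prod>b\<in>?Y. 1 + \<rho>)"
      unfolding prod_norm[symmetric]
    proof (intro prod_mono conjI norm_ge_zero)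
      fix b assume "b \<in> ?Y"
      then show "norm (eig x b - u) \<le> 1 + \<rho>"
        using norm_triangle_ineq4[of "eig x b" u] n u by simp
    qed
    ultimately have "norm ((\<Prod>b\<in>?Y. eig x b - u) * hl_sum t ps ((eig x)(Var i := u)) (insert (Var i) ?Y)) \<le> (1 + \<rho>) ^ ?N * B"
      unfolding norm_mult using assms(6) by (intro mult_mono) auto
    then have 1: "norm (cleared_sum t ps u (eig x) ?Y) \<le> (1 + \<rho>) ^ ?N * B"
      using cleared_sum_eq_upd[OF fin iY len notin] by simp
    then have 0: "0 \<le> (1 + \<rho>) ^ ?N * B" using norm_ge_zero order_trans by blast
    have pos: "0 \<le> 1 - norm t * \<rho>"
      using kernel_denominators(3)[OF assms(5,6), of u 1] u by simp
    have "(\<Prod>b\<in>?Y. 1 - norm t * \<rho>) \<le> norm (\<Prod>b\<in>?Y. eig x b - t * u)"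
      unfolding prod_norm[symmetric]
    proof (intro prod_mono conjI pos)
      fix b assume "b \<in> ?Y"
      then show "1 - norm t * \<rho> \<le> norm (eig x b - t * u)"
        using kernel_denominators(1)[OF assms(5,6), of u "eig x b"] n u by simp
    qed
    then have 2: "(1 - norm t * \<rho>) ^ ?N \<le> norm (\<Prod>b\<in>?Y. eig x b - t * u)" by simp
    have 3: "1 - norm t * \<rho>\<^sup>2 \<le> norm (1 - t * u\<^sup>2)" "0 < 1 - norm t * \<rho>\<^sup>2" "0 < 1 - norm t * \<rho>"
      using kernel_denominators[OF assms(5,6), of u 1] u by auto
    show ?thesis
      unfolding residue_kernel_def norm_divide using 0 1 2 3
      by (intro frac_le divide_nonneg_pos) auto
  qed
  then show ?thesis by blast
qed

text \<open>
  The terms with the variable \<open>i\<close> or its inverse in the last slot.  Each of the two has a pole at $\pm1$; their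
  sum is bounded.
\<close>

definition variable_part ::
  "complex \<Rightarrow> eigen set \<Rightarrow> nat set \<Rightarrow> nat \<Rightarrow> complex poly list \<Rightarrow> (nat \<Rightarrow> complex) \<Rightarrow> complex" where
  "variable_part t F J i ps x =
     eig_density t F J x * (last_slot t ps x (spectrum F J) (Inv i) + last_slot t ps x (spectrum F J) (Var i))"

lemma variable_part_eq:
  assumes "norm t < 1" "finite J" "i \<notin> J" "F \<subseteq> signs" "generic (insert i J) x"
    and len: "Suc (card (spectrum F J)) = length ps"
  shows "variable_part t F (insert i J) i ps x =
    eig_density t F J x / (2 * of_nat (Suc (card J))) *
      (paired (residue_kernel t ps x (spectrum F J)) (x i) +
       paired (residue_kernel t ps x (spectrum F J)) (inverse (x i)))"
  using last_slot_variable[OF assms, of "Inv i" "Var i"] last_slot_variable[OF assms, of "Var i" "Inv i"]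
  unfolding variable_part_def by (simp only: distrib_left eig.simps) simp

lemma measurable_variable_part:
  assumes "F \<subseteq> signs" "i \<in> J"
  shows "variable_part t F J i ps \<in> borel_measurable (circles J)"
proof -
  have "Var i \<in> spectrum F J" "Inv i \<in> spectrum F J" using assms by (auto simp: spectrum_def)
  then show ?thesis
    unfolding variable_part_def[abs_def] using assms
    by (intro borel_measurable_times borel_measurable_add measurable_eig_density measurable_last_slot)
qed

lemma integrable_variable_part:
  assumes "norm t < 1" "finite J" "i \<notin> J" "F \<subseteq> signs" and len: "Suc (card (spectrum F J)) = length ps"
  shows "integrable (circles (insert i J)) (variable_part t F (insert i J) i ps)"
proof -
  obtain \<rho> r where r: "1 < \<rho>" "\<rho> < r" "norm t * r\<^sup>2 < 1" using annulus_radii[OF assms(1)] .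
  have "norm t * \<rho>\<^sup>2 \<le> norm t * r\<^sup>2" using r by (intro mult_left_mono power_mono) auto
  then have rho: "norm t * \<rho>\<^sup>2 < 1" using r by simp
  obtain M where M: "\<And>x u. generic J x \<Longrightarrow> norm u = \<rho> \<Longrightarrow> norm (residue_kernel t ps x (spectrum F J) u) \<le> M"
    using residue_kernel_bounded[OF assms(2-4,1) rho r(1) len] by metis
  obtain C where C: "\<And>x. generic J x \<Longrightarrow> norm (eig_density t F J x) \<le> C"
    using eig_density_bounded[OF assms(2,4,1)] by metis
  define D where "D = (2 * (\<rho>\<^sup>2 / (\<rho>\<^sup>2 - 1) + \<rho> / (\<rho> - 1)) + 1) * M"
  show ?thesis
  proof (rule integrable_circles_bounded)
    fix x assume gen: "generic (insert i J) x"
    then have genJ: "generic J x" by (rule generic_subset) auto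
    note neq = generic_neq[OF gen, of i, simplified]
    have "norm (x i) = 1" using gen by (simp add: generic_def)
    then have "norm (paired (residue_kernel t ps x (spectrum F J)) (x i) +
       paired (residue_kernel t ps x (spectrum F J)) (inverse (x i))) \<le> D"
      unfolding D_def using neq r M[OF genJ] holomorphic_residue_kernel[OF genJ assms(2,4) r(3)]
      by (intro paired_bound[where r = r]) auto
    moreover have "norm (eig_density t F J x / (2 * of_nat (Suc (card J)))) \<le> C / norm (2 * of_nat (Suc (card J)) :: complex)"
      unfolding norm_divide using C[OF genJ] by (intro divide_right_mono) auto
    moreover have "0 \<le> C" using C[OF genJ] norm_ge_zero order_trans by blast
    ultimately show "norm (variable_part t F (insert i J) i ps x) \<le> C / norm (2 * of_nat (Suc (card J)) :: complex) * D"
      unfolding variable_part_eq[OF assms(1-4) gen len] norm_mult by (intro mult_mono) auto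
  qed (use assms measurable_variable_part in auto)
qed

lemma generic_insert:
  assumes "generic J x" "i \<notin> J" "norm y = 1"
    and "\<And>b. b \<in> spectrum {Plus, Minus} J \<Longrightarrow> y \<noteq> eig x b \<and> inverse y \<noteq> eig x b"
  shows "generic (insert i J) (x(i := y))"
proof -
  let ?S = "spectrum {Plus, Minus} J" and ?x = "x(i := y)"
  have eq: "eig ?x b = eig x b" if "b \<in> ?S" for b
    using assms(2) that by (intro eig_cong[where J = J and F = "{Plus, Minus}"]) auto
  have "y \<noteq> 1" "y \<noteq> -1"
    using assms(4)[of Plus] assms(4)[of Minus] by (auto simp: spectrum_def)
  then have "y\<^sup>2 \<noteq> 1" by (simp add: power2_eq_1_iff)
  moreover have "y \<noteq> 0" using assms(3) by auto
  ultimately have ne: "y \<noteq> inverse y" by (auto simp: power2_eq_square field_simps)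
  have "inj_on (eig ?x) ?S"
    using assms(1) eq by (subst inj_on_cong[of _ _ "eig x"]) (auto simp: generic_def)
  moreover have "eig ?x ` ?S = eig x ` ?S" using eq by (intro image_cong) auto
  ultimately have "inj_on (eig ?x) (insert (Var i) (insert (Inv i) ?S))"
  proof -
    assume 1: "inj_on (eig ?x) ?S" and 2: "eig ?x ` ?S = eig x ` ?S"
    have y: "y \<notin> eig x ` ?S" "inverse y \<notin> eig x ` ?S" using assms(4) by auto
    have "eig ?x ` (insert (Inv i) ?S - {Var i}) \<subseteq> insert (inverse y) (eig x ` ?S)"
      using eq by auto
    then have a: "eig ?x (Var i) \<notin> eig ?x ` (insert (Inv i) ?S - {Var i})" using y ne by auto
    have "eig ?x ` (?S - {Inv i}) \<subseteq> eig x ` ?S" using eq by auto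
    then have b: "eig ?x (Inv i) \<notin> eig ?x ` (?S - {Inv i})" using y by auto
    show ?thesis using 1 a b by (simp only: inj_on_insert simp_thms)
  qed
  then have "inj_on (eig ?x) (spectrum {Plus, Minus} (insert i J))"
    by (simp only: spectrum_insert(1))
  then show ?thesis using assms(1,3) by (auto simp: generic_def)
qed

lemma AE_generic_insert:
  assumes "finite J" "generic J x" "i \<notin> J"
  shows "AE y in circle_measure. generic (insert i J) (x(i := y))"
proof -
  have "AE y in circle_measure. \<forall>b\<in>spectrum {Plus, Minus} J. y \<noteq> eig x b \<and> inverse y \<noteq> eig x b"
  proof (rule AE_finite_allI)
    fix b
    have "AE y in circle_measure. y \<noteq> eig x b \<and> y \<noteq> inverse (eig x b)"
      by (intro AE_conjI AE_circle_measure_neq)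
    then show "AE y in circle_measure. y \<noteq> eig x b \<and> inverse y \<noteq> eig x b"
      by eventually_elim (metis inverse_inverse_eq)
  qed (use assms in simp)
  then show ?thesis using AE_circle_measure_norm
    by eventually_elim (use assms in \<open>auto intro!: generic_insert\<close>)
qed

lemma residue_kernel_cong:
  assumes "\<And>b. b \<in> Y \<Longrightarrow> eig x b = eig y b"
  shows "residue_kernel t ps x Y = residue_kernel t ps y Y"
proof -
  have "cleared_sum t ps u (eig x) Y = cleared_sum t ps u (eig y) Y" for u
    using assms by (rule cleared_sum_cong)
  moreover have "(\<Prod>b\<in>Y. eig x b - t * u) = (\<Prod>b\<in>Y. eig y b - t * u)" for u
    using assms by (intro prod.cong) auto
  ultimately show ?thesis by (simp add: residue_kernel_def[abs_def])
qed

lemma eig_density_cong: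
  assumes "\<And>j. j \<in> J \<Longrightarrow> x j = y j"
  shows "eig_density t F J x = eig_density t F J y"
proof -
  have "(\<Prod>i\<in>J. weight t F (x i)) = (\<Prod>i\<in>J. weight t F (y i))"
    using assms by (intro prod.cong) auto
  moreover have "(\<Prod>(i, j)\<in>{(i, j). i \<in> J \<and> j \<in> J \<and> i < j}. pm2 1 (x i) (x j) / pm2 t (x i) (x j)) =
      (\<Prod>(i, j)\<in>{(i, j). i \<in> J \<and> j \<in> J \<and> i < j}. pm2 1 (y i) (y j) / pm2 t (y i) (y j))"
    using assms by (intro prod.cong) auto
  ultimately show ?thesis by (simp only: eig_density_def)
qed

lemma inner_integral_variable_part:
  assumes "norm t < 1" "finite J" "i \<notin> J" "F \<subseteq> signs" and len: "Suc (card (spectrum F J)) = length ps"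
    and gen: "generic J x" and sp: "x \<in> space (circles J)"
  shows "(\<integral>y. variable_part t F (insert i J) i ps (x(i := y)) \<partial>circle_measure) =
    (\<Sum>q\<in>signs - F. eig_density t (insert q F) J x * hl_sum t ps (eig x) (spectrum (insert q F) J)) /
      (4 * of_nat (Suc (card J)) * (1 - t) * kappa t F)"
proof -
  obtain \<rho> r where r: "1 < \<rho>" "\<rho> < r" "norm t * r\<^sup>2 < 1" using annulus_radii[OF assms(1)] .
  define c where "c = eig_density t F J x / (2 * of_nat (Suc (card J)))"
  define K where "K u = c * residue_kernel t ps x (spectrum F J) u" for u
  have "K holomorphic_on ball 0 r"
    unfolding K_def[abs_def] using holomorphic_residue_kernel[OF gen assms(2,4) r(3)] r
    by (intro holomorphic_intros) auto
  moreover have "(\<lambda>y. variable_part t F (insert i J) i ps (x(i := y))) \<in> borel_measurable borel"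
  proof -
    have "(\<lambda>y. (x, y)) \<in> measurable circle_measure (circles J \<Otimes>\<^sub>M circle_measure)"
      using sp by (rule measurable_Pair1')
    from measurable_compose[OF this measurable_add_dim[of i J "\<lambda>_. circle_measure"]]
    have "(\<lambda>y. x(i := y)) \<in> measurable circle_measure (circles (insert i J))" by simp
    from measurable_compose[OF this measurable_variable_part[OF assms(4), of i "insert i J"]]
    have "(\<lambda>y. variable_part t F (insert i J) i ps (x(i := y))) \<in> borel_measurable circle_measure"
      by simp
    then show ?thesis by (simp cong: measurable_cong_sets)
  qed
  moreover have "AE y in circle_measure. variable_part t F (insert i J) i ps (x(i := y)) = paired K y + paired K (inverse y)"
    using AE_generic_insert[OF assms(2) gen assms(3)]
  proof eventually_elim
    case (elim y)
    have 1: "residue_kernel t ps (x(i := y)) (spectrum F J) = residue_kernel t ps x (spectrum F J)"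
      using assms(3,4) by (intro residue_kernel_cong eig_cong[where J = J and F = F]) auto
    have 2: "eig_density t F J (x(i := y)) = eig_density t F J x"
      using assms(3) by (intro eig_density_cong) auto
    have "paired K u = c * paired (residue_kernel t ps x (spectrum F J)) u" for u
      by (simp add: paired_def K_def)
    then show ?case
      unfolding variable_part_eq[OF assms(1-4) elim len] 1 2 c_def[symmetric]
      by (simp only: fun_upd_same distrib_left)
  qed
  ultimately have "(\<integral>y. variable_part t F (insert i J) i ps (x(i := y)) \<partial>circle_measure) = (K 1 + K (-1)) / 2"
    using r by (intro circle_integral_paired[where r = r]) auto
  also have "K 1 + K (-1) = (eig_density t F J x * residue_kernel t ps x (spectrum F J) (fixed Plus) +
      eig_density t F J x * residue_kernel t ps x (spectrum F J) (fixed Minus)) / (2 * of_nat (Suc (card J)))"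
    by (simp add: K_def c_def add_divide_distrib)
  also have "\<dots> = (\<Sum>q\<in>{Plus, Minus}. eig_density t F J x * residue_kernel t ps x (spectrum F J) (fixed q)) /
      (2 * of_nat (Suc (card J)))"
    by simp
  also have "(\<Sum>q\<in>{Plus, Minus}. eig_density t F J x * residue_kernel t ps x (spectrum F J) (fixed q)) =
      (\<Sum>q\<in>signs - F. eig_density t (insert q F) J x * hl_sum t ps (eig x) (spectrum (insert q F) J) / (kappa t F * (1 - t)))"
    using residue_kernel_fixed[OF assms(1,2,4) _ gen len]
    by (intro sum.mono_neutral_cong_right) auto
  finally have "(\<integral>y. variable_part t F (insert i J) i ps (x(i := y)) \<partial>circle_measure) =
    (\<Sum>q\<in>signs - F. eig_density t (insert q F) J x * hl_sum t ps (eig x) (spectrum (insert q F) J) /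
      (kappa t F * (1 - t))) / (2 * of_nat (Suc (card J))) / 2" .
  moreover have "kappa t F * (1 - t) * (2 * m) * 2 = 4 * m * (1 - t) * kappa t F" for m
    by simp
  ultimately show ?thesis
    by (simp only: sum_divide_distrib[symmetric] divide_divide_eq_left)
qed

text \<open>
  One conjugate pair is integrated out, and each missing fixed eigenvalue is created once.
\<close>

lemma integral_variable_part:
  assumes "norm t < 1" "finite J" "i \<notin> J" "F \<subseteq> signs" and len: "Suc (card (spectrum F J)) = length ps"
  shows "(\<integral>x. variable_part t F (insert i J) i ps x \<partial>circles (insert i J)) =
    (\<Sum>q\<in>signs - F. hl_int t (insert q F) J ps) / (4 * of_nat (Suc (card J)) * (1 - t) * kappa t F)"
proof -
  interpret product_sigma_finite "\<lambda>_::nat. circle_measure" by (rule product_sigma_finite_circle_measure)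
  let ?g = "\<lambda>q x. eig_density t (insert q F) J x * hl_sum t ps (eig x) (spectrum (insert q F) J)"
  let ?c = "4 * of_nat (Suc (card J)) * (1 - t) * kappa t F"
  have int: "integrable (circles J) (?g q)" if "q \<in> signs - F" for q
  proof (rule integrable_density_hl_sum)
    show "length ps = card (spectrum (insert q F) J)"
      using that assms len by (simp add: card_spectrum finite_fixed)
  qed (use assms that in auto)
  have "(\<lambda>p. (fst p)(i := snd p)) \<in> measurable (circles J \<Otimes>\<^sub>M circle_measure) (circles (insert i J))"
    using measurable_add_dim[of i J "\<lambda>_. circle_measure"] by (simp add: split_def)
  from measurable_compose[OF this measurable_variable_part[OF assms(4), of i "insert i J"]]
  have "(\<lambda>(x, y). variable_part t F (insert i J) i ps (x(i := y))) \<in>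
      borel_measurable (circles J \<Otimes>\<^sub>M circle_measure)"
    by (simp add: split_def)
  then have m: "(\<lambda>x. \<integral>y. variable_part t F (insert i J) i ps (x(i := y)) \<partial>circle_measure) \<in> borel_measurable (circles J)"
    by (rule sigma_finite_measure.borel_measurable_lebesgue_integral[OF
        prob_space_imp_sigma_finite[OF prob_space_circle_measure]])
  have m': "(\<lambda>x. (\<Sum>q\<in>signs - F. ?g q x) / ?c) \<in> borel_measurable (circles J)"
    by (intro borel_measurable_divide borel_measurable_sum borel_measurable_const
        borel_measurable_integrable int)
  have "(\<integral>x. variable_part t F (insert i J) i ps x \<partial>circles (insert i J)) =
      (\<integral>x. (\<integral>y. variable_part t F (insert i J) i ps (x(i := y)) \<partial>circle_measure) \<partial>circles J)"
    using assms by (intro product_integral_insert integrable_variable_part)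
  also have "\<dots> = (\<integral>x. (\<Sum>q\<in>signs - F. ?g q x) / ?c \<partial>circles J)"
  proof (rule integral_cong_AE[OF m m'])
    show "AE x in circles J. (\<integral>y. variable_part t F (insert i J) i ps (x(i := y)) \<partial>circle_measure) =
        (\<Sum>q\<in>signs - F. ?g q x) / ?c"
      using AE_generic[OF assms(2)] AE_space
      by eventually_elim (rule inner_integral_variable_part[OF assms])
  qed
  also have "\<dots> = (\<Sum>q\<in>signs - F. hl_int t (insert q F) J ps) / ?c"
    unfolding hl_int_def integral_divide_zero by (subst Bochner_Integration.integral_sum[OF int]) auto
  finally show ?thesis .
qed

lemma sum_spectrum:
  assumes "finite J" "F \<subseteq> signs"
  shows "(\<Sum>b\<in>spectrum F J. g b) = (\<Sum>q\<in>F. g q) + (\<Sum>j\<in>J. g (Inv j) + g (Var j))"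
proof -
  have "(\<Sum>b\<in>spectrum F J. g b) = (\<Sum>b\<in>Var ` J. g b) + (\<Sum>b\<in>Inv ` J. g b) + (\<Sum>q\<in>F. g q)"
    unfolding spectrum_def using assms finite_fixed[of F]
    by (subst sum.union_disjoint, auto)+
  also have "(\<Sum>b\<in>Var ` J. g b) = (\<Sum>j\<in>J. g (Var j))" by (subst sum.reindex) (auto simp: inj_on_def)
  also have "(\<Sum>b\<in>Inv ` J. g b) = (\<Sum>j\<in>J. g (Inv j))" by (subst sum.reindex) (auto simp: inj_on_def)
  finally show ?thesis by (simp add: sum.distrib add_ac)
qed

text \<open>
  The recursion.  The first sum collects the terms with a fixed eigenvalue in the last slot, the second
  those with a variable or its inverse there.
\<close>

lemma hl_int_one_Cons:
  assumes "norm t < 1" "finite J" "F \<subseteq> signs" "Suc (length ps) = card (spectrum F J)"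
  shows "hl_int t F J (1 # ps) =
    (\<Sum>q\<in>F. kappa t (F - {q}) * hl_int t (F - {q}) J ps) +
    (\<Sum>i\<in>J. (\<Sum>q\<in>signs - F. hl_int t (insert q F) (J - {i}) ps) /
       (4 * of_nat (card J) * (1 - t) * kappa t F))"
proof -
  let ?g = "\<lambda>q x. eig_density t (F - {q}) J x * hl_sum t ps (eig x) (spectrum (F - {q}) J)"
  have int1: "integrable (circles J) (?g q)" if "q \<in> F" for q
  proof (rule integrable_density_hl_sum)
    show "length ps = card (spectrum (F - {q}) J)"
      using card_spectrum_remove[OF assms(2,3) that] assms(4) by simp
  qed (use assms(1-3) in \<open>blast+\<close>)
  have J: "insert i (J - {i}) = J" if "i \<in> J" for i using that by auto
  have len: "Suc (card (spectrum F (J - {i}))) = length ps" if "i \<in> J" for i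
  proof -
    have "card J = Suc (card (J - {i}))" using that assms(2) by (intro card.remove)
    then show ?thesis using assms(2-4) by (simp add: card_spectrum)
  qed
  have int2: "integrable (circles J) (variable_part t F J i ps)" if "i \<in> J" for i
    using integrable_variable_part[of t "J - {i}" i F ps, unfolded J[OF that]] assms that len[OF that] by simp
  have m1: "(\<lambda>x. kappa t (F - {q}) * ?g q x) \<in> borel_measurable (circles J)" if "q \<in> F" for q
    using borel_measurable_integrable[OF int1[OF that]]
    by (rule borel_measurable_times[OF borel_measurable_const])
  have "(\<lambda>x. eig_density t F J x * hl_sum t (1 # ps) (eig x) (spectrum F J)) \<in> borel_measurable (circles J)"
    using assms by (intro borel_measurable_times measurable_eig_density measurable_hl_sum_eig[of F]) auto
  moreover have "(\<lambda>x. (\<Sum>q\<in>F. kappa t (F - {q}) * ?g q x) + (\<Sum>i\<in>J. variable_part t F J i ps x)) \<in> borel_measurable (circles J)"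
    by (intro borel_measurable_add borel_measurable_sum m1 borel_measurable_integrable[OF int2])
  moreover have "AE x in circles J. eig_density t F J x * hl_sum t (1 # ps) (eig x) (spectrum F J) =
      (\<Sum>q\<in>F. kappa t (F - {q}) * ?g q x) + (\<Sum>i\<in>J. variable_part t F J i ps x)"
    using AE_generic[OF assms(2)]
  proof eventually_elim
    case (elim x)
    have "eig_density t F J x * last_slot t ps x (spectrum F J) q = kappa t (F - {q}) * ?g q x" if "q \<in> F" for q
      using assms that elim by (intro last_slot_fixed)
    then show ?case
      unfolding hl_sum_one_Cons sum_spectrum[OF assms(2,3)] variable_part_def
      by (simp add: distrib_left sum_distrib_left)
  qed
  ultimately have "hl_int t F J (1 # ps) =
      (\<integral>x. (\<Sum>q\<in>F. kappa t (F - {q}) * ?g q x) + (\<Sum>i\<in>J. variable_part t F J i ps x) \<partial>circles J)"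
    unfolding hl_int_def by (rule integral_cong_AE)
  also have "\<dots> = (\<Sum>q\<in>F. kappa t (F - {q}) * hl_int t (F - {q}) J ps) +
      (\<Sum>i\<in>J. (\<integral>x. variable_part t F J i ps x \<partial>circles J))"
    unfolding hl_int_def using int1 int2
    by (subst Bochner_Integration.integral_add)
       (auto simp: Bochner_Integration.integral_sum intro!: Bochner_Integration.integrable_sum)
  also have "(\<Sum>i\<in>J. (\<integral>x. variable_part t F J i ps x \<partial>circles J)) =
      (\<Sum>i\<in>J. (\<Sum>q\<in>signs - F. hl_int t (insert q F) (J - {i}) ps) /
       (4 * of_nat (card J) * (1 - t) * kappa t F))"
  proof (rule sum.cong[OF refl])
    fix i assume i: "i \<in> J"
    have "Suc (card (J - {i})) = card J" using i assms(2) by (rule card_Suc_Diff1[rotated])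
    then show "(\<integral>x. variable_part t F J i ps x \<partial>circles J) =
      (\<Sum>q\<in>signs - F. hl_int t (insert q F) (J - {i}) ps) / (4 * of_nat (card J) * (1 - t) * kappa t F)"
      using integral_variable_part[of t "J - {i}" i F ps, unfolded J[OF i]] assms len[OF i] by simp
  qed
  finally show ?thesis .
qed

section \<open>A Pieri rule for straightening functionals\<close>

text \<open>
  The value 0 for \<open>k > r\<close> makes Pascal's rule hold at the boundary.
\<close>

definition gauss_binomial :: "complex \<Rightarrow> nat \<Rightarrow> nat \<Rightarrow> complex" where
  "gauss_binomial t r k = (if k \<le> r then tfact t r / (tfact t (r - k) * tfact t k) else 0)"

lemma tfact_Suc: "tfact t (Suc n) = tfact t n * tint t (Suc n)"
  by (simp add: tfact_def)

lemma gauss_binomial_ends: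
  assumes "norm t < 1"
  shows "gauss_binomial t r 0 = 1" "gauss_binomial t r r = 1"
  using tfact_nonzero[OF assms, of r] by (simp_all add: gauss_binomial_def tfact_def)

lemma gauss_binomial_Suc_Suc:
  assumes "norm t < 1" "k \<le> r"
  shows "gauss_binomial t (Suc r) (Suc k) = gauss_binomial t r (Suc k) + t ^ (r - k) * gauss_binomial t r k"
proof (cases "k = r")
  case True
  then show ?thesis
    using gauss_binomial_ends[OF assms(1)] by (simp add: gauss_binomial_def[of t r "Suc r"])
next
  case False
  \<comment> \<open>$[r+1] = [m+1] + t^{m+1} [k+1]$ for $r = k + m + 1$ is the whole content of the rule.\<close>
  define m where "m = r - Suc k"
  have m: "r = Suc (k + m)" using False assms(2) by (simp add: m_def)
  have "1 - t \<noteq> 0" using assms(1) by auto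
  then have split: "tint t (Suc (Suc (k + m))) = tint t (Suc m) + t ^ Suc m * tint t (Suc k)"
    unfolding tint_def by (simp add: add_divide_distrib[symmetric] power_add algebra_simps)
  have nz: "tfact t j \<noteq> 0" for j using tfact_nonzero[OF assms(1)] .
  have nz': "tint t (Suc j) \<noteq> 0" for j
    using nz[of "Suc j"] unfolding tfact_Suc by simp
  have 1: "gauss_binomial t (Suc r) (Suc k) =
      tfact t r / (tfact t m * tfact t k * tint t (Suc m) * tint t (Suc k)) * (tint t (Suc m) + t ^ Suc m * tint t (Suc k))"
    unfolding split[symmetric] using m by (simp add: gauss_binomial_def tfact_Suc mult_ac)
  have 2: "gauss_binomial t r (Suc k) =
      tfact t r / (tfact t m * tfact t k * tint t (Suc m) * tint t (Suc k)) * tint t (Suc m)"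
    using m nz'[of m] by (simp add: gauss_binomial_def tfact_Suc mult_ac)
  have 3: "t ^ (r - k) * gauss_binomial t r k =
      tfact t r / (tfact t m * tfact t k * tint t (Suc m) * tint t (Suc k)) * (t ^ Suc m * tint t (Suc k))"
    using m nz'[of k] by (simp add: gauss_binomial_def tfact_Suc mult_ac)
  show ?thesis unfolding 1 2 3 by (rule distrib_left)
qed

text \<open>
  Pascal's rule for Gaussian binomials, in the summed form needed for adding one element to a block.
\<close>

lemma gauss_binomial_sum_Suc:
  assumes "norm t < 1"
  shows "(\<Sum>k\<le>Suc r. gauss_binomial t (Suc r) k * Y k) =
    (\<Sum>k\<le>r. gauss_binomial t r k * Y k) + (\<Sum>k\<le>r. t ^ (r - k) * gauss_binomial t r k * Y (Suc k))"
proof -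
  have "(\<Sum>k\<le>Suc r. gauss_binomial t (Suc r) k * Y k) =
      Y 0 + (\<Sum>k\<le>r. gauss_binomial t (Suc r) (Suc k) * Y (Suc k))"
    unfolding sum.atMost_Suc_shift gauss_binomial_ends(1)[OF assms] by simp
  also have "(\<Sum>k\<le>r. gauss_binomial t (Suc r) (Suc k) * Y (Suc k)) =
      (\<Sum>k\<le>r. gauss_binomial t r (Suc k) * Y (Suc k)) + (\<Sum>k\<le>r. t ^ (r - k) * gauss_binomial t r k * Y (Suc k))"
    using gauss_binomial_Suc_Suc[OF assms, of _ r] by (simp add: sum.distrib[symmetric] distrib_right)
  also have "Y 0 + ((\<Sum>k\<le>r. gauss_binomial t r (Suc k) * Y (Suc k)) + (\<Sum>k\<le>r. t ^ (r - k) * gauss_binomial t r k * Y (Suc k))) =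
      (\<Sum>k\<le>Suc r. gauss_binomial t r k * Y k) + (\<Sum>k\<le>r. t ^ (r - k) * gauss_binomial t r k * Y (Suc k))"
    unfolding sum.atMost_Suc_shift[of "\<lambda>k. gauss_binomial t r k * Y k"] gauss_binomial_ends(1)[OF assms] by simp
  also have "(\<Sum>k\<le>Suc r. gauss_binomial t r k * Y k) = (\<Sum>k\<le>r. gauss_binomial t r k * Y k)"
    by (simp add: gauss_binomial_def)
  finally show ?thesis .
qed

text \<open>
  The two properties of the integrals that the Pieri rule uses: linearity in each slot and straightening of neighbouring
  slots.
\<close>

definition hl_functional :: "complex \<Rightarrow> nat \<Rightarrow> (complex poly list \<Rightarrow> complex) \<Rightarrow> bool" where
  "hl_functional t N L \<longleftrightarrow>
     (\<forall>pre p q post. length pre + length post + 1 = N \<longrightarrow>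
        L (pre @ (p + q) # post) = L (pre @ p # post) + L (pre @ q # post)) \<and>
     (\<forall>pre c p post. length pre + length post + 1 = N \<longrightarrow>
        L (pre @ smult c p # post) = c * L (pre @ p # post)) \<and>
     (\<forall>pre p post. length pre + length post + 2 = N \<longrightarrow>
        L (pre @ pCons 0 p # p # post) = t * L (pre @ p # pCons 0 p # post))"

lemma hl_functionalD:
  assumes "hl_functional t N L"
  shows "length pre + length post + 1 = N \<Longrightarrow> L (pre @ (p + q) # post) = L (pre @ p # post) + L (pre @ q # post)"
    "length pre + length post + 1 = N \<Longrightarrow> L (pre @ smult c p # post) = c * L (pre @ p # post)"
    "length pre + length post + 2 = N \<Longrightarrow> L (pre @ pCons 0 p # p # post) = t * L (pre @ p # pCons 0 p # post)"
  using assms unfolding hl_functional_def by blast+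

lemma hl_functional_map_mult:
  assumes "hl_functional t N L"
  shows "hl_functional t N (\<lambda>ps. L (map ((*) g) ps))"
  unfolding hl_functional_def
  using hl_functionalD[OF assms] by (simp add: distrib_left)

lemma hl_functional_combine:
  assumes "hl_functional t N L" "hl_functional t N L'"
  shows "hl_functional t N (\<lambda>ps. L ps / c + L' ps / c')"
  unfolding hl_functional_def
  using hl_functionalD[OF assms(1)] hl_functionalD[OF assms(2)]
  by (simp add: add_divide_distrib distrib_left)

lemma hl_functional_move:
  assumes "hl_functional t N L" "length pre + m + length post + 1 = N"
  shows "L (pre @ pCons 0 p # replicate m p @ post) = t ^ m * L (pre @ replicate m p @ pCons 0 p # post)"
  using assms(2)
proof (induction m arbitrary: pre)
  case (Suc m)
  have "L (pre @ pCons 0 p # replicate (Suc m) p @ post) = L (pre @ pCons 0 p # p # (replicate m p @ post))"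
    by simp
  also have "\<dots> = t * L (pre @ p # pCons 0 p # (replicate m p @ post))"
    using Suc.prems by (intro hl_functionalD(3)[OF assms(1)]) simp
  also have "L (pre @ p # pCons 0 p # (replicate m p @ post)) =
      t ^ m * L ((pre @ [p]) @ replicate m p @ pCons 0 p # post)"
    using Suc.IH[of "pre @ [p]"] Suc.prems by simp
  finally show ?case by simp
qed simp

text \<open>
  The product over a block of equal parts is expanded one slot at a time.  A slot whose exponent is raised moves past the
  \<open>r - k\<close> slots that are not raised, at the price of one factor \<open>t\<close> each.
\<close>

lemma hl_functional_block:
  assumes "hl_functional t N L" "norm t < 1" "length pre + r + length post = N"
  shows "L (pre @ replicate r (p * [:1, -\<beta>:]) @ post) =
    (\<Sum>k\<le>r. gauss_binomial t r k *
       ((-\<beta>) ^ k * L (pre @ replicate (r - k) p @ replicate k (pCons 0 p) @ post)))"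
  using assms(3)
proof (induction r arbitrary: pre)
  case 0
  then show ?case using gauss_binomial_ends(1)[OF assms(2), of 0] by simp
next
  case (Suc r)
  let ?q = "p * [:1, -\<beta>:]" and ?x = "pCons 0 p"
  define X where "X k = L (pre @ replicate (Suc r - k) p @ replicate k ?x @ post)" for k
  have q: "?q = p + smult (-\<beta>) ?x" by simp
  have step: "L ((pre @ [?q]) @ replicate (r - k) p @ replicate k ?x @ post) = X k + (-\<beta>) * (t ^ (r - k) * X (Suc k))"
    if "k \<le> r" for k
  proof -
    let ?R = "replicate (r - k) p @ replicate k ?x @ post"
    have len: "length pre + length ?R + 1 = N" using Suc.prems that by simp
    have "L (pre @ ?q # ?R) = L (pre @ p # ?R) + (-\<beta>) * L (pre @ ?x # ?R)"
      unfolding q hl_functionalD(1)[OF assms(1) len] hl_functionalD(2)[OF assms(1) len] ..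
    also have "L (pre @ p # ?R) = X k"
      using that by (simp add: X_def Suc_diff_le)
    also have "L (pre @ ?x # ?R) = t ^ (r - k) * L (pre @ replicate (r - k) p @ ?x # (replicate k ?x @ post))"
      using len by (intro hl_functional_move[OF assms(1)]) simp
    also have "L (pre @ replicate (r - k) p @ ?x # (replicate k ?x @ post)) = X (Suc k)"
      by (simp add: X_def)
    finally show ?thesis by simp
  qed
  have "L (pre @ replicate (Suc r) ?q @ post) = L ((pre @ [?q]) @ replicate r ?q @ post)" by simp
  also have "\<dots> = (\<Sum>k\<le>r. gauss_binomial t r k *
       ((-\<beta>) ^ k * L ((pre @ [?q]) @ replicate (r - k) p @ replicate k ?x @ post)))"
    using Suc.prems by (intro Suc.IH) simp
  also have "\<dots> = (\<Sum>k\<le>r. gauss_binomial t r k * ((-\<beta>) ^ k * X k) +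
      t ^ (r - k) * gauss_binomial t r k * ((-\<beta>) ^ Suc k * X (Suc k)))"
  proof (rule sum.cong[OF refl])
    fix k assume "k \<in> {..r}"
    then have s: "L ((pre @ [?q]) @ replicate (r - k) p @ replicate k ?x @ post) = X k + (-\<beta>) * (t ^ (r - k) * X (Suc k))"
      by (intro step) simp
    show "gauss_binomial t r k * ((-\<beta>) ^ k * L ((pre @ [?q]) @ replicate (r - k) p @ replicate k ?x @ post)) =
      gauss_binomial t r k * ((-\<beta>) ^ k * X k) + t ^ (r - k) * gauss_binomial t r k * ((-\<beta>) ^ Suc k * X (Suc k))"
      unfolding s by (simp add: algebra_simps)
  qed
  also have "\<dots> = (\<Sum>k\<le>Suc r. gauss_binomial t (Suc r) k * ((-\<beta>) ^ k * X k))"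
    unfolding gauss_binomial_sum_Suc[OF assms(2)] by (rule sum.distrib)
  finally show ?case by (simp only: X_def)
qed

lemma sorted_split_first_block:
  fixes xs :: "nat list"
  assumes "sorted xs" "\<And>x. x \<in> set xs \<Longrightarrow> m \<le> x"
  shows "xs = replicate (count_list xs m) m @ filter (\<lambda>x. x \<noteq> m) xs"
  using assms
proof (induction xs)
  case (Cons x xs)
  show ?case
  proof (cases "x = m")
    case False
    then have "m < x" using Cons.prems(2)[of x] by simp
    then have "m \<notin> set (x # xs)" using Cons.prems(1) by auto
    then have "count_list (x # xs) m = 0" "filter (\<lambda>x. x \<noteq> m) (x # xs) = x # xs"
      by (simp_all add: count_list_0_iff filter_id_conv del: filter.simps) auto
    then show ?thesis by simp
  qed (use Cons in simp)
qed simp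

lemma count_list_filter: "P x \<Longrightarrow> count_list (filter P xs) x = count_list xs x"
  by (induction xs) auto

text \<open>
  The contribution of \<open>r\<close> equal parts \<open>m\<close>, \<open>k\<close> of which are raised to \<open>m + 1\<close>, if \<open>f\<close> gives
  the contribution of single parts.
\<close>

definition block_factor :: "complex \<Rightarrow> (nat \<Rightarrow> complex) \<Rightarrow> complex \<Rightarrow> nat \<Rightarrow> nat \<Rightarrow> complex" where
  "block_factor t f \<beta> r m = (\<Sum>k\<le>r. gauss_binomial t r k * ((-\<beta> * f (Suc m)) ^ k * f m ^ (r - k)))"

text \<open>
  If the functional is multiplicative in the parts, then multiplication by $\prod_i (1-\beta z_i)$ makes it multiplicative
  in the blocks of equal parts.  The blocks are expanded from the smallest part upwards.  Raising parts
  by one keeps the list sorted, so the expansion needs no further straightening.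
\<close>

lemma hl_functional_pieri:
  assumes L: "hl_functional t N L" and t: "norm t < 1"
    and eval: "\<And>\<nu>. sorted \<nu> \<Longrightarrow> length \<nu> = N \<Longrightarrow> L (map (monom 1) \<nu>) = C * prod_list (map f \<nu>)"
    and \<mu>: "sorted \<mu>" "length \<mu> = N"
  shows "L (map (\<lambda>a. monom 1 a * [:1, -\<beta>:]) \<mu>) = C * (\<Prod>m\<in>set \<mu>. block_factor t f \<beta> (count_list \<mu> m) m)"
proof -
  have "L (map (monom 1) \<nu> @ map (\<lambda>a. monom 1 a * [:1, -\<beta>:]) \<mu>) =
      C * prod_list (map f \<nu>) * (\<Prod>m\<in>set \<mu>. block_factor t f \<beta> (count_list \<mu> m) m)"
    if "sorted (\<nu> @ \<mu>)" "length \<nu> + length \<mu> = N" for \<nu> \<mu>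
    using that
  proof (induction "length \<mu>" arbitrary: \<nu> \<mu> rule: less_induct)
    case less
    show ?case
    proof (cases \<mu>)
      case Nil
      then show ?thesis using less.prems by (simp add: eval)
    next
      case (Cons m ms)
      define r where "r = count_list \<mu> m"
      define \<mu>' where "\<mu>' = filter (\<lambda>x. x \<noteq> m) \<mu>"
      have sorted: "sorted \<nu>" "sorted \<mu>" "\<And>x y. x \<in> set \<nu> \<Longrightarrow> y \<in> set \<mu> \<Longrightarrow> x \<le> y"
        using less.prems(1) by (auto simp: sorted_append)
      have ge: "m \<le> x" if "x \<in> set \<mu>" for x using that sorted(2) Cons by auto
      \<comment> \<open>$r$ slots of the smallest exponent come first, because the list is ascending\<close>
      have split: "\<mu> = replicate r m @ \<mu>'"
        unfolding r_def \<mu>'_def using sorted(2) ge by (rule sorted_split_first_block)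
      have "m \<in> set \<mu>" using Cons by simp
      then have "0 < r" unfolding r_def by (metis count_list_0_iff neq0_conv)
      then have shorter: "length \<mu>' < length \<mu>" using split by (metis add_less_same_cancel2 length_append length_replicate not_less_iff_gr_or_eq not_less0 add.commute less_add_same_cancel1)
      have gt: "Suc m \<le> x" if "x \<in> set \<mu>'" for x
        using that ge[of x] by (auto simp: \<mu>'_def)
      have sorted': "sorted \<mu>'" using sorted(2) unfolding \<mu>'_def by (rule sorted_wrt_filter)
      have len: "length (map (monom (1::complex)) \<nu>) + r + length (map (\<lambda>a. monom 1 a * [:1, -\<beta>:]) \<mu>') = N"
        using less.prems(2) split by (metis add.assoc length_append length_map length_replicate)
      have monomials: "L (map (monom 1) \<nu> @ replicate (r - k) (monom 1 m) @ replicate k (pCons 0 (monom 1 m)) @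
            map (\<lambda>a. monom 1 a * [:1, -\<beta>:]) \<mu>') =
          C * prod_list (map f \<nu>) * (f m ^ (r - k) * f (Suc m) ^ k) *
            (\<Prod>m\<in>set \<mu>'. block_factor t f \<beta> (count_list \<mu>' m) m)" if "k \<le> r" for k
      proof -
        let ?\<nu> = "\<nu> @ replicate (r - k) m @ replicate k (Suc m)"
        have "\<And>x. x \<in> set \<nu> \<Longrightarrow> x \<le> m" using sorted(3) \<open>m \<in> set \<mu>\<close> by blast
        then have "sorted (?\<nu> @ \<mu>')"
          using sorted sorted' gt by (fastforce simp: sorted_append \<mu>'_def)
        moreover have "length ?\<nu> + length \<mu>' = N" using len that by simp
        ultimately have "L (map (monom 1) ?\<nu> @ map (\<lambda>a. monom 1 a * [:1, -\<beta>:]) \<mu>') =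
          C * prod_list (map f ?\<nu>) * (\<Prod>m\<in>set \<mu>'. block_factor t f \<beta> (count_list \<mu>' m) m)"
          by (intro less.hyps shorter)
        then show ?thesis by (simp add: monom_Suc mult_ac)
      qed
      have "L (map (monom 1) \<nu> @ map (\<lambda>a. monom 1 a * [:1, -\<beta>:]) \<mu>) =
          L (map (monom 1) \<nu> @ replicate r (monom 1 m * [:1, -\<beta>:]) @ map (\<lambda>a. monom 1 a * [:1, -\<beta>:]) \<mu>')"
        by (subst split) (simp only: map_append map_replicate)
      also have "\<dots> = (\<Sum>k\<le>r. gauss_binomial t r k * ((-\<beta>) ^ k * L (map (monom 1) \<nu> @
          replicate (r - k) (monom 1 m) @ replicate k (pCons 0 (monom 1 m)) @ map (\<lambda>a. monom 1 a * [:1, -\<beta>:]) \<mu>')))"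
        by (rule hl_functional_block[OF L t len])
      also have "\<dots> = (\<Sum>k\<le>r. C * prod_list (map f \<nu>) * (gauss_binomial t r k * ((-\<beta> * f (Suc m)) ^ k * f m ^ (r - k)) *
            (\<Prod>m\<in>set \<mu>'. block_factor t f \<beta> (count_list \<mu>' m) m)))"
      proof (rule sum.cong[OF refl])
        fix k assume "k \<in> {..r}"
        then have "k \<le> r" by simp
        then show "gauss_binomial t r k * ((-\<beta>) ^ k * L (map (monom 1) \<nu> @
          replicate (r - k) (monom 1 m) @ replicate k (pCons 0 (monom 1 m)) @ map (\<lambda>a. monom 1 a * [:1, -\<beta>:]) \<mu>')) =
          C * prod_list (map f \<nu>) * (gauss_binomial t r k * ((-\<beta> * f (Suc m)) ^ k * f m ^ (r - k)) *
            (\<Prod>m\<in>set \<mu>'. block_factor t f \<beta> (count_list \<mu>' m) m))"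
          unfolding monomials[OF \<open>k \<le> r\<close>] by (simp only: power_mult_distrib mult_ac)
      qed
      also have "\<dots> = C * prod_list (map f \<nu>) * (block_factor t f \<beta> r m *
            (\<Prod>m\<in>set \<mu>'. block_factor t f \<beta> (count_list \<mu>' m) m))"
        by (simp only: block_factor_def sum_distrib_left[symmetric] sum_distrib_right[symmetric])
      also have "(\<Prod>m\<in>set \<mu>'. block_factor t f \<beta> (count_list \<mu>' m) m) =
          (\<Prod>m\<in>set \<mu> - {m}. block_factor t f \<beta> (count_list \<mu> m) m)"
        by (intro prod.cong) (auto simp: \<mu>'_def count_list_filter)
      also have "block_factor t f \<beta> r m * \<dots> = (\<Prod>m\<in>set \<mu>. block_factor t f \<beta> (count_list \<mu> m) m)"
        using \<open>m \<in> set \<mu>\<close> by (simp add: prod.remove[of "set \<mu>" m] r_def)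
      finally show ?thesis .
    qed
  qed
  from this[of "[]" \<mu>] \<mu> show ?thesis by simp
qed

lemma prod_list_map_count:
  "prod_list (map f xs) = (\<Prod>m\<in>set xs. f m ^ count_list xs m :: complex)"
proof (induction xs)
  case (Cons x xs)
  have *: "(\<Prod>m\<in>set xs - {x}. f m ^ count_list (x # xs) m) = (\<Prod>m\<in>set xs - {x}. f m ^ count_list xs m)"
    by (intro prod.cong) auto
  have "(\<Prod>m\<in>set (x # xs). f m ^ count_list (x # xs) m) =
      f x * (f x ^ count_list xs x * (\<Prod>m\<in>set xs - {x}. f m ^ count_list xs m))"
    using * by (simp add: prod.insert_remove[of "set xs" _ x])
  also have "f x ^ count_list xs x * (\<Prod>m\<in>set xs - {x}. f m ^ count_list xs m) =
      (\<Prod>m\<in>set xs. f m ^ count_list xs m)"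
  proof (cases "x \<in> set xs")
    case False
    then have "count_list xs x = 0" "set xs - {x} = set xs" by (auto simp: count_list_0_iff)
    then show ?thesis by simp
  qed (simp add: prod.remove[of "set xs" x])
  finally show ?case using Cons by simp
qed simp

text \<open>
  With only even parts allowed, the rule for $\alpha$ must raise every odd part and no even
  part, so that the result is again multiplicative in the parts.  This allows a second application, with $\beta$.
\<close>

lemma hl_functional_two_factors:
  assumes L: "hl_functional t N L" and t: "norm t < 1"
    and eval: "\<And>\<nu>. sorted \<nu> \<Longrightarrow> length \<nu> = N \<Longrightarrow>
      L (map (monom 1) \<nu>) = C * prod_list (map (\<lambda>a. if even a then 1 else 0) \<nu>)"
    and \<mu>: "sorted \<mu>" "length \<mu> = N"
  shows "L (map (\<lambda>a. [:1, -\<alpha>:] * (monom 1 a * [:1, -\<beta>:])) \<mu>) = C * (even_part \<mu> \<alpha> \<beta> t * odd_part \<mu> \<alpha> \<beta> t)"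
proof -
  let ?f = "\<lambda>a::nat. if even a then 1 else 0 :: complex"
  let ?g = "\<lambda>a::nat. if even a then 1 else - \<alpha>"
  have first: "block_factor t ?f \<alpha> r m = ?g m ^ r" for r m
  proof (cases "even m")
    case True
    then have "block_factor t ?f \<alpha> r m = (\<Sum>k\<in>{0}. gauss_binomial t r k * ((-\<alpha> * ?f (Suc m)) ^ k * ?f m ^ (r - k)))"
      unfolding block_factor_def by (intro sum.mono_neutral_right) auto
    then show ?thesis using True gauss_binomial_ends[OF t, of r] by simp
  next
    case False
    then have "block_factor t ?f \<alpha> r m = (\<Sum>k\<in>{r}. gauss_binomial t r k * ((-\<alpha> * ?f (Suc m)) ^ k * ?f m ^ (r - k)))"
      unfolding block_factor_def by (intro sum.mono_neutral_right) auto
    then show ?thesis using False gauss_binomial_ends[OF t, of r] by simp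
  qed
  have eval': "L (map ((*) [:1, -\<alpha>:]) (map (monom 1) \<nu>)) = C * prod_list (map ?g \<nu>)"
    if "sorted \<nu>" "length \<nu> = N" for \<nu>
  proof -
    have "L (map ((*) [:1, -\<alpha>:]) (map (monom 1) \<nu>)) = L (map (\<lambda>a. monom 1 a * [:1, -\<alpha>:]) \<nu>)"
      unfolding map_map o_def by (simp only: mult.commute)
    also have "\<dots> = C * (\<Prod>m\<in>set \<nu>. block_factor t ?f \<alpha> (count_list \<nu> m) m)"
      using eval that by (intro hl_functional_pieri[OF L t])
    finally show ?thesis by (simp only: first prod_list_map_count)
  qed
  have second: "block_factor t ?g \<beta> r m =
      (if even m then rogers_szego r (\<alpha> * \<beta>) t
       else (-1) ^ r * (\<Sum>j\<le>r. \<beta> ^ j * \<alpha> ^ (r - j) * (tfact t r / (tfact t (r - j) * tfact t j))))" for r m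
  proof (cases "even m")
    case True
    have "-\<beta> * -\<alpha> = \<alpha> * \<beta>" by simp
    then show ?thesis
      using True by (simp add: block_factor_def rogers_szego_def gauss_binomial_def mult_ac)
  next
    case False
    have sgn: "(-\<beta>) ^ k * (-\<alpha>) ^ (r - k) = (-1) ^ r * (\<beta> ^ k * \<alpha> ^ (r - k))" if "k \<le> r" for k
    proof -
      have "(-1::complex) ^ r = (-1) ^ k * (-1) ^ (r - k)"
        using that by (simp flip: power_add)
      then show ?thesis by (simp add: power_minus[of \<beta>] power_minus[of \<alpha>])
    qed
    have "gauss_binomial t r k * ((-\<beta>) ^ k * (-\<alpha>) ^ (r - k)) =
        (-1) ^ r * (\<beta> ^ k * \<alpha> ^ (r - k) * (tfact t r / (tfact t (r - k) * tfact t k)))" if "k \<le> r" for k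
      unfolding sgn[OF that] using that by (simp add: gauss_binomial_def)
    then show ?thesis
      using False by (simp add: block_factor_def sum_distrib_left)
  qed
  have "L (map (\<lambda>a. [:1, -\<alpha>:] * (monom 1 a * [:1, -\<beta>:])) \<mu>) =
      L (map ((*) [:1, -\<alpha>:]) (map (\<lambda>a. monom 1 a * [:1, -\<beta>:]) \<mu>))"
    unfolding map_map o_def ..
  also have "\<dots> = C * (\<Prod>m\<in>set \<mu>. block_factor t ?g \<beta> (count_list \<mu> m) m)"
    using eval' \<mu> by (intro hl_functional_pieri[OF hl_functional_map_mult[OF L] t])
  also have "(\<Prod>m\<in>set \<mu>. block_factor t ?g \<beta> (count_list \<mu> m) m) = even_part \<mu> \<alpha> \<beta> t * odd_part \<mu> \<alpha> \<beta> t"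
  proof -
    have "set \<mu> = {m \<in> set \<mu>. even m} \<union> {m \<in> set \<mu>. odd m}" by auto
    then have "(\<Prod>m\<in>set \<mu>. block_factor t ?g \<beta> (count_list \<mu> m) m) =
        (\<Prod>m | m \<in> set \<mu> \<and> even m. block_factor t ?g \<beta> (count_list \<mu> m) m) *
        (\<Prod>m | m \<in> set \<mu> \<and> odd m. block_factor t ?g \<beta> (count_list \<mu> m) m)"
      by (subst prod.union_disjoint[symmetric]) auto
    then show ?thesis
      unfolding even_part_def odd_part_eq[OF t] Let_def by (simp add: second)
  qed
  finally show ?thesis .
qed

section \<open>Evaluation of the integrals\<close>

lemma hl_int_cong_AE:
  assumes "finite J" "F \<subseteq> signs"
    and "\<And>x. generic J x \<Longrightarrow> hl_sum t ps (eig x) (spectrum F J) = c * hl_sum t qs (eig x) (spectrum F J)"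
  shows "hl_int t F J ps = c * hl_int t F J qs"
proof -
  have "(\<integral>x. eig_density t F J x * hl_sum t ps (eig x) (spectrum F J) \<partial>circles J) =
      (\<integral>x. c * (eig_density t F J x * hl_sum t qs (eig x) (spectrum F J)) \<partial>circles J)"
  proof (rule integral_cong_AE)
    show "AE x in circles J. eig_density t F J x * hl_sum t ps (eig x) (spectrum F J) =
        c * (eig_density t F J x * hl_sum t qs (eig x) (spectrum F J))"
      using AE_generic[OF assms(1)] by eventually_elim (simp add: assms(3))
  qed (use assms in \<open>intro borel_measurable_times borel_measurable_const measurable_eig_density
      measurable_hl_sum_eig[of F]; simp\<close>)+
  then show ?thesis by (simp add: hl_int_def)
qed

text \<open>
  Conjugate pairs have product 1, so $\prod_i z_i^a$ is constant on the torus.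
\<close>

lemma hl_int_map_monom:
  assumes "finite J" "F \<subseteq> signs" "length ps = card (spectrum F J)"
  shows "hl_int t F J (map ((*) (monom 1 a)) ps) = (\<Prod>q\<in>F. fixed q) ^ a * hl_int t F J ps"
proof (rule hl_int_cong_AE[OF assms(1,2)])
  fix x assume gen: "generic J x"
  have "hl_sum t (map ((*) (monom 1 a)) ps) (eig x) (spectrum F J) =
      (\<Prod>b\<in>spectrum F J. poly (monom 1 a) (eig x b)) * hl_sum t ps (eig x) (spectrum F J)"
    using assms by (intro hl_sum_mult) auto
  also have "(\<Prod>b\<in>spectrum F J. poly (monom 1 a) (eig x b)) = (\<Prod>b\<in>spectrum F J. eig x b) ^ a"
    by (simp add: poly_monom prod_power_distrib)
  also have "(\<Prod>b\<in>spectrum F J. eig x b) = (\<Prod>q\<in>F. fixed q)"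
  proof -
    have "(\<Prod>j\<in>J. eig x (Var j) * eig x (Inv j)) = 1"
      using generic_neq(1)[OF gen] by (intro prod.neutral) auto
    moreover have "(\<Prod>q\<in>F. eig x q) = (\<Prod>q\<in>F. fixed q)"
      using assms(2) by (intro prod.cong) auto
    ultimately show ?thesis by (simp only: prod_spectrum[OF assms(1,2)] mult_1_left)
  qed
  finally show "hl_sum t (map ((*) (monom 1 a)) ps) (eig x) (spectrum F J) =
      (\<Prod>q\<in>F. fixed q) ^ a * hl_sum t ps (eig x) (spectrum F J)" .
qed

text \<open>
  After the factor $z^a$ with the smallest exponent is split off, the last slot carries the polynomial 1 and
  the recursion applies.  The split-off factors for $F$ and for the toggled set differ by $\varepsilon^a$.
\<close>

lemma hl_int_monom_Cons:
  assumes "norm t < 1" "finite J" "F \<subseteq> signs" "Suc (length \<nu>) = card (spectrum F J)"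
    and ge: "\<And>b. b \<in> set \<nu> \<Longrightarrow> a \<le> b"
  shows "hl_int t F J (map (monom 1) (a # \<nu>)) =
    (\<Sum>q\<in>F. fixed q ^ a * (kappa t (F - {q}) * hl_int t (F - {q}) J (map (monom 1) \<nu>))) +
    (\<Sum>i\<in>J. (\<Sum>q\<in>signs - F. fixed q ^ a * hl_int t (insert q F) (J - {i}) (map (monom 1) \<nu>)) /
       (4 * of_nat (card J) * (1 - t) * kappa t F))"
proof -
  define s where "s F = (\<Prod>q\<in>F. fixed q) ^ a" for F
  \<comment> \<open>The exponents that remain when the common power $z^a$ is split off; no subtraction is truncated.\<close>
  define \<nu>' where "\<nu>' = map (\<lambda>b. b - a) \<nu>"
  have \<nu>: "map (monom 1) \<nu> = map ((*) (monom 1 a)) (map (monom (1::complex)) \<nu>')"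
    using ge by (simp add: \<nu>'_def mult_monom)
  have fin: "finite F" using assms(3) by (rule finite_fixed)
  have shift: "hl_int t F' J' (map (monom 1) \<nu>) = s F' * hl_int t F' J' (map (monom 1) \<nu>')"
    if "finite J'" "F' \<subseteq> signs" "length \<nu> = card (spectrum F' J')" for F' J'
    unfolding \<nu> s_def using that by (intro hl_int_map_monom) (auto simp: \<nu>'_def)
  have sq: "fixed q ^ a * fixed q ^ a = 1" if "q \<in> signs" for q
    using eig_fixed(2)[OF that] by (simp add: power_mult_distrib[symmetric])
  have remove: "s F * hl_int t (F - {q}) J (map (monom 1) \<nu>') = fixed q ^ a * hl_int t (F - {q}) J (map (monom 1) \<nu>)"
    if q: "q \<in> F" for q
  proof -
    have sub: "F - {q} \<subseteq> signs" using assms(3) by blast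
    have "length \<nu> = card (spectrum (F - {q}) J)"
      using card_spectrum_remove[OF assms(2,3) q] assms(4) by simp
    from shift[OF assms(2) sub this]
    have 1: "hl_int t (F - {q}) J (map (monom 1) \<nu>) = s (F - {q}) * hl_int t (F - {q}) J (map (monom 1) \<nu>')" .
    have "s F = fixed q ^ a * s (F - {q})"
      unfolding s_def prod.remove[OF fin q] by (rule power_mult_distrib)
    then show ?thesis unfolding 1 by (simp only: mult.assoc)
  qed
  have add: "s F * hl_int t (insert q F) (J - {i}) (map (monom 1) \<nu>') =
      fixed q ^ a * hl_int t (insert q F) (J - {i}) (map (monom 1) \<nu>)"
    if q: "q \<in> signs - F" and i: "i \<in> J" for q i
  proof -
    have sub: "insert q F \<subseteq> signs" using q assms(3) by blast
    have "length \<nu> = card (spectrum (insert q F) (J - {i}))"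
      using card_spectrum_exchange[OF assms(2,3) q i] assms(4) by simp
    from shift[OF _ sub this] assms(2)
    have 1: "hl_int t (insert q F) (J - {i}) (map (monom 1) \<nu>) =
        s (insert q F) * hl_int t (insert q F) (J - {i}) (map (monom 1) \<nu>')" by simp
    have "s (insert q F) = fixed q ^ a * s F"
      unfolding s_def using q fin by (simp add: power_mult_distrib)
    then have "fixed q ^ a * s (insert q F) = s F"
      using sq[of q] q by (simp only: mult.assoc[symmetric] mult_1_left) simp
    then show ?thesis unfolding 1 by (simp only: mult.assoc[symmetric])
  qed
  have "map (monom 1) (a # \<nu>) = map ((*) (monom 1 a)) (1 # map (monom (1::complex)) \<nu>')"
    using \<nu> by simp
  then have "hl_int t F J (map (monom 1) (a # \<nu>)) = s F * hl_int t F J (1 # map (monom 1) \<nu>')"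
    unfolding s_def using assms by (simp only:) (intro hl_int_map_monom; simp add: \<nu>'_def)
  also have "\<dots> = (\<Sum>q\<in>F. kappa t (F - {q}) * (s F * hl_int t (F - {q}) J (map (monom 1) \<nu>'))) +
      (\<Sum>i\<in>J. (\<Sum>q\<in>signs - F. s F * hl_int t (insert q F) (J - {i}) (map (monom 1) \<nu>')) /
       (4 * of_nat (card J) * (1 - t) * kappa t F))"
  proof -
    have "Suc (length (map (monom (1::complex)) \<nu>')) = card (spectrum F J)"
      using assms(4) by (simp add: \<nu>'_def)
    from hl_int_one_Cons[OF assms(1-3) this] show ?thesis
      by (simp only: distrib_left sum_distrib_left times_divide_eq_right mult.left_commute)
  qed
  also have "(\<Sum>q\<in>F. kappa t (F - {q}) * (s F * hl_int t (F - {q}) J (map (monom 1) \<nu>'))) =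
      (\<Sum>q\<in>F. fixed q ^ a * (kappa t (F - {q}) * hl_int t (F - {q}) J (map (monom 1) \<nu>)))"
  proof (rule sum.cong[OF refl])
    fix q assume "q \<in> F"
    then show "kappa t (F - {q}) * (s F * hl_int t (F - {q}) J (map (monom 1) \<nu>')) =
        fixed q ^ a * (kappa t (F - {q}) * hl_int t (F - {q}) J (map (monom 1) \<nu>))"
      by (simp only: remove mult.left_commute)
  qed
  also have "(\<Sum>i\<in>J. (\<Sum>q\<in>signs - F. s F * hl_int t (insert q F) (J - {i}) (map (monom 1) \<nu>')) /
       (4 * of_nat (card J) * (1 - t) * kappa t F)) =
      (\<Sum>i\<in>J. (\<Sum>q\<in>signs - F. fixed q ^ a * hl_int t (insert q F) (J - {i}) (map (monom 1) \<nu>)) /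
       (4 * of_nat (card J) * (1 - t) * kappa t F))"
    by (intro sum.cong refl arg_cong2[where f = "(/)"] add)
  finally show ?thesis .
qed

text \<open>
  The solution of the recursion.  It depends neither on the names of the variables nor on their number, which is
  determined by the length of the list.
\<close>

fun int_value :: "complex \<Rightarrow> eigen set \<Rightarrow> nat list \<Rightarrow> complex" where
  "int_value t F [] = (if F = {} then 1 else 0)"
| "int_value t F (a # \<nu>) =
     (\<Sum>q\<in>F. fixed q ^ a * (kappa t (F - {q}) * int_value t (F - {q}) \<nu>)) +
     (\<Sum>q\<in>signs - F. fixed q ^ a * int_value t (insert q F) \<nu>) / (4 * (1 - t) * kappa t F)"

text \<open>
  Boundary case of the recursion: more fixed eigenvalues than slots.
\<close>

lemma int_value_eq_0:
  assumes "F \<subseteq> signs" "length \<nu> < card F"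
  shows "int_value t F \<nu> = 0"
  using assms
proof (induction \<nu> arbitrary: F)
  case (Cons a \<nu>)
  have fin: "finite F" using Cons.prems(1) by (rule finite_fixed)
  have "int_value t (F - {q}) \<nu> = 0" if "q \<in> F" for q
  proof (rule Cons.IH)
    have "card F = Suc (card (F - {q}))" using that fin by (intro card.remove)
    then show "length \<nu> < card (F - {q})" using Cons.prems(2) by simp
  qed (use Cons.prems in blast)
  moreover have "int_value t (insert q F) \<nu> = 0" if "q \<in> signs - F" for q
    using that Cons.prems fin by (intro Cons.IH) auto
  ultimately show ?case by simp
qed auto

lemma hl_int_eq_value:
  assumes "norm t < 1" "finite J" "F \<subseteq> signs" "sorted \<nu>" "length \<nu> = card (spectrum F J)"
  shows "hl_int t F J (map (monom 1) \<nu>) = int_value t F \<nu>"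
  using assms(2-)
proof (induction \<nu> arbitrary: F J)
  case Nil
  then have "J = {}" "F = {}"
    using finite_fixed[of F] by (auto simp: card_spectrum)
  interpret prob_space "circles {}" by (rule prob_space_circles)
  have "hl_int t {} {} [] = (\<integral>x. 1 \<partial>circles {})"
    by (simp add: hl_int_def eig_density_def)
  also have "\<dots> = 1" using prob_space by simp
  finally show ?case using \<open>J = {}\<close> \<open>F = {}\<close> by simp
next
  case (Cons a \<nu>)
  have fin: "finite F" using Cons.prems(2) by (rule finite_fixed)
  have len: "Suc (length \<nu>) = card (spectrum F J)" using Cons.prems(4) by simp
  have card: "Suc (length \<nu>) = 2 * card J + card F"
    using len card_spectrum[OF Cons.prems(1,2)] by simp
  have sorted: "sorted \<nu>" "\<And>b. b \<in> set \<nu> \<Longrightarrow> a \<le> b" using Cons.prems(3) by auto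
  have remove: "hl_int t (F - {q}) J (map (monom 1) \<nu>) = int_value t (F - {q}) \<nu>" if "q \<in> F" for q
  proof (rule Cons.IH[OF Cons.prems(1) _ sorted(1)])
    show "F - {q} \<subseteq> signs" using Cons.prems(2) by blast
    show "length \<nu> = card (spectrum (F - {q}) J)"
      using card_spectrum_remove[OF Cons.prems(1,2) that] len by simp
  qed
  have add: "hl_int t (insert q F) (J - {i}) (map (monom 1) \<nu>) = int_value t (insert q F) \<nu>"
    if q: "q \<in> signs - F" and i: "i \<in> J" for q i
  proof (rule Cons.IH[OF _ _ sorted(1)])
    show "finite (J - {i})" using Cons.prems(1) by simp
    show "insert q F \<subseteq> signs" using q Cons.prems(2) by blast
    show "length \<nu> = card (spectrum (insert q F) (J - {i}))"
      using card_spectrum_exchange[OF Cons.prems(1,2) q i] len by simp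
  qed
  let ?S = "\<Sum>q\<in>signs - F. fixed q ^ a * int_value t (insert q F) \<nu>"
  have "(\<Sum>i\<in>J. (\<Sum>q\<in>signs - F. fixed q ^ a * hl_int t (insert q F) (J - {i}) (map (monom 1) \<nu>)) /
       (4 * of_nat (card J) * (1 - t) * kappa t F)) =
      (\<Sum>i\<in>J. ?S / (4 * of_nat (card J) * (1 - t) * kappa t F))"
    by (intro sum.cong refl arg_cong2[where f = "(/)"] arg_cong2[where f = "(*)"] add)
  also have "\<dots> = ?S / (4 * (1 - t) * kappa t F)"
  proof (cases "J = {}")
    case True
    \<comment> \<open>with no conjugate pairs left, adding a fixed eigenvalue overshoots the number of slots\<close>
    have "int_value t (insert q F) \<nu> = 0" if "q \<in> signs - F" for q
      using that card True Cons.prems(2) fin by (intro int_value_eq_0) auto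
    then show ?thesis using True by simp
  next
    case False
    then have "of_nat (card J) \<noteq> (0::complex)" using Cons.prems(1) by simp
    then show ?thesis by simp
  qed
  finally have "(\<Sum>i\<in>J. (\<Sum>q\<in>signs - F. fixed q ^ a * hl_int t (insert q F) (J - {i}) (map (monom 1) \<nu>)) /
       (4 * of_nat (card J) * (1 - t) * kappa t F)) = ?S / (4 * (1 - t) * kappa t F)" .
  moreover have "(\<Sum>q\<in>F. fixed q ^ a * (kappa t (F - {q}) * hl_int t (F - {q}) J (map (monom 1) \<nu>))) =
      (\<Sum>q\<in>F. fixed q ^ a * (kappa t (F - {q}) * int_value t (F - {q}) \<nu>))"
    by (intro sum.cong refl arg_cong2[where f = "(*)"] remove)
  moreover have "hl_int t F J (map (monom 1) (a # \<nu>)) =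
    (\<Sum>q\<in>F. fixed q ^ a * (kappa t (F - {q}) * hl_int t (F - {q}) J (map (monom 1) \<nu>))) +
    (\<Sum>i\<in>J. (\<Sum>q\<in>signs - F. fixed q ^ a * hl_int t (insert q F) (J - {i}) (map (monom 1) \<nu>)) /
       (4 * of_nat (card J) * (1 - t) * kappa t F))"
    by (rule hl_int_monom_Cons[OF assms(1) Cons.prems(1,2) len]) (rule sorted(2))
  ultimately show ?case by (simp only: int_value.simps)
qed

lemma int_value_Cons:
  "int_value t {} (a # \<nu>) =
     (int_value t {Plus} \<nu> + (-1) ^ a * int_value t {Minus} \<nu>) / (4 * (1 - t))"
  "int_value t {Plus, Minus} (a # \<nu>) =
     (1 + t) / 2 * (int_value t {Minus} \<nu> + (-1) ^ a * int_value t {Plus} \<nu>)"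
  "int_value t {Plus} (a # \<nu>) =
     int_value t {} \<nu> + (-1) ^ a * int_value t {Plus, Minus} \<nu> / (4 * (1 - t) * ((1 + t) / 2))"
  "int_value t {Minus} (a # \<nu>) =
     int_value t {Plus, Minus} \<nu> / (4 * (1 - t) * ((1 + t) / 2)) + (-1) ^ a * int_value t {} \<nu>"
proof -
  have *: "{Plus, Minus} - {Plus} = {Minus}" "{Plus, Minus} - {Minus} = {Plus}"
    "{Plus, Minus} - {Plus, Minus} = {}" "{Minus, Plus} = {Plus, Minus}"
    "{Plus} - {Plus} = {}" "{Minus} - {Minus} = {}" by auto
  show "int_value t {} (a # \<nu>) =
     (int_value t {Plus} \<nu> + (-1) ^ a * int_value t {Minus} \<nu>) / (4 * (1 - t))"
    by (simp add: kappa_def)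
  show "int_value t {Plus, Minus} (a # \<nu>) =
     (1 + t) / 2 * (int_value t {Minus} \<nu> + (-1) ^ a * int_value t {Plus} \<nu>)"
    unfolding int_value.simps * by (simp add: kappa_def * distrib_left)
  show "int_value t {Plus} (a # \<nu>) =
     int_value t {} \<nu> + (-1) ^ a * int_value t {Plus, Minus} \<nu> / (4 * (1 - t) * ((1 + t) / 2))"
    unfolding int_value.simps * by (simp add: kappa_def *)
  show "int_value t {Minus} (a # \<nu>) =
     int_value t {Plus, Minus} \<nu> / (4 * (1 - t) * ((1 + t) / 2)) + (-1) ^ a * int_value t {} \<nu>"
    unfolding int_value.simps * by (simp add: kappa_def *)
qed

text \<open>
  The weight of the second summand makes the even and the odd totals determine each
  other in the recursion.
\<close>

definition even_total :: "complex \<Rightarrow> nat list \<Rightarrow> complex" where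
  "even_total t \<nu> = int_value t {} \<nu> + int_value t {Plus, Minus} \<nu> / (4 * (1 - t) * ((1 + t) / 2))"

definition odd_total :: "complex \<Rightarrow> nat list \<Rightarrow> complex" where
  "odd_total t \<nu> = int_value t {Plus} \<nu> + int_value t {Minus} \<nu>"

abbreviation even_indicator :: "nat list \<Rightarrow> complex" where
  "even_indicator \<nu> \<equiv> prod_list (map (\<lambda>a. if even a then 1 else 0) \<nu>)"

lemma half_one_plus_nonzero: "norm (t::complex) < 1 \<Longrightarrow> (1 + t) / 2 \<noteq> 0"
  using kappa_nonzero[of t "{Plus}"] by (simp add: kappa_def)

text \<open>
  The two terms of each recursion step, from the fixed eigenvalues $1$ and $-1$, lead to the same total; they
  carry the coefficients $1$ and $(-1)^a$.
\<close>

lemma totals_Cons: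
  assumes "norm t < 1"
  shows "even_total t (a # \<nu>) = (1 + (-1) ^ a) / (4 * (1 - t)) * odd_total t \<nu>"
    and "odd_total t (a # \<nu>) = (1 + (-1) ^ a) * even_total t \<nu>"
proof -
  have "h * X / (4 * (1 - t) * h) = X / (4 * (1 - t))" if "h \<noteq> 0" for h X
    using that by simp
  note cancel = this[OF half_one_plus_nonzero[OF assms]]
  show "even_total t (a # \<nu>) = (1 + (-1) ^ a) / (4 * (1 - t)) * odd_total t \<nu>"
    unfolding even_total_def int_value_Cons cancel odd_total_def
    by (simp add: add_divide_distrib[symmetric] algebra_simps)
  show "odd_total t (a # \<nu>) = (1 + (-1) ^ a) * even_total t \<nu>"
    unfolding even_total_def int_value_Cons odd_total_def distrib_left distrib_right times_divide_eq_right mult_1_left add_divide_distrib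
    by (simp only: add_ac)
qed

lemma totals_eq:
  assumes "norm t < 1"
  shows "even_total t \<nu> = even_total t (replicate (length \<nu>) 0) * even_indicator \<nu> \<and>
    odd_total t \<nu> = odd_total t (replicate (length \<nu>) 0) * even_indicator \<nu>"
proof (induction \<nu>)
  case (Cons a \<nu>)
  then show ?case
    by (cases "even a") (simp_all add: totals_Cons[OF assms])
qed simp

lemma totals_nonzero:
  assumes "norm t < 1"
  shows "even_total t (replicate (2 * n) 0) \<noteq> 0" "odd_total t (replicate (Suc (2 * n)) 0) \<noteq> 0"
proof -
  have "1 - t \<noteq> 0" using assms by auto
  then have "even_total t (replicate (2 * n) 0) \<noteq> 0"
    by (induction n) (simp add: even_total_def, simp add: totals_Cons[OF assms])
  then show "even_total t (replicate (2 * n) 0) \<noteq> 0" "odd_total t (replicate (Suc (2 * n)) 0) \<noteq> 0"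
    by (simp_all add: totals_Cons[OF assms])
qed

text \<open>
  For exponent $0$ in the last slot both summands of a total obey the same recursion, so their normalising integrals
  agree up to the known weights.
\<close>

lemma totals_halves:
  assumes "norm t < 1"
  shows "int_value t {} (0 # \<nu>) = even_total t (0 # \<nu>) / 2"
    "int_value t {Plus, Minus} (0 # \<nu>) / (4 * (1 - t) * ((1 + t) / 2)) = even_total t (0 # \<nu>) / 2"
    "int_value t {Plus} (0 # \<nu>) = odd_total t (0 # \<nu>) / 2"
    "int_value t {Minus} (0 # \<nu>) = odd_total t (0 # \<nu>) / 2"
proof -
  have "h * X / (4 * (1 - t) * h) = X / (4 * (1 - t))" if "h \<noteq> 0" for h X
    using that by simp
  note cancel = this[OF half_one_plus_nonzero[OF assms]]
  have half: "(X + X) / 2 = X" for X :: complex by simp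
  show "int_value t {} (0 # \<nu>) = even_total t (0 # \<nu>) / 2"
    "int_value t {Plus, Minus} (0 # \<nu>) / (4 * (1 - t) * ((1 + t) / 2)) = even_total t (0 # \<nu>) / 2"
    unfolding even_total_def int_value_Cons cancel
    by (simp_all only: power_0 mult_1_left half add.commute[of "int_value t {Minus} \<nu>"])
  show "int_value t {Plus} (0 # \<nu>) = odd_total t (0 # \<nu>) / 2"
    "int_value t {Minus} (0 # \<nu>) = odd_total t (0 # \<nu>) / 2"
    unfolding odd_total_def int_value_Cons
    by (simp_all only: power_0 mult_1_left half
      add.commute[of "int_value t {Plus, Minus} \<nu> / (4 * (1 - t) * ((1 + t) / 2))"])
qed

lemma hl_int_functional:
  assumes "norm t < 1" "finite J" "F \<subseteq> signs"
  shows "hl_functional t (card (spectrum F J)) (hl_int t F J)"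
  unfolding hl_functional_def
proof (intro conjI allI impI)
  fix pre post :: "complex poly list" and p q
  assume len: "length pre + length post + 1 = card (spectrum F J)"
  have int: "integrable (circles J) (\<lambda>x. eig_density t F J x * hl_sum t (pre @ r # post) (eig x) (spectrum F J))" for r
    using assms len by (intro integrable_density_hl_sum) auto
  show "hl_int t F J (pre @ (p + q) # post) = hl_int t F J (pre @ p # post) + hl_int t F J (pre @ q # post)"
    unfolding hl_int_def hl_sum_add distrib_left by (rule Bochner_Integration.integral_add[OF int int])
next
  fix pre c p post
  show "hl_int t F J (pre @ smult c p # post) = c * hl_int t F J (pre @ p # post)"
    by (rule hl_int_cong_AE[OF assms(2,3)]) (rule hl_sum_smult)
next
  fix pre p post
  show "hl_int t F J (pre @ pCons 0 p # p # post) = t * hl_int t F J (pre @ p # pCons 0 p # post)"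
    using assms by (intro hl_int_cong_AE[OF assms(2,3)] hl_sum_swap finite_spectrum generic_inj)
qed

definition partition_function :: "complex \<Rightarrow> eigen set \<Rightarrow> nat set \<Rightarrow> complex" where
  "partition_function t F J = (\<integral>x. eig_density t F J x \<partial>circles J)"

text \<open>
  The normalising integral is the integral for the exponents $0,\dots,0$.  The evaluation therefore also shows that
  the normalising integrals do not vanish.
\<close>

lemma partition_function_eq:
  assumes "norm t < 1" "finite J" "F \<subseteq> signs" "N = card (spectrum F J)"
  shows "int_value t F (replicate N 0) = tfact t N * partition_function t F J"
proof -
  have "t \<noteq> 1" using assms(1) by auto
  have "int_value t F (replicate N 0) = hl_int t F J (map (monom 1) (replicate N 0))"
    using assms by (intro hl_int_eq_value[symmetric]) auto
  also have "map (monom (1::complex)) (replicate N 0) = replicate N 1"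
    by (simp add: monom_0 one_pCons)
  also have "hl_int t F J (replicate N 1) = (\<integral>x. tfact t N * eig_density t F J x \<partial>circles J)"
    unfolding hl_int_def
  proof (rule integral_cong_AE)
    show "AE x in circles J. eig_density t F J x * hl_sum t (replicate N 1) (eig x) (spectrum F J) =
        tfact t N * eig_density t F J x"
      using AE_generic[OF assms(2)]
    proof eventually_elim
      case (elim x)
      have "0 \<notin> eig x ` spectrum F J" using generic_norm(2)[OF elim assms(3)] by auto
      then have "hl_sum t (replicate N 1) (eig x) (spectrum F J) = tfact t N"
        unfolding assms(4) using assms \<open>t \<noteq> 1\<close> generic_inj[OF elim assms(3)]
        by (intro hl_sum_ones) auto
      then show ?case by simp
    qed
  qed (use assms in \<open>intro borel_measurable_times borel_measurable_const measurable_eig_density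
      measurable_hl_sum_eig[of F]; simp\<close>)+
  finally show ?thesis by (simp add: partition_function_def)
qed

text \<open>
  Normalising by halves of a total turns the sum of the two integrals into twice a quotient of totals.
\<close>

lemma even_size_evaluation:
  assumes "norm t < 1" "n \<ge> 1" "sorted \<nu>" "length \<nu> = 2 * n"
  shows "hl_int t {} {..<n} (map (monom 1) \<nu>) / partition_function t {} {..<n} +
    hl_int t {Plus, Minus} {..<n - 1} (map (monom 1) \<nu>) / partition_function t {Plus, Minus} {..<n - 1} =
    2 * tfact t (2 * n) * even_indicator \<nu>"
proof -
  let ?N = "2 * n" and ?c = "4 * (1 - t) * ((1 + t) / 2)"
  define T E where "T = tfact t ?N" and "E = even_total t (replicate ?N 0)"
  have T: "T \<noteq> 0" using tfact_nonzero[OF assms(1)] by (simp add: T_def)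
  have E: "E \<noteq> 0" using totals_nonzero[OF assms(1)] by (simp add: E_def)
  have c: "?c \<noteq> 0" using half_one_plus_nonzero[OF assms(1)] assms(1) by auto
  obtain m where m: "?N = Suc m" using assms(2) by (cases "2 * n") auto
  have card: "?N = card (spectrum {} {..<n})" "?N = card (spectrum {Plus, Minus} {..<n - 1})"
    using assms(2) by (simp_all add: card_spectrum)
  have cancel: "X = h * (X / h)" if "h \<noteq> 0" for h X :: complex
    using that by simp
  have rep: "replicate ?N (0::nat) = 0 # replicate m 0" by (simp add: m)
  have "T * partition_function t {} {..<n} = int_value t {} (replicate ?N 0)"
    unfolding T_def by (rule partition_function_eq[OF assms(1) _ _ card(1), symmetric]) auto
  also have "\<dots> = E / 2" unfolding E_def rep by (rule totals_halves(1)[OF assms(1)])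
  finally have Z1: "T * partition_function t {} {..<n} = E / 2" .
  have "T * partition_function t {Plus, Minus} {..<n - 1} = int_value t {Plus, Minus} (replicate ?N 0)"
    unfolding T_def by (rule partition_function_eq[OF assms(1) _ _ card(2), symmetric]) auto
  also have "\<dots> = ?c * (int_value t {Plus, Minus} (replicate ?N 0) / ?c)"
    by (rule cancel[OF c])
  also have "int_value t {Plus, Minus} (replicate ?N 0) / ?c = E / 2"
    unfolding E_def rep by (rule totals_halves(2)[OF assms(1)])
  finally have Z2: "T * partition_function t {Plus, Minus} {..<n - 1} = ?c * (E / 2)" .
  have quot: "x / (E / 2) = 2 * (x / E)" "x / (?c * (E / 2)) = 2 * (x / ?c / E)" for x
    by simp_all
  have "hl_int t {} {..<n} (map (monom 1) \<nu>) = int_value t {} \<nu>"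
    "hl_int t {Plus, Minus} {..<n - 1} (map (monom 1) \<nu>) = int_value t {Plus, Minus} \<nu>"
    using assms card by (intro hl_int_eq_value; simp)+
  then have "hl_int t {} {..<n} (map (monom 1) \<nu>) / partition_function t {} {..<n} +
    hl_int t {Plus, Minus} {..<n - 1} (map (monom 1) \<nu>) / partition_function t {Plus, Minus} {..<n - 1} =
    T * (int_value t {} \<nu> / (T * partition_function t {} {..<n}) +
      int_value t {Plus, Minus} \<nu> / (T * partition_function t {Plus, Minus} {..<n - 1}))"
    using T by (simp add: distrib_left)
  also have "\<dots> = 2 * T * (even_total t \<nu> / E)"
    unfolding Z1 Z2 quot even_total_def by (simp only: add_divide_distrib distrib_left mult_ac)
  also have "even_total t \<nu> / E = even_indicator \<nu>"
    using totals_eq[OF assms(1), of \<nu>] assms(4) E by (simp add: E_def)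
  finally show ?thesis by (simp add: T_def)
qed

lemma odd_size_evaluation:
  assumes "norm t < 1" "sorted \<nu>" "length \<nu> = 2 * n + 1"
  shows "hl_int t {Plus} {..<n} (map (monom 1) \<nu>) / partition_function t {Plus} {..<n} +
    hl_int t {Minus} {..<n} (map (monom 1) \<nu>) / partition_function t {Minus} {..<n} =
    2 * tfact t (2 * n + 1) * even_indicator \<nu>"
proof -
  let ?N = "Suc (2 * n)"
  define T E where "T = tfact t ?N" and "E = odd_total t (replicate ?N 0)"
  have T: "T \<noteq> 0" using tfact_nonzero[OF assms(1)] by (simp add: T_def)
  have E: "E \<noteq> 0" using totals_nonzero(2)[OF assms(1), of n] by (simp add: E_def)
  have card: "?N = card (spectrum {Plus} {..<n})" "?N = card (spectrum {Minus} {..<n})"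
    by (simp_all add: card_spectrum)
  have Z: "T * partition_function t {Plus} {..<n} = E / 2" "T * partition_function t {Minus} {..<n} = E / 2"
    using partition_function_eq[OF assms(1) _ _ card(1)] partition_function_eq[OF assms(1) _ _ card(2)]
      totals_halves(3,4)[OF assms(1), of "replicate (2 * n) 0"]
    by (simp_all add: T_def E_def)
  have "hl_int t {Plus} {..<n} (map (monom 1) \<nu>) = int_value t {Plus} \<nu>"
    "hl_int t {Minus} {..<n} (map (monom 1) \<nu>) = int_value t {Minus} \<nu>"
    using assms card by (intro hl_int_eq_value; simp)+
  then have "hl_int t {Plus} {..<n} (map (monom 1) \<nu>) / partition_function t {Plus} {..<n} +
    hl_int t {Minus} {..<n} (map (monom 1) \<nu>) / partition_function t {Minus} {..<n} =
    T * (int_value t {Plus} \<nu> / (T * partition_function t {Plus} {..<n}) +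
      int_value t {Minus} \<nu> / (T * partition_function t {Minus} {..<n}))"
    using T by (simp add: distrib_left)
  also have "\<dots> = 2 * T * (odd_total t \<nu> / E)"
    unfolding Z odd_total_def by (simp add: add_divide_distrib distrib_left mult_ac)
  also have "odd_total t \<nu> / E = even_indicator \<nu>"
    using totals_eq[OF assms(1), of \<nu>] assms(3) E by (simp add: E_def)
  finally show ?thesis by (simp add: T_def)
qed

section \<open>The integral identities\<close>

lemma distinct_eigen_list: "distinct (eigen_list k)"
proof (rule card_distinct)
  have "length (eigen_list k) = 2 * k"
    by (induction k) (simp_all add: eigen_list_def)
  then show "card (set (eigen_list k)) = length (eigen_list k)"
    by (simp add: set_eigen_list card_spectrum)
qed

text \<open>
  Both sides are finite sums with the same terms, so this holds at every point, including those where
  denominators vanish.  Measurability of the integrand follows from it.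
\<close>

lemma hall_littlewood_spectrum:
  assumes "set fl \<subseteq> signs" "distinct fl" "length \<mu> = 2 * k + length fl"
  shows "hall_littlewood \<mu> (pm_args x k @ map fixed fl) t =
    hl_sum t (map (monom 1) (rev \<mu>)) (eig x) (spectrum (set fl) {..<k}) / vfun \<mu> t"
proof -
  let ?L = "eigen_list k @ fl"
  have len: "length ?L = length \<mu>"
  proof -
    have "length (eigen_list k) = 2 * k" by (induction k) (simp_all add: eigen_list_def)
    then show ?thesis using assms(3) by simp
  qed
  have "set (eigen_list k) \<inter> set fl = {}" using assms(1) by (auto simp: set_eigen_list spectrum_def)
  then have dist: "distinct ?L" using assms(2) distinct_eigen_list by simp
  have set: "set ?L = spectrum (set fl) {..<k}" by (auto simp: set_eigen_list spectrum_def)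
  have "map fixed fl = map (eig x) fl"
    using assms(1) by (intro map_cong refl) auto
  then have args: "pm_args x k @ map fixed fl = map (eig x) ?L"
    by (simp add: map_eig_eigen_list)
  have inj: "inj_on ((!) ?L) {..<length \<mu>}"
    using dist len by (simp add: inj_on_nth)
  have "hl_sum t (map (monom 1) (rev \<mu>)) ((!) (map (eig x) ?L)) {..<length \<mu>} =
      hl_sum t (map (monom 1) (rev \<mu>)) (\<lambda>i. eig x (?L ! i)) {..<length \<mu>}"
    using len by (intro hl_sum_cong) (simp del: map_append)
  also have "\<dots> = hl_sum t (map (monom 1) (rev \<mu>)) (eig x) ((!) ?L ` {..<length \<mu>})"
    using inj by (rule hl_sum_reindex)
  also have "(!) ?L ` {..<length \<mu>} = spectrum (set fl) {..<k}"
    unfolding set[symmetric] using len by (auto simp: set_conv_nth)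
  finally show ?thesis
    unfolding hall_littlewood_eq_hl_sum args by (simp only:)
qed

text \<open>
  The parameters $\pm s$ combine to $1 - t u^{\pm2}$.  A parameter $\pm1$ cancels
  a factor of $1 - u^{\pm2}$, while a parameter $\pm t$ leaves that factor.
\<close>

lemma one_variable_weight:
  assumes "norm t < 1" "s\<^sup>2 = t" "F \<subseteq> signs" "norm u = 1" "u \<noteq> 1" "u \<noteq> -1"
  shows "pm1 1 (u\<^sup>2) / (pm1 (if Plus \<in> F then t else 1) u * pm1 (if Minus \<in> F then - t else -1) u *
      pm1 s u * pm1 (- s) u) = weight t F u"
proof -
  have u0: "u \<noteq> 0" using assms(4) by auto
  have prod: "pm1 c u * pm1 (- c) u = pm1 (c\<^sup>2) (u\<^sup>2)" for c
    by (simp add: pm1_def power2_eq_square algebra_simps)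
  have s: "pm1 s u * pm1 (- s) u = pm1 t (u\<^sup>2)" using prod[of s] assms(2) by simp
  have one: "pm1 1 (u\<^sup>2) = pm1 1 u * pm1 (-1) u" using prod[of 1] by simp
  have "u + 1 \<noteq> 0" "inverse u + 1 \<noteq> 0"
    using inverse_unit[OF assms(4-6)] assms(6) by (simp_all add: add_eq_0_iff2)
  then have nz: "pm1 1 u \<noteq> 0" "pm1 (-1) u \<noteq> 0"
    using inverse_unit[OF assms(4-6)] assms(5) by (simp_all add: pm1_def add.commute)
  have F: "F = {} \<or> F = {Plus} \<or> F = {Minus} \<or> F = {Plus, Minus}" using assms(3) by auto
  show ?thesis
    unfolding weight_def mult.assoc[of _ "pm1 s u"] s one using F nz
    by (elim disjE) (simp_all add: divide_simps)
qed

lemma koornwinder_density_eq: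
  assumes "norm t < 1" "s\<^sup>2 = t" "F \<subseteq> signs" "generic {..<k} x"
  shows "koornwinder_density k (if Plus \<in> F then t else 1) (if Minus \<in> F then - t else -1) s (- s) t x =
    eig_density t F {..<k} x"
proof -
  have "(\<Prod>i<k. pm1 1 ((x i)\<^sup>2) / (pm1 (if Plus \<in> F then t else 1) (x i) *
      pm1 (if Minus \<in> F then - t else -1) (x i) * pm1 s (x i) * pm1 (- s) (x i))) =
      (\<Prod>i<k. weight t F (x i))"
  proof (rule prod.cong[OF refl])
    fix i assume "i \<in> {..<k}"
    then show "pm1 1 ((x i)\<^sup>2) / (pm1 (if Plus \<in> F then t else 1) (x i) *
      pm1 (if Minus \<in> F then - t else -1) (x i) * pm1 s (x i) * pm1 (- s) (x i)) = weight t F (x i)"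
      using assms generic_neq[OF assms(4)] by (intro one_variable_weight) (auto simp: generic_def)
  qed
  moreover have "{(i, j). i < j \<and> j < k} = {(i, j). i \<in> {..<k} \<and> j \<in> {..<k} \<and> i < j}" by auto
  ultimately show ?thesis
    unfolding koornwinder_density_def eig_density_def by (simp only: card_lessThan)
qed

lemma measurable_koornwinder_density:
  "koornwinder_density k a b c d t \<in> borel_measurable (torus k)"
  unfolding koornwinder_density_def[abs_def] torus_def
proof (intro borel_measurable_times borel_measurable_prod borel_measurable_const)
  fix i assume "i \<in> {..<k}"
  note [measurable] = measurable_component[OF this]
  show "(\<lambda>x. pm1 1 ((x i)\<^sup>2) / (pm1 a (x i) * pm1 b (x i) * pm1 c (x i) * pm1 d (x i))) \<in>
      borel_measurable (circles {..<k})"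
    unfolding pm1_def by measurable
next
  fix ij assume "ij \<in> {(i, j). i < j \<and> j < k}"
  then obtain i j where [simp]: "ij = (i, j)" and ij: "i \<in> {..<k}" "j \<in> {..<k}" by auto
  note [measurable] = ij[THEN measurable_component]
  show "(\<lambda>x. case ij of (i, j) \<Rightarrow> pm2 1 (x i) (x j) / pm2 t (x i) (x j)) \<in> borel_measurable (circles {..<k})"
    unfolding pm2_def by simp measurable
qed

lemma integral_koornwinder_density:
  assumes "norm t < 1" "s\<^sup>2 = t" "F \<subseteq> signs"
  shows "(\<integral>x. koornwinder_density k (if Plus \<in> F then t else 1) (if Minus \<in> F then - t else -1) s (- s) t x \<partial>torus k) =
    partition_function t F {..<k}"
  unfolding partition_function_def torus_def[symmetric]
proof (rule integral_cong_AE[OF measurable_koornwinder_density])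
  show "eig_density t F {..<k} \<in> borel_measurable (torus k)"
    unfolding torus_def by (rule measurable_eig_density[OF assms(3)])
  show "AE x in torus k. koornwinder_density k (if Plus \<in> F then t else 1) (if Minus \<in> F then - t else -1) s (- s) t x =
      eig_density t F {..<k} x"
    using AE_generic_torus by eventually_elim (rule koornwinder_density_eq[OF assms])
qed

text \<open>
  The product over the whole spectrum of $(1-\alpha z)(1-\beta z)$ is symmetric, so it
  distributes over the slots; the fixed eigenvalues contribute the prefactor.
\<close>

lemma integral_hall_littlewood:
  assumes "norm t < 1" "s\<^sup>2 = t" "set fl \<subseteq> signs" "distinct fl" "length \<mu> = 2 * k + length fl"
  shows "(\<Prod>q\<in>set fl. (1 - \<alpha> * fixed q) * (1 - \<beta> * fixed q)) *
    (\<integral>x. hall_littlewood \<mu> (pm_args x k @ map fixed fl) t *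
        koornwinder_density k (if Plus \<in> set fl then t else 1) (if Minus \<in> set fl then - t else -1) s (- s) t x *
        (\<Prod>i<k. pm1 \<alpha> (x i) * pm1 \<beta> (x i)) \<partial>torus k) =
    hl_int t (set fl) {..<k} (map (\<lambda>a. [:1, -\<alpha>:] * (monom 1 a * [:1, -\<beta>:])) (rev \<mu>)) / vfun \<mu> t"
proof -
  let ?F = "set fl" and ?g = "[:1, -\<alpha>:] * [:1, -\<beta>:]"
  let ?E = "\<Prod>q\<in>?F. (1 - \<alpha> * fixed q) * (1 - \<beta> * fixed q)"
  let ?h = "\<lambda>x. hall_littlewood \<mu> (pm_args x k @ map fixed fl) t *
        koornwinder_density k (if Plus \<in> ?F then t else 1) (if Minus \<in> ?F then - t else -1) s (- s) t x *
        (\<Prod>i<k. pm1 \<alpha> (x i) * pm1 \<beta> (x i))"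
  let ?ps = "map (\<lambda>a. [:1, -\<alpha>:] * (monom 1 a * [:1, -\<beta>:])) (rev \<mu>)"
  note hl = hall_littlewood_spectrum[OF assms(3-5), where t = t]
  have ps: "?ps = map ((*) ?g) (map (monom 1) (rev \<mu>))"
    unfolding map_map o_def by (simp only: mult_ac)
  have len: "card (spectrum ?F {..<k}) = length (map (monom (1::complex)) (rev \<mu>))"
    using assms(3-5) by (simp add: card_spectrum distinct_card)
  have meas_h: "?h \<in> borel_measurable (torus k)"
    unfolding hl
  proof (intro borel_measurable_times borel_measurable_divide borel_measurable_const borel_measurable_prod)
    show "(\<lambda>x. hl_sum t (map (monom 1) (rev \<mu>)) (eig x) (spectrum ?F {..<k})) \<in> borel_measurable (torus k)"
      unfolding torus_def using assms(3) by (intro measurable_hl_sum_eig[of ?F]) auto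
    fix i assume "i \<in> {..<k}"
    from measurable_component[OF this]
    have [measurable]: "(\<lambda>x. x i) \<in> borel_measurable (torus k)" by (simp only: torus_def)
    show "(\<lambda>x. pm1 \<alpha> (x i)) \<in> borel_measurable (torus k)" "(\<lambda>x. pm1 \<beta> (x i)) \<in> borel_measurable (torus k)"
      unfolding pm1_def by measurable
  qed (rule measurable_koornwinder_density)
  have "hl_int t ?F {..<k} ?ps = (\<integral>x. vfun \<mu> t * ?E * ?h x \<partial>torus k)"
    unfolding hl_int_def torus_def[symmetric]
  proof (rule integral_cong_AE)
    show "(\<lambda>x. eig_density t ?F {..<k} x * hl_sum t ?ps (eig x) (spectrum ?F {..<k})) \<in> borel_measurable (torus k)"
      unfolding torus_def using assms(3)
      by (intro borel_measurable_times measurable_eig_density measurable_hl_sum_eig[of ?F]) auto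
    show "(\<lambda>x. vfun \<mu> t * ?E * ?h x) \<in> borel_measurable (torus k)"
      using meas_h by (rule borel_measurable_times[OF borel_measurable_const])
    show "AE x in torus k. eig_density t ?F {..<k} x * hl_sum t ?ps (eig x) (spectrum ?F {..<k}) =
        vfun \<mu> t * ?E * ?h x"
      using AE_generic_torus
    proof eventually_elim
      case (elim x)
      have v: "vfun \<mu> t \<noteq> 0" using tfact_nonzero[OF assms(1)] by (simp add: vfun_def)
      have g: "poly ?g z = (1 - \<alpha> * z) * (1 - \<beta> * z)" for z
        by (simp add: algebra_simps)
      have "(\<Prod>b\<in>spectrum ?F {..<k}. poly ?g (eig x b)) =
          (\<Prod>i<k. pm1 \<alpha> (x i) * pm1 \<beta> (x i)) * (\<Prod>q\<in>?F. (1 - \<alpha> * eig x q) * (1 - \<beta> * eig x q))"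
        unfolding g prod_spectrum[OF finite_lessThan assms(3)]
        by (simp add: pm1_def mult_ac)
      also have "(\<Prod>q\<in>?F. (1 - \<alpha> * eig x q) * (1 - \<beta> * eig x q)) = ?E"
        using assms(3) by (intro prod.cong) auto
      finally have "hl_sum t ?ps (eig x) (spectrum ?F {..<k}) =
          (\<Prod>i<k. pm1 \<alpha> (x i) * pm1 \<beta> (x i)) * ?E * hl_sum t (map (monom 1) (rev \<mu>)) (eig x) (spectrum ?F {..<k})"
        unfolding ps using hl_sum_mult[OF _ len] assms(3) by simp
      then show ?case
        unfolding hl koornwinder_density_eq[OF assms(1-3) elim] using v by simp
    qed
  qed
  also have "\<dots> = vfun \<mu> t * (?E * (\<integral>x. ?h x \<partial>torus k))"
    by simp
  finally show ?thesis
    using tfact_nonzero[OF assms(1)] by (simp add: vfun_def)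
qed

lemma even_part_rev: "even_part (rev \<mu>) \<alpha> \<beta> t = even_part \<mu> \<alpha> \<beta> t"
  by (simp add: even_part_def)

lemma odd_part_rev: "odd_part (rev \<mu>) \<alpha> \<beta> t = odd_part \<mu> \<alpha> \<beta> t"
  by (simp add: odd_part_def rev_filter[symmetric])

lemma tfact_eq_phi: "tfact t N = phi N t / (1 - t) ^ N"
  by (simp add: tfact_def tint_def phi_def prod_dividef)

theorem theorem5p1:
  fixes t s \<alpha> \<beta> :: complex
  assumes "norm t < 1" and "s\<^sup>2 = t"
  shows
    "(\<forall>n \<mu>. n \<ge> 1 \<and> is_partition (2 * n) \<mu> \<longrightarrow>
        1 / (\<integral>x. koornwinder_density n 1 (-1) s (-s) t x \<partial>torus n) *
          (\<integral>x. hall_littlewood \<mu> (pm_args x n) t * koornwinder_density n 1 (-1) s (-s) t x *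
                (\<Prod>i<n. pm1 \<alpha> (x i) * pm1 \<beta> (x i)) \<partial>torus n)
      + (1 - \<alpha>\<^sup>2) * (1 - \<beta>\<^sup>2)
          / (\<integral>x. koornwinder_density (n - 1) t (-t) s (-s) t x \<partial>torus (n - 1)) *
          (\<integral>x. hall_littlewood \<mu> (pm_args x (n - 1) @ [1, -1]) t *
                koornwinder_density (n - 1) t (-t) s (-s) t x *
                (\<Prod>i<n - 1. pm1 \<alpha> (x i) * pm1 \<beta> (x i)) \<partial>torus (n - 1))
      = 2 * phi (2 * n) t / (vfun \<mu> t * (1 - t) ^ (2 * n)) *
          (even_part \<mu> \<alpha> \<beta> t * odd_part \<mu> \<alpha> \<beta> t))
   \<and> (\<forall>n \<mu>. is_partition (2 * n + 1) \<mu> \<longrightarrow>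
        (1 - \<alpha>) * (1 - \<beta>)
          / (\<integral>x. koornwinder_density n t (-1) s (-s) t x \<partial>torus n) *
          (\<integral>x. hall_littlewood \<mu> (pm_args x n @ [1]) t * koornwinder_density n t (-1) s (-s) t x *
                (\<Prod>i<n. pm1 \<alpha> (x i) * pm1 \<beta> (x i)) \<partial>torus n)
      + (1 + \<alpha>) * (1 + \<beta>)
          / (\<integral>x. koornwinder_density n 1 (-t) s (-s) t x \<partial>torus n) *
          (\<integral>x. hall_littlewood \<mu> (pm_args x n @ [-1]) t * koornwinder_density n 1 (-t) s (-s) t x *
                (\<Prod>i<n. pm1 \<alpha> (x i) * pm1 \<beta> (x i)) \<partial>torus n)
      = 2 * phi (2 * n + 1) t / (vfun \<mu> t * (1 - t) ^ (2 * n + 1)) *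
          (even_part \<mu> \<alpha> \<beta> t * odd_part \<mu> \<alpha> \<beta> t))"
proof (intro conjI allI impI, goal_cases)
  have quot: "a / z * j = x / z" if "a * j = x" for a z j x :: complex
    using that by simp
  case (1 n \<mu>)
  then have n: "n \<ge> 1" and len: "length \<mu> = 2 * n" and sorted: "sorted (rev \<mu>)"
    by (auto simp: is_partition_def sorted_wrt_rev)
  let ?ps = "map (\<lambda>a. [:1, -\<alpha>:] * (monom 1 a * [:1, -\<beta>:])) (rev \<mu>)"
  let ?Z = "partition_function t {} {..<n}" and ?Z' = "partition_function t {Plus, Minus} {..<n - 1}"
  let ?L = "\<lambda>ps. hl_int t {} {..<n} ps / ?Z + hl_int t {Plus, Minus} {..<n - 1} ps / ?Z'"
  have "hl_functional t (2 * n) (hl_int t {} {..<n})"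
    using hl_int_functional[OF assms(1), of "{..<n}" "{}"] by (simp add: card_spectrum)
  moreover have "hl_functional t (2 * n) (hl_int t {Plus, Minus} {..<n - 1})"
  proof -
    have "card (spectrum {Plus, Minus} {..<n - 1}) = 2 * n" using n by (simp add: card_spectrum)
    then show ?thesis using hl_int_functional[OF assms(1), of "{..<n - 1}" "{Plus, Minus}"] by simp
  qed
  ultimately have L: "hl_functional t (2 * n) ?L" by (rule hl_functional_combine)
  have val: "?L ?ps = 2 * tfact t (2 * n) * (even_part (rev \<mu>) \<alpha> \<beta> t * odd_part (rev \<mu>) \<alpha> \<beta> t)"
    using even_size_evaluation[OF assms(1) n] sorted len
    by (intro hl_functional_two_factors[OF L assms(1)]) auto
  have E: "(\<Prod>q\<in>{Plus, Minus}. (1 - \<alpha> * fixed q) * (1 - \<beta> * fixed q)) = (1 - \<alpha>\<^sup>2) * (1 - \<beta>\<^sup>2)"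
    by (simp add: power2_eq_square algebra_simps)
  have I: "(\<integral>x. hall_littlewood \<mu> (pm_args x n) t * koornwinder_density n 1 (-1) s (-s) t x *
                (\<Prod>i<n. pm1 \<alpha> (x i) * pm1 \<beta> (x i)) \<partial>torus n) = hl_int t {} {..<n} ?ps / vfun \<mu> t"
    using integral_hall_littlewood[OF assms, of "[]" \<mu> n \<alpha> \<beta>] len by simp
  have I': "(1 - \<alpha>\<^sup>2) * (1 - \<beta>\<^sup>2) * (\<integral>x. hall_littlewood \<mu> (pm_args x (n - 1) @ [1, -1]) t *
                koornwinder_density (n - 1) t (-t) s (-s) t x *
                (\<Prod>i<n - 1. pm1 \<alpha> (x i) * pm1 \<beta> (x i)) \<partial>torus (n - 1)) =
      hl_int t {Plus, Minus} {..<n - 1} ?ps / vfun \<mu> t"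
    using integral_hall_littlewood[OF assms, of "[Plus, Minus]" \<mu> "n - 1" \<alpha> \<beta>] len n
    unfolding list.set E by simp
  have Z: "(\<integral>x. koornwinder_density n 1 (-1) s (-s) t x \<partial>torus n) = ?Z"
    using integral_koornwinder_density[OF assms, of "{}" n] by simp
  have Z': "(\<integral>x. koornwinder_density (n - 1) t (-t) s (-s) t x \<partial>torus (n - 1)) = ?Z'"
    using integral_koornwinder_density[OF assms, of "{Plus, Minus}" "n - 1"] by simp
  have "1 / ?Z * (hl_int t {} {..<n} ?ps / vfun \<mu> t) + hl_int t {Plus, Minus} {..<n - 1} ?ps / vfun \<mu> t / ?Z' =
      ?L ?ps / vfun \<mu> t"
    by (simp add: add_divide_distrib mult.commute)
  also have "\<dots> = 2 * phi (2 * n) t / (vfun \<mu> t * (1 - t) ^ (2 * n)) *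
      (even_part \<mu> \<alpha> \<beta> t * odd_part \<mu> \<alpha> \<beta> t)"
    unfolding val even_part_rev odd_part_rev tfact_eq_phi by (simp add: mult_ac)
  finally show ?case unfolding I Z Z' quot[OF I'] .
next
  have quot: "a / z * j = x / z" if "a * j = x" for a z j x :: complex
    using that by simp
  case (2 n \<mu>)
  then have len: "length \<mu> = 2 * n + 1" and sorted: "sorted (rev \<mu>)"
    by (auto simp: is_partition_def sorted_wrt_rev)
  let ?ps = "map (\<lambda>a. [:1, -\<alpha>:] * (monom 1 a * [:1, -\<beta>:])) (rev \<mu>)"
  let ?Z = "partition_function t {Plus} {..<n}" and ?Z' = "partition_function t {Minus} {..<n}"
  let ?L = "\<lambda>ps. hl_int t {Plus} {..<n} ps / ?Z + hl_int t {Minus} {..<n} ps / ?Z'"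
  have "hl_functional t (2 * n + 1) (hl_int t {Plus} {..<n})" "hl_functional t (2 * n + 1) (hl_int t {Minus} {..<n})"
    using hl_int_functional[OF assms(1), of "{..<n}" "{Plus}"] hl_int_functional[OF assms(1), of "{..<n}" "{Minus}"]
    by (simp_all add: card_spectrum)
  then have L: "hl_functional t (2 * n + 1) ?L" by (rule hl_functional_combine)
  have val: "?L ?ps = 2 * tfact t (2 * n + 1) * (even_part (rev \<mu>) \<alpha> \<beta> t * odd_part (rev \<mu>) \<alpha> \<beta> t)"
    using odd_size_evaluation[OF assms(1)] sorted len
    by (intro hl_functional_two_factors[OF L assms(1)]) auto
  have I: "(1 - \<alpha>) * (1 - \<beta>) * (\<integral>x. hall_littlewood \<mu> (pm_args x n @ [1]) t * koornwinder_density n t (-1) s (-s) t x *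
                (\<Prod>i<n. pm1 \<alpha> (x i) * pm1 \<beta> (x i)) \<partial>torus n) = hl_int t {Plus} {..<n} ?ps / vfun \<mu> t"
    using integral_hall_littlewood[OF assms, of "[Plus]" \<mu> n \<alpha> \<beta>] len by simp
  have I': "(1 + \<alpha>) * (1 + \<beta>) * (\<integral>x. hall_littlewood \<mu> (pm_args x n @ [-1]) t * koornwinder_density n 1 (-t) s (-s) t x *
                (\<Prod>i<n. pm1 \<alpha> (x i) * pm1 \<beta> (x i)) \<partial>torus n) = hl_int t {Minus} {..<n} ?ps / vfun \<mu> t"
    using integral_hall_littlewood[OF assms, of "[Minus]" \<mu> n \<alpha> \<beta>] len by simp
  have Z: "(\<integral>x. koornwinder_density n t (-1) s (-s) t x \<partial>torus n) = ?Z"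
    using integral_koornwinder_density[OF assms, of "{Plus}" n] by simp
  have Z': "(\<integral>x. koornwinder_density n 1 (-t) s (-s) t x \<partial>torus n) = ?Z'"
    using integral_koornwinder_density[OF assms, of "{Minus}" n] by simp
  have "hl_int t {Plus} {..<n} ?ps / vfun \<mu> t / ?Z + hl_int t {Minus} {..<n} ?ps / vfun \<mu> t / ?Z' = ?L ?ps / vfun \<mu> t"
    by (simp add: add_divide_distrib mult.commute)
  also have "\<dots> = 2 * phi (2 * n + 1) t / (vfun \<mu> t * (1 - t) ^ (2 * n + 1)) *
      (even_part \<mu> \<alpha> \<beta> t * odd_part \<mu> \<alpha> \<beta> t)"
    unfolding val even_part_rev odd_part_rev tfact_eq_phi
    by (simp only: times_divide_eq_left times_divide_eq_right divide_divide_eq_left mult_ac)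
  finally show ?case unfolding Z Z' quot[OF I] quot[OF I'] .
qed

end
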